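(* Let $\omega\subseteq\Omega$ be a union of elements of $\mathcal T_h$ such that $\operatorname{supp} f\subseteq\omega$, $\operatorname{supp}u_h^1\subseteq\omega$, and $\operatorname{supp}u_h^0\subseteq\omega$. Then for $\ell\in\mathbb N$ the error $\xi^n:=\tilde u_h^{n+1/2}-u_h^{n+1/2}$ between the solution $(u_h^n)_{n\ge0}\subset V_h$ of the global Crank--Nicolson scheme and the solution $(\tilde u_h^n)_{n\ge0}$ of the localized Crank--Nicolson scheme on $\mathtt N_\ell(\omega)$ (with $\tilde u_h^0=u_h^0$, $\tilde u_h^1=u_h^1$) fulfills $$|||\xi^n|||=|||u_h^{n+1/2}-\tilde u_h^{n+1/2}|||\lesssim C_{\tau,h}\,(9\ell)^{n/2}\,\gamma^{\ell}\,\max_{k\le n}|||u_h^{k+1/2}|||$$ for any $n\in\mathbb N_0$, where $$0<\gamma=\sqrt{\frac{C_{\tau,h}+\frac12}{1+C_{\tau,h}}}<1$$ for a constant $$C_{\tau,h}\eqsim\beta\alpha^{-1}\Big(\frac\tau h+\frac h\tau\Big)$$ that also depends on $d$.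
   Context: Setting. $\Omega\subset\mathbb R^d$ is an open, bounded, connected Lipschitz polytope with $\operatorname{diam}(\Omega)\eqsim1$. $A\in L^\infty(\Omega)$ is a scalar coefficient with $0<\alpha\le A(x)\le\beta$ for almost every $x\in\Omega$. The function $f\in L^\infty(0,t_{\mathrm{fin}};L^2(\Omega))$ is the right-hand side of the wave equation $\partial_t^2u-\nabla\cdot(A\nabla u)=f$ in $\Omega\times(0,t_{\mathrm{fin}})$ with zero Dirichlet boundary conditions; its support is understood with respect to the space variable. For measurable $S\subseteq\Omega$ write $(\cdot,\cdot)_S$ and $\|\cdot\|_S$ for the inner product and norm of $L^2(S)$, $a_S(v,w):=(A\nabla v,\nabla w)_S$, $\|v\|_{a,S}^2:=a_S(v,v)$; the index is dropped if $S=\Omega$. Space discretization. $\mathcal T_h$ is a regular and quasi-uniform mesh of $\Omega$ into parallelepipeds with mesh size $h$, and $V_h\subset H^1_0(\Omega)$ is the first-order ($Q_1$) conforming finite element space on $\mathcal T_h$ with zero boundary values. For $S\subseteq\Omega$, $V_h(S):=\{v_h\in V_h:\operatorname{supp}(v_h)\subseteq\overline S\}$. Patches. For $\omega\subseteq\Omega$, $\mathtt N(\omega)=\mathtt N_1(\omega)$ is the interior of the union of all closed elements $\overline K$, $K\in\mathcal T_h$, with $\overline K\cap\overline\omega\ne\emptyset$; $\mathtt N_\ell(\omega):=\mathtt N(\mathtt N_{\ell-1}(\omega))$ for $\ell\ge2$. Time discretization. $\tau>0$ is the time step size. For a sequence $(z^n)_{n\ge0}$ put $\hat\partial_\tau^2z^n:=\tau^{-2}(z^{n+1}-2z^n+z^{n-1})$,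 $\widehat{z^n}:=\frac14(z^{n+1}+2z^n+z^{n-1})$, and $z^{n+1/2}:=\frac12(z^{n+1}+z^n)$. Given initial conditions $u_h^0,u_h^1\in V_h$ and functions $f_h^k\in V_h$, where $f_h^k$ is an approximation of $f(k\tau)$ in $V_h$, e.g. its $L^2$-projection, the global Crank--Nicolson scheme seeks $(u_h^n)_n\subset V_h$ such that for $n\ge1$ $$(\hat\partial_\tau^2u_h^n,v_h)+a(\widehat{u_h^n},v_h)=(\widehat{f_h^n},v_h)\quad\text{for all }v_h\in V_h.$$ The localized scheme on $\mathtt N_\ell(\omega)$ seeks $\tilde u_h^{n}\in V_h(\mathtt N_\ell(\omega))$, $n\ge2$, with $\tilde u_h^0=u_h^0$, $\tilde u_h^1=u_h^1$ in $V_h(\omega)$, such that for $n\ge1$ $$(\hat\partial_\tau^2\tilde u_h^n,v_h)_{\mathtt N_\ell(\omega)}+a_{\mathtt N_\ell(\omega)}(\widehat{\tilde u_h^n},v_h)=(\widehat{f_h^n},v_h)_{\mathtt N_\ell(\omega)}\quad\text{for all }v_h\in V_h(\mathtt N_\ell(\omega)).$$ Norm. $|||v_h|||^2:=\|v_h\|^2+\frac{\tau^2}{4}\|v_h\|_{a}^2$ for $v_h\in V_h$. Convention. The index $k$ in the maximum ranges over nonnegative integers. $\theta\lesssim\eta$ means $\theta\le C\eta$ with a generic constant $C>0$ that is independent of the discretization scales but might depend on $d$, $\alpha$, $\beta$; $\theta\eqsim\eta$ means $\theta\lesssim\eta\lesssim\theta$. *)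

theory Defs
  imports "HOL-Analysis.Analysis"
begin

section \<open>Domain\<close>

text \<open>A polytope in the sense of finite element theory need not be convex: its closure is a
  finite union of convex polytopes. The Lipschitz condition is the usual one: near every boundary
  point, and in suitable rotated coordinates, the domain is the set of points strictly above the
  graph of a Lipschitz function. Here \<open>e\<close> is the vertical direction and \<open>y - (y \<bullet> e) *\<^sub>R e\<close> is the
  horizontal part of \<open>y\<close>.\<close>

definition lipschitz_polytope :: "(real^'d) set \<Rightarrow> bool" where
  "lipschitz_polytope \<Omega> \<longleftrightarrow>
     open \<Omega> \<and> bounded \<Omega> \<and> connected \<Omega> \<and>
     (\<exists>P. finite P \<and> (\<forall>p\<in>P. polytope p) \<and> closure \<Omega> = \<Union>P) \<and>
     (\<forall>x\<in>frontier \<Omega>. \<exists>U e L \<phi>. open U \<and> x \<in> U \<and> norm e = 1 \<and> L-lipschitz_on UNIV \<phi> \<and>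
        \<Omega> \<inter> U = {y \<in> U. \<phi> (y - (y \<bullet> e) *\<^sub>R e) < y \<bullet> e})"


section \<open>Square integrable functions\<close>

text \<open>Elements of $L^2$ are handled through representatives.\<close>

definition L2 :: "(real^'d) set \<Rightarrow> (real^'d \<Rightarrow> real) set" where
  "L2 S = {g. g \<in> borel_measurable (lebesgue_on S) \<and> integrable (lebesgue_on S) (\<lambda>x. (g x)\<^sup>2)}"

definition L2_inner :: "(real^'d) set \<Rightarrow> (real^'d \<Rightarrow> real) \<Rightarrow> (real^'d \<Rightarrow> real) \<Rightarrow> real" where
  "L2_inner S v w = (LINT x|lebesgue_on S. v x * w x)"

definition L2_norm :: "(real^'d) set \<Rightarrow> (real^'d \<Rightarrow> real) \<Rightarrow> real" where
  "L2_norm S v = sqrt (L2_inner S v v)"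

text \<open>The Bochner space $L^\infty(0,t_{\mathrm{fin}};L^2(\Omega))$: strongly measurable (an almost
  everywhere limit of simple functions) and essentially bounded.\<close>

definition Linf_L2 :: "real \<Rightarrow> (real^'d) set \<Rightarrow> (real \<Rightarrow> real^'d \<Rightarrow> real) \<Rightarrow> bool" where
  "Linf_L2 tfin \<Omega> f \<longleftrightarrow>
     (AE t in lebesgue_on {0<..<tfin}. f t \<in> L2 \<Omega>) \<and>
     (\<exists>s. (\<forall>j. simple_function (lebesgue_on {0<..<tfin}) (s j) \<and> (\<forall>t. s j t \<in> L2 \<Omega>)) \<and>
          (AE t in lebesgue_on {0<..<tfin}.
             (\<lambda>j. L2_norm \<Omega> (\<lambda>x. s j t x - f t x)) \<longlonglongrightarrow> 0)) \<and>
     (\<exists>M. AE t in lebesgue_on {0<..<tfin}. L2_norm \<Omega> (f t) \<le> M)"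

text \<open>The support of an $L^2$ function is insensitive to null sets.\<close>

definition ess_supp :: "(real^'d) set \<Rightarrow> (real^'d \<Rightarrow> real) \<Rightarrow> (real^'d) set" where
  "ess_supp \<Omega> g =
     closure \<Omega> - \<Union>{U. open U \<and> (AE x in lebesgue. x \<in> U \<inter> \<Omega> \<longrightarrow> g x = 0)}"


section \<open>Meshes of parallelepipeds\<close>

definition affine_ref :: "real^'d \<Rightarrow> real^'d^'d \<Rightarrow> real^'d \<Rightarrow> real^'d" where
  "affine_ref b M x = b + M *v x"

text \<open>Elements are open; their closures are the closed elements.\<close>

definition parallelepiped :: "(real^'d) set \<Rightarrow> bool" where
  "parallelepiped K \<longleftrightarrow> (\<exists>b M. invertible M \<and> K = affine_ref b M ` box 0 1)"

text \<open>In \<open>regular_mesh \<Omega> \<sigma> h T\<close> the number \<open>\<sigma>\<close> bounds both the shape regularity and the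
  quasi-uniformity of the mesh, and \<open>h\<close> is the largest element diameter. Two closed elements meet
  in a common face (possibly empty), so there are no hanging nodes.\<close>

definition regular_mesh :: "(real^'d) set \<Rightarrow> real \<Rightarrow> real \<Rightarrow> (real^'d) set set \<Rightarrow> bool" where
  "regular_mesh \<Omega> \<sigma> h T \<longleftrightarrow>
     finite T \<and> (\<forall>K\<in>T. parallelepiped K) \<and> disjoint T \<and>
     (\<Union>K\<in>T. closure K) = closure \<Omega> \<and>
     (\<forall>K\<in>T. \<forall>K'\<in>T. (closure K \<inter> closure K') face_of closure K) \<and>
     h = Max (diameter ` T) \<and>
     (\<forall>K\<in>T. \<exists>x. ball x (diameter K / \<sigma>) \<subseteq> K) \<and>
     (\<forall>K\<in>T. h \<le> \<sigma> * diameter K)"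

definition patch :: "(real^'d) set set \<Rightarrow> (real^'d) set \<Rightarrow> (real^'d) set" where
  "patch T \<omega> = interior (\<Union>{closure K | K. K \<in> T \<and> closure K \<inter> closure \<omega> \<noteq> {}})"

definition patch_iter :: "(real^'d) set set \<Rightarrow> nat \<Rightarrow> (real^'d) set \<Rightarrow> (real^'d) set" where
  "patch_iter T l \<omega> = (patch T ^^ l) \<omega>"


section \<open>The Q1 finite element space\<close>

text \<open>Polynomials of degree at most one in each variable.\<close>

definition Q1_poly :: "(real^'d \<Rightarrow> real) \<Rightarrow> bool" where
  "Q1_poly q \<longleftrightarrow> (\<exists>c :: 'd set \<Rightarrow> real. \<forall>x. q x = (\<Sum>I\<in>UNIV. c I * (\<Prod>i\<in>I. x $ i)))"

text \<open>On an element, a Q1 function is the push-forward of such a polynomial under the affine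
  reference map. The maps onto a given parallelepiped differ only by a symmetry of the unit cube,
  which preserves the Q1 polynomials.\<close>

definition Q1_on :: "(real^'d) set \<Rightarrow> (real^'d \<Rightarrow> real) \<Rightarrow> bool" where
  "Q1_on K v \<longleftrightarrow> (\<exists>b M q. invertible M \<and> K = affine_ref b M ` box 0 1 \<and> Q1_poly q \<and>
     (\<forall>x\<in>box 0 1. v (affine_ref b M x) = q x))"

text \<open>Functions are extended by zero to the whole space; with this convention, continuity on the
  whole space encodes both $H^1$-conformity and the zero boundary values.\<close>

definition Vh :: "(real^'d) set \<Rightarrow> (real^'d) set set \<Rightarrow> (real^'d \<Rightarrow> real) set" where
  "Vh \<Omega> T = {v. continuous_on UNIV v \<and> (\<forall>x. x \<notin> \<Omega> \<longrightarrow> v x = 0) \<and> (\<forall>K\<in>T. Q1_on K v)}"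

definition Vh_on ::
  "(real^'d) set \<Rightarrow> (real^'d) set set \<Rightarrow> (real^'d) set \<Rightarrow> (real^'d \<Rightarrow> real) set" where
  "Vh_on \<Omega> T S = {v \<in> Vh \<Omega> T. closure {x. v x \<noteq> 0} \<subseteq> closure S}"

text \<open>Finite element functions are smooth inside each element, and their weak gradient is the
  classical gradient there. On the mesh skeleton, a null set, \<open>grad v\<close> may be arbitrary.\<close>

definition grad :: "(real^'d \<Rightarrow> real) \<Rightarrow> real^'d \<Rightarrow> real^'d" where
  "grad v x = (THE D. GDERIV v x :> D)"

definition energy_form ::
  "(real^'d \<Rightarrow> real) \<Rightarrow> (real^'d) set \<Rightarrow> (real^'d \<Rightarrow> real) \<Rightarrow> (real^'d \<Rightarrow> real) \<Rightarrow> real" where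
  "energy_form A S v w = (LINT x|lebesgue_on S. (A x *\<^sub>R grad v x) \<bullet> grad w x)"

definition tau_norm ::
  "(real^'d \<Rightarrow> real) \<Rightarrow> (real^'d) set \<Rightarrow> real \<Rightarrow> (real^'d \<Rightarrow> real) \<Rightarrow> real" where
  "tau_norm A \<Omega> \<tau> v = sqrt ((L2_norm \<Omega> v)\<^sup>2 + \<tau>\<^sup>2 / 4 * energy_form A \<Omega> v v)"


section \<open>Time discretization\<close>

definition diff2 :: "real \<Rightarrow> (nat \<Rightarrow> real^'d \<Rightarrow> real) \<Rightarrow> nat \<Rightarrow> real^'d \<Rightarrow> real" where
  "diff2 \<tau> z n = (\<lambda>x. (z (n + 1) x - 2 * z n x + z (n - 1) x) / \<tau>\<^sup>2)"

definition avg3 :: "(nat \<Rightarrow> real^'d \<Rightarrow> real) \<Rightarrow> nat \<Rightarrow> real^'d \<Rightarrow> real" where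
  "avg3 z n = (\<lambda>x. (z (n + 1) x + 2 * z n x + z (n - 1) x) / 4)"

definition mid :: "(nat \<Rightarrow> real^'d \<Rightarrow> real) \<Rightarrow> nat \<Rightarrow> real^'d \<Rightarrow> real" where
  "mid z n = (\<lambda>x. (z (n + 1) x + z n x) / 2)"

text \<open>Crank--Nicolson scheme on the region \<open>S\<close> with trial and test space \<open>W\<close>. The initial
  conditions are the members \<open>z 0\<close> and \<open>z 1\<close>.\<close>

definition crank_nicolson ::
  "(real^'d \<Rightarrow> real) \<Rightarrow> real \<Rightarrow> (real^'d) set \<Rightarrow> (real^'d \<Rightarrow> real) set \<Rightarrow>
   (nat \<Rightarrow> real^'d \<Rightarrow> real) \<Rightarrow> (nat \<Rightarrow> real^'d \<Rightarrow> real) \<Rightarrow> bool" where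
  "crank_nicolson A \<tau> S W fh z \<longleftrightarrow>
     (\<forall>n. z n \<in> W) \<and>
     (\<forall>n\<ge>1. \<forall>v\<in>W. L2_inner S (diff2 \<tau> z n) v + energy_form A S (avg3 z n) v
                     = L2_inner S (avg3 fh n) v)"

text \<open>\<open>gh\<close> is an admissible approximation of \<open>g\<close> in the finite element space if it acts like \<open>g\<close> on
  test functions supported away from \<open>\<omega>\<close>. Some such condition is implicit when the data are said to
  be localized in \<open>\<omega>\<close>. When \<open>g\<close> is supported in \<open>\<omega>\<close>, it allows the $L^2$-projection, which is itself
  not supported in \<open>\<omega>\<close>, and also every finite element function supported in \<open>\<omega>\<close>; see the two lemmas
  below.\<close>

definition fe_approximation ::
  "(real^'d) set \<Rightarrow> (real^'d) set set \<Rightarrow> (real^'d) set \<Rightarrow>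
   (real^'d \<Rightarrow> real) \<Rightarrow> (real^'d \<Rightarrow> real) \<Rightarrow> bool" where
  "fe_approximation \<Omega> T \<omega> g gh \<longleftrightarrow>
     gh \<in> Vh \<Omega> T \<and>
     (\<forall>v\<in>Vh_on \<Omega> T (\<Omega> - closure \<omega>). L2_inner \<Omega> gh v = L2_inner \<Omega> g v)"

lemma fe_approximation_L2_projection:
  assumes "gh \<in> Vh \<Omega> T" "\<And>v. v \<in> Vh \<Omega> T \<Longrightarrow> L2_inner \<Omega> gh v = L2_inner \<Omega> g v"
  shows "fe_approximation \<Omega> T \<omega> g gh"
  using assms by (auto simp: fe_approximation_def Vh_on_def)

lemma AE_zero_off_ess_supp:
  fixes g :: "real^'d \<Rightarrow> real"
  assumes "open \<Omega>"
  shows "AE x in lebesgue. x \<in> \<Omega> - ess_supp \<Omega> g \<longrightarrow> g x = 0"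
proof -
  let ?F = "{U. open U \<and> (AE x in lebesgue. x \<in> U \<inter> \<Omega> \<longrightarrow> g x = 0)}"
  obtain F where F: "F \<subseteq> ?F" "countable F" "\<Union>F = \<Union>?F"
    using Lindelof[of ?F] by auto
  have "AE x in lebesgue. \<forall>U\<in>F. x \<in> U \<inter> \<Omega> \<longrightarrow> g x = 0"
    using F(1) by (subst AE_ball_countable[OF F(2)]) blast
  moreover have "x \<in> \<Union>F" if "x \<in> \<Omega> - ess_supp \<Omega> g" for x
    using that closure_subset[of \<Omega>] unfolding ess_supp_def F(3) by blast
  ultimately show ?thesis
    by (auto elim!: eventually_mono)
qed

lemma fe_approximation_supported:
  assumes "open \<Omega>" "open \<omega>" "gh \<in> Vh_on \<Omega> T \<omega>" "ess_supp \<Omega> g \<subseteq> closure \<omega>"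
  shows "fe_approximation \<Omega> T \<omega> g gh"
  unfolding fe_approximation_def
proof (intro conjI ballI)
  show "gh \<in> Vh \<Omega> T"
    using assms by (simp add: Vh_on_def)
  fix v assume v: "v \<in> Vh_on \<Omega> T (\<Omega> - closure \<omega>)"
  have "open {x. v x \<noteq> 0}"
    using v by (auto simp: Vh_on_def Vh_def intro!: open_Collect_neq)
  moreover have "{x. v x \<noteq> 0} \<subseteq> closure (\<Omega> - closure \<omega>)"
    using v closure_subset[of "{x. v x \<noteq> 0}"] unfolding Vh_on_def by blast
  moreover have "closure (\<Omega> - closure \<omega>) \<inter> \<omega> = {}"
    using assms(2) closure_subset[of \<omega>] open_Int_closure_eq_empty[of \<omega> "\<Omega> - closure \<omega>"]
    by blast
  ultimately have off: "v x = 0" if "x \<in> closure \<omega>" for x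
    using that open_Int_closure_eq_empty[of "{x. v x \<noteq> 0}" \<omega>] by blast
  have "gh x * v x = 0" for x
  proof (cases "x \<in> closure \<omega>")
    case False
    then have "gh x = 0"
      using assms(3) closure_subset[of "{x. gh x \<noteq> 0}"] unfolding Vh_on_def by blast
    then show ?thesis by simp
  qed (use off in simp)
  then have "L2_inner \<Omega> gh v = 0"
    by (simp only: L2_inner_def Bochner_Integration.integral_zero)
  moreover have "AE x in lebesgue_on \<Omega>. g x * v x = 0"
  proof -
    have "AE x in lebesgue. x \<in> \<Omega> \<longrightarrow> g x * v x = 0"
      using AE_zero_off_ess_supp[OF assms(1), of g] by eventually_elim (use off assms(4) in auto)
    then show ?thesis
      using assms(1) by (subst AE_restrict_space_iff) auto
  qed
  then have "L2_inner \<Omega> g v = 0"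
    unfolding L2_inner_def by (rule integral_eq_zero_AE)
  ultimately show "L2_inner \<Omega> gh v = L2_inner \<Omega> g v"
    by simp
qed

end

theory Submission
  imports Defs
begin

text \<open>Write \<open>m(v,w) = (v,w) + \<tau>\<^sup>2/4 a(v,w)\<close> for the inner product of the norm, and \<open>U\<^sup>n\<close> for the
  midpoint values of the global solution. The sum of the Crank--Nicolson equations for two consecutive
  times is the recursion \<open>m(U\<^sup>n, v) = 2 (U\<^sup>n\<^sup>-\<^sup>1, v) - 2 \<tau>\<^sup>2/4 a(U\<^sup>n\<^sup>-\<^sup>1, v) - m(U\<^sup>n\<^sup>-\<^sup>2, v)\<close> for test
  functions \<open>v\<close> away from the data (\<open>midpoint_recursion\<close>). So every time step solves an elliptic problem for
  the form \<open>m\<close>, and its right-hand side is bounded locally by \<open>2 |||U\<^sup>n\<^sup>-\<^sup>1||| + |||U\<^sup>n\<^sup>-\<^sup>2|||\<close>.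

  Such a solution decays exponentially away from the data. Let \<open>v\<close> arise from \<open>U\<^sup>n\<close> by deleting all nodal
  values on the first \<open>k\<close> layers of elements around the data. It vanishes on these layers, and it equals
  \<open>U\<^sup>n\<close> outside \<open>k + 1\<close> layers. On the elements in between, inverse estimates bound its norm by a constant
  \<open>c\<close> times the norm of \<open>U\<^sup>n\<close>, where \<open>c\<close> is of the order \<open>\<tau>/h + h/\<tau>\<close> (\<open>elem_norm_le_of_vertices\<close>). Testing
  with \<open>v\<close> bounds the energy outside \<open>k + 1\<close> layers by the energy in one layer plus contributions of the two
  previous time steps. The energy in one layer is the difference of two consecutive outer energies, so the
  outer energy \<open>E n k\<close> satisfies \<open>E n (k+1) \<le> \<rho> (E n k + 2 E (n-1) k + E (n-2) k)\<close> with
  \<open>\<rho> = 3c/(1+3c)\<close> (\<open>outer_energy_decay\<close>). Hence \<open>E n k \<le> \<rho>\<^sup>k (1+2k)\<^sup>n max\<^sub>j |||U\<^sup>j|||\<^sup>2\<close>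
  (\<open>global_solution_decay\<close>), and \<open>\<rho> \<le> \<gamma>\<^sup>2\<close> as soon as \<open>C\<^bsub>\<tau>,h\<^esub> \<ge> 3c/2\<close>; the choice below is
  \<open>C\<^bsub>\<tau>,h\<^esub> = 2c\<close>.

  The error satisfies the same recursion with test functions from the local space. Up to the
  truncation of \<open>U\<^sup>n\<close> to the outside of \<open>\<ell> - 1\<close> layers, which has norm at most \<open>c (E n (\<ell>-1))\<^sup>1\<^sup>/\<^sup>2\<close>, the error is
  itself an admissible test function. This gives \<open>|||\<xi>\<^sup>n||| \<le> 2 c (E n (\<ell>-1))\<^sup>1\<^sup>/\<^sup>2 + 2 |||\<xi>\<^sup>n\<^sup>-\<^sup>1||| + |||\<xi>\<^sup>n\<^sup>-\<^sup>2|||\<close>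
  (\<open>error_step\<close>), and the inhomogeneity is bounded by a multiple of \<open>(9\<ell>)\<^sup>n\<^sup>/\<^sup>2\<close>, which dominates the homogeneous growth
  \<open>(1 + \<surd>2)\<^sup>n\<close>.

  Deleting nodal values must lead back into the finite element space (\<open>nodal_interpolation\<close>). Being
  multilinear on a parallelepiped means being affine along lines parallel to its edges. In this form the
  property passes to faces, and a function with this property on a polytope is determined by its values at
  the extreme points (\<open>edge_affine_unique\<close>). So interpolants on two elements agree on the common face. They
  vanish on the boundary of the domain because the smallest face around a boundary point has all its
  vertices on the boundary (\<open>face_interior_in_domain\<close>); here the Lipschitz condition enters, through the fact
  that the domain is the interior of its closure.\<close>

section \<open>Lipschitz domains\<close>

text \<open>Directly below a boundary point there is an open set of points under the Lipschitz graph. It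
  misses \<open>\<Omega>\<close>, hence also its closure, so no boundary point is interior to the closure.\<close>

lemma interior_closure_lipschitz_polytope:
  assumes "lipschitz_polytope \<Omega>"
  shows "interior (closure \<Omega>) = \<Omega>"
proof
  have op: "open \<Omega>"
    using assms by (simp add: lipschitz_polytope_def)
  then show "\<Omega> \<subseteq> interior (closure \<Omega>)"
    by (simp add: interior_maximal closure_subset)
  show "interior (closure \<Omega>) \<subseteq> \<Omega>"
  proof
    fix x assume x: "x \<in> interior (closure \<Omega>)"
    show "x \<in> \<Omega>"
    proof (rule ccontr)
      assume nx: "x \<notin> \<Omega>"
      then have xf: "x \<in> frontier \<Omega>"
        using x interior_subset[of "closure \<Omega>"] op by (auto simp: frontier_def interior_open)
      obtain U e L \<phi> where U: "open U" "x \<in> U" and e: "norm e = 1"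
        and L: "L-lipschitz_on UNIV \<phi>"
        and graph: "\<Omega> \<inter> U = {y \<in> U. \<phi> (y - (y \<bullet> e) *\<^sub>R e) < y \<bullet> e}"
        using assms[unfolded lipschitz_polytope_def, THEN conjunct2, THEN conjunct2, THEN conjunct2,
            THEN conjunct2, THEN bspec, OF xf]
        by blast
      have ee: "e \<bullet> e = 1"
        using e by (simp add: norm_eq_1)
      have cont: "continuous_on UNIV (\<lambda>y. \<phi> (y - (y \<bullet> e) *\<^sub>R e))"
        by (rule continuous_on_compose2[OF lipschitz_on_continuous_on[OF L]])
          (auto intro!: continuous_intros)
      define V where "V = U \<inter> interior (closure \<Omega>) \<inter> {y. y \<bullet> e < \<phi> (y - (y \<bullet> e) *\<^sub>R e)}"
      have "open V"
        unfolding V_def using U(1) cont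
        by (intro open_Int open_interior open_Collect_less) (auto intro!: continuous_intros)
      have "eventually (\<lambda>s. x - s *\<^sub>R e \<in> U \<inter> interior (closure \<Omega>)) (at_right (0::real))"
      proof -
        have "((\<lambda>s. x - s *\<^sub>R e) \<longlongrightarrow> x - 0 *\<^sub>R e) (at_right (0::real))"
          by (intro tendsto_intros)
        then show ?thesis
          by (rule topological_tendstoD) (use U x in auto)
      qed
      moreover have "eventually (\<lambda>s. s > 0) (at_right (0::real))"
        by (rule eventually_at_right_less)
      ultimately obtain s :: real where s: "x - s *\<^sub>R e \<in> U \<inter> interior (closure \<Omega>)" "s > 0"
        using eventually_happens[OF eventually_conj, of _ "at_right (0::real)"] by auto
      have hor: "x - s *\<^sub>R e - ((x - s *\<^sub>R e) \<bullet> e) *\<^sub>R e = x - (x \<bullet> e) *\<^sub>R e"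
        by (simp add: inner_diff_left ee algebra_simps)
      have "x \<bullet> e \<le> \<phi> (x - (x \<bullet> e) *\<^sub>R e)"
      proof (rule ccontr)
        assume "\<not> ?thesis"
        then have "x \<in> \<Omega> \<inter> U"
          unfolding graph using U by simp
        then show False using nx by simp
      qed
      then have "x - s *\<^sub>R e \<in> V"
        using s unfolding V_def Int_iff mem_Collect_eq hor by (simp add: inner_diff_left ee)
      moreover have "V \<subseteq> closure \<Omega>"
        unfolding V_def using interior_subset[of "closure \<Omega>"] by blast
      ultimately have "V \<inter> \<Omega> \<noteq> {}"
        using \<open>open V\<close> open_Int_closure_eq_empty[of V \<Omega>] by blast
      then obtain y where y: "y \<in> V" "y \<in> \<Omega>" by blast
      then have "y \<in> \<Omega> \<inter> U" by (simp add: V_def)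
      then show False
        using y(1) unfolding graph by (simp add: V_def)
    qed
  qed
qed


section \<open>Functions that are affine along the edges of a polytope\<close>

text \<open>This is the coordinate-free content of being multilinear: it refers to the polytope only, not
  to a parametrization, and it is inherited by faces. Both facts are what makes finite element
  functions fit together across elements.\<close>

definition edge_affine :: "'a::euclidean_space set \<Rightarrow> ('a \<Rightarrow> real) \<Rightarrow> bool" where
  "edge_affine P g \<longleftrightarrow> (\<forall>E a b x s t. E edge_of P \<longrightarrow> a \<in> E \<longrightarrow> b \<in> E \<longrightarrow> x \<in> P \<longrightarrow>
     x + s *\<^sub>R (b - a) \<in> P \<longrightarrow> 0 \<le> t \<longrightarrow> t \<le> 1 \<longrightarrow>
     g (x + (t * s) *\<^sub>R (b - a)) = (1 - t) * g x + t * g (x + s *\<^sub>R (b - a)))"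

lemma edge_affineD:
  assumes "edge_affine P g" "E edge_of P" "a \<in> E" "b \<in> E" "x \<in> P" "x + s *\<^sub>R (b - a) \<in> P" "0 \<le> t" "t \<le> 1"
  shows "g (x + (t * s) *\<^sub>R (b - a)) = (1 - t) * g x + t * g (x + s *\<^sub>R (b - a))"
  using assms unfolding edge_affine_def by blast

lemma edge_affine_face:
  assumes "edge_affine P g" "F face_of P"
  shows "edge_affine F g"
proof -
  have "E edge_of P" if "E edge_of F" for E
    using that face_of_trans[OF _ assms(2)] by (simp add: edge_of_def)
  then show ?thesis
    unfolding edge_affine_def
    by (intro allI impI edge_affineD[OF assms(1)]) (use face_of_imp_subset[OF assms(2)] in auto)
qed

lemma edge_affine_cong:
  assumes "edge_affine P f" "convex P" "\<And>x. x \<in> P \<Longrightarrow> f x = g x"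
  shows "edge_affine P g"
  unfolding edge_affine_def
proof (intro allI impI)
  fix E a b x and s t :: real
  assume E: "E edge_of P" and mem: "a \<in> E" "b \<in> E" "x \<in> P" "x + s *\<^sub>R (b - a) \<in> P" "0 \<le> t" "t \<le> 1"
  have "(1 - t) *\<^sub>R x + t *\<^sub>R (x + s *\<^sub>R (b - a)) \<in> P"
    using mem assms(2) by (intro convexD) auto
  moreover have "(1 - t) *\<^sub>R x + t *\<^sub>R (x + s *\<^sub>R (b - a)) = x + (t * s) *\<^sub>R (b - a)"
    by (simp add: algebra_simps)
  ultimately have "f (x + (t * s) *\<^sub>R (b - a)) = g (x + (t * s) *\<^sub>R (b - a))"
    by (auto intro!: assms(3))
  then show "g (x + (t * s) *\<^sub>R (b - a)) = (1 - t) * g x + t * g (x + s *\<^sub>R (b - a))"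
    using edge_affineD[OF assms(1) E mem] assms(3)[OF mem(3)] assms(3)[OF mem(4)] by simp
qed

lemma edge_affine_zero: "edge_affine P (\<lambda>_. 0)"
  by (simp add: edge_affine_def)

lemma edge_affine_lincomb:
  assumes "edge_affine P f" "edge_affine P g"
  shows "edge_affine P (\<lambda>x. c * f x + d * g x)"
  unfolding edge_affine_def
proof (intro allI impI)
  fix E a b x and s t :: real
  assume "E edge_of P" "a \<in> E" "b \<in> E" "x \<in> P" "x + s *\<^sub>R (b - a) \<in> P" "0 \<le> t" "t \<le> 1"
  then have "f (x + (t * s) *\<^sub>R (b - a)) = (1 - t) * f x + t * f (x + s *\<^sub>R (b - a))"
    "g (x + (t * s) *\<^sub>R (b - a)) = (1 - t) * g x + t * g (x + s *\<^sub>R (b - a))"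
    by (rule edge_affineD[OF assms(1)] edge_affineD[OF assms(2)])+
  then show "c * f (x + (t * s) *\<^sub>R (b - a)) + d * g (x + (t * s) *\<^sub>R (b - a)) =
    (1 - t) * (c * f x + d * g x) + t * (c * f (x + s *\<^sub>R (b - a)) + d * g (x + s *\<^sub>R (b - a)))"
    by (simp only:) (simp add: algebra_simps)
qed

lemma polytope_edge_exists:
  fixes P :: "'a::euclidean_space set"
  assumes "polytope P" "1 \<le> aff_dim P"
  obtains E where "E edge_of P"
proof -
  have "\<exists>E. E edge_of P"
    using assms
  proof (induction "nat (aff_dim P)" arbitrary: P rule: less_induct)
    case less
    show ?case
    proof (cases "aff_dim P = 1")
      case True
      then show ?thesis
        using less.prems polytope_imp_convex[of P] face_of_refl[of P] by (auto simp: edge_of_def)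
    next
      case False
      obtain F where F: "F facet_of P"
        using polytope_facet_exists[of P] less.prems by auto
      then have "F face_of P" "aff_dim F = aff_dim P - 1"
        by (auto simp: facet_of_def)
      moreover then have "\<exists>E. E edge_of F"
        using less.prems False face_of_polytope_polytope[of P F] by (intro less.hyps) auto
      ultimately show ?thesis
        using face_of_trans by (auto simp: edge_of_def)
    qed
  qed
  then show ?thesis using that by blast
qed

text \<open>Every point in the relative interior lies between two points of the relative frontier, on a
  line parallel to some edge. The relative frontier consists of facets, so induction on the dimension
  reduces the claim to single points.\<close>

lemma edge_affine_eq_0:
  fixes P :: "'a::euclidean_space set"
  assumes "polytope P" "edge_affine P g" "\<And>z. z extreme_point_of P \<Longrightarrow> g z = 0" "x \<in> P"
  shows "g x = 0"
  using assms
proof (induction "nat (aff_dim P)" arbitrary: P x rule: less_induct)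
  case less
  show ?case
  proof (cases "1 \<le> aff_dim P")
    case False
    then have "aff_dim P = 0"
      using \<open>x \<in> P\<close> aff_dim_geq[of P] aff_dim_empty[of P] by force
    then obtain a where "P = {a}"
      using aff_dim_eq_0 by blast
    then show ?thesis
      using less.prems by (auto simp: extreme_point_of_def)
  next
    case True
    have cv: "convex P" and bd: "bounded P" and ph: "polyhedron P"
      using less.prems(1) by (auto simp: polytope_imp_convex polytope_imp_bounded polytope_imp_polyhedron)
    have front: "g y = 0" if y: "y \<in> rel_frontier P" for y
    proof -
      obtain F where F: "F facet_of P" "y \<in> F"
        using y unfolding rel_frontier_of_polyhedron[OF ph] by blast
      then have face: "F face_of P" "aff_dim F = aff_dim P - 1"
        by (auto simp: facet_of_def)
      show ?thesis
      proof (rule less.hyps[of F])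
        show "nat (aff_dim F) < nat (aff_dim P)" using face True by simp
        show "polytope F" using face less.prems(1) face_of_polytope_polytope by blast
        show "edge_affine F g" using face less.prems(2) edge_affine_face by blast
        show "g z = 0" if "z extreme_point_of F" for z
          using that face less.prems(3) extreme_point_of_face by blast
      qed fact
    qed
    show ?thesis
    proof (cases "x \<in> rel_frontier P")
      case True
      then show ?thesis by (rule front)
    next
      case False
      then have x: "x \<in> rel_interior P"
        using \<open>x \<in> P\<close> closure_subset by (auto simp: rel_frontier_def)
      obtain E where E: "E edge_of P"
        using polytope_edge_exists less.prems(1) True by blast
      have "aff_dim E = 1" using E by (simp add: edge_of_def)
      then have "\<not> (\<exists>a. E \<subseteq> {a})"
        by (auto simp: subset_singleton_iff)
      then obtain a b where ab: "a \<in> E" "b \<in> E" "a \<noteq> b"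
        by blast
      have abP: "a \<in> P" "b \<in> P"
        using ab E edge_of_imp_subset by blast+
      have hull: "x + c *\<^sub>R (b - a) \<in> affine hull P" for c
      proof -
        have "x \<in> affine hull P" "a \<in> affine hull P" "b \<in> affine hull P"
          using abP \<open>x \<in> P\<close> by (auto intro: hull_inc)
        then show ?thesis
          using mem_affine_3_minus[of "affine hull P" x b a c] by simp
      qed
      obtain d1 where d1: "0 < d1" "x + d1 *\<^sub>R (b - a) \<in> rel_frontier P"
      proof -
        have "x + (b - a) \<in> affine hull P" "b - a \<noteq> 0"
          using hull[of 1] ab by simp_all
        from ray_to_rel_frontier[OF bd x this] show ?thesis using that by metis
      qed
      obtain d2 where d2: "0 < d2" "x + d2 *\<^sub>R (a - b) \<in> rel_frontier P"
      proof -
        have "x + (a - b) \<in> affine hull P" "a - b \<noteq> 0"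
          using hull[of "-1"] ab by simp_all
        from ray_to_rel_frontier[OF bd x this] show ?thesis using that by metis
      qed
      define y where "y = x + d2 *\<^sub>R (a - b)"
      have clP: "closure P = P"
        using less.prems(1) polytope_imp_closed closure_closed by blast
      have yP: "y \<in> P" "x + d1 *\<^sub>R (b - a) \<in> P"
        using d1 d2 clP by (auto simp: y_def rel_frontier_def)
      have eq: "x + d1 *\<^sub>R (b - a) = y + (d1 + d2) *\<^sub>R (b - a)"
        "y + (d2 / (d1 + d2) * (d1 + d2)) *\<^sub>R (b - a) = x"
      proof -
        have "d2 / (d1 + d2) * (d1 + d2) = d2" using d1 d2 by simp
        then show "y + (d2 / (d1 + d2) * (d1 + d2)) *\<^sub>R (b - a) = x"
          by (simp only:) (simp add: y_def algebra_simps)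
      qed (simp add: y_def algebra_simps)
      have "g (y + (d2 / (d1 + d2) * (d1 + d2)) *\<^sub>R (b - a))
          = (1 - d2 / (d1 + d2)) * g y + d2 / (d1 + d2) * g (y + (d1 + d2) *\<^sub>R (b - a))"
        using yP d1 d2 eq(1) by (intro edge_affineD[OF less.prems(2) E ab(1,2)]) auto
      then show ?thesis
        unfolding eq(2) eq(1)[symmetric] using front[of y] front[of "x + d1 *\<^sub>R (b - a)"] d1 d2 by (simp add: y_def)
    qed
  qed
qed

lemma edge_affine_unique:
  fixes P :: "'a::euclidean_space set"
  assumes "polytope P" "edge_affine P f" "edge_affine P g"
    and "\<And>z. z extreme_point_of P \<Longrightarrow> f z = g z" "x \<in> P"
  shows "f x = g x"
  using edge_affine_eq_0[OF assms(1) edge_affine_lincomb[OF assms(2,3), of 1 "-1"]] assms(4,5)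
  by simp


section \<open>Multilinear functions on parallelepipeds\<close>

text \<open>The vertices of the unit cube are indexed by sets of coordinates; \<open>Q1_hat I\<close> is the multilinear
  nodal basis function of the vertex \<open>corner I\<close>.\<close>

definition corner :: "'d set \<Rightarrow> real^'d" where
  "corner I = (\<chi> i. if i \<in> I then 1 else 0)"

definition Q1_hat :: "'d set \<Rightarrow> real^'d \<Rightarrow> real" where
  "Q1_hat I y = (\<Prod>i\<in>UNIV. if i \<in> I then y $ i else 1 - y $ i)"

lemma corner_in_cube: "corner I \<in> cbox 0 1"
  by (simp add: mem_box_cart corner_def)

lemma Q1_hat_corner: "Q1_hat I (corner J) = (if I = J then 1 else 0)"
proof (cases "I = J")
  case False
  then obtain i where "(i \<in> I) \<noteq> (i \<in> J)" by blast
  then show ?thesis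
    using False unfolding Q1_hat_def by (auto simp: corner_def intro!: bexI[of _ i])
qed (auto simp: Q1_hat_def corner_def intro!: prod.neutral)

lemma Q1_hat_bounds:
  assumes "y \<in> cbox 0 1"
  shows "0 \<le> Q1_hat I y" "Q1_hat I y \<le> 1"
  using assms unfolding Q1_hat_def mem_box_cart
  by (auto intro!: prod_nonneg prod_le_1 split: if_splits)

lemma Q1_hat_Lipschitz:
  assumes "y \<in> cbox 0 1" "z \<in> cbox 0 1"
  shows "\<bar>Q1_hat I y - Q1_hat I z\<bar> \<le> (\<Sum>i\<in>UNIV. \<bar>y $ i - z $ i\<bar>)"
proof -
  have "norm (Q1_hat I y - Q1_hat I z)
      \<le> (\<Sum>i\<in>UNIV. norm ((if i \<in> I then y $ i else 1 - y $ i) - (if i \<in> I then z $ i else 1 - z $ i)))"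
    unfolding Q1_hat_def using assms by (intro norm_prod_diff) (auto simp: mem_box_cart)
  also have "\<dots> = (\<Sum>i\<in>UNIV. \<bar>y $ i - z $ i\<bar>)"
    by (intro sum.cong) auto
  finally show ?thesis by simp
qed

lemma Q1_poly_cmult: "Q1_poly p \<Longrightarrow> Q1_poly (\<lambda>y. a * p y)"
  unfolding Q1_poly_def
proof (elim exE)
  fix c assume "\<forall>x. p x = (\<Sum>I\<in>UNIV. c I * (\<Prod>i\<in>I. x $ i))"
  then show "\<exists>c. \<forall>x. a * p x = (\<Sum>I\<in>UNIV. c I * (\<Prod>i\<in>I. x $ i))"
    by (intro exI[of _ "\<lambda>I. a * c I"]) (simp add: sum_distrib_left mult.assoc)
qed

lemma Q1_poly_add: "Q1_poly p \<Longrightarrow> Q1_poly q \<Longrightarrow> Q1_poly (\<lambda>y. p y + q y)"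
  unfolding Q1_poly_def
proof (elim exE)
  fix c d assume "\<forall>x. p x = (\<Sum>I\<in>UNIV. c I * (\<Prod>i\<in>I. x $ i))" "\<forall>x. q x = (\<Sum>I\<in>UNIV. d I * (\<Prod>i\<in>I. x $ i))"
  then show "\<exists>c. \<forall>x. p x + q x = (\<Sum>I\<in>UNIV. c I * (\<Prod>i\<in>I. x $ i))"
    by (intro exI[of _ "\<lambda>I. c I + d I"]) (simp add: sum.distrib algebra_simps)
qed

lemma Q1_poly_sum: "finite A \<Longrightarrow> (\<And>a. a \<in> A \<Longrightarrow> Q1_poly (p a)) \<Longrightarrow> Q1_poly (\<lambda>y. \<Sum>a\<in>A. p a y)"
proof (induction A rule: finite_induct)
  case empty
  show ?case
    by (auto simp: Q1_poly_def intro!: exI[of _ "\<lambda>_. 0"])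
qed (simp add: Q1_poly_add)

lemma Q1_poly_monomial_factors:
  fixes A B :: "'d::finite set"
  assumes "A \<inter> B = {}"
  shows "Q1_poly (\<lambda>y. (\<Prod>i\<in>A. y $ i) * (\<Prod>i\<in>B. 1 - y $ i))"
  using finite[of B] assms
proof (induction B arbitrary: A rule: finite_induct)
  case empty
  have "(\<Sum>I\<in>UNIV. (if I = A then 1 else 0) * f I) = f A" for f :: "'d set \<Rightarrow> real"
  proof -
    have "(\<Sum>I\<in>UNIV. (if I = A then 1 else 0) * f I) = (\<Sum>I\<in>UNIV. if I = A then f I else 0)"
      by (rule sum.cong) auto
    then show ?thesis by simp
  qed
  then show ?case
    unfolding Q1_poly_def by (intro exI[of _ "\<lambda>I. if I = A then 1 else 0"]) simp
next
  case (insert b B)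
  have "Q1_poly (\<lambda>y. (\<Prod>i\<in>A. y $ i) * (\<Prod>i\<in>B. 1 - y $ i)
      + (-1) * ((\<Prod>i\<in>insert b A. y $ i) * (\<Prod>i\<in>B. 1 - y $ i)))"
    using insert by (intro Q1_poly_add Q1_poly_cmult insert.IH) auto
  then show ?case
    using insert by (simp add: algebra_simps)
qed

lemma Q1_poly_hat: "Q1_poly (Q1_hat I)"
proof -
  have "Q1_hat I = (\<lambda>y. (\<Prod>i\<in>I. y $ i) * (\<Prod>i\<in>- I. 1 - y $ i))"
    unfolding Q1_hat_def by (rule ext, subst prod.If_cases) (auto simp: Collect_neg_eq)
  then show ?thesis
    using Q1_poly_monomial_factors[of I "- I"] by simp
qed

lemma Q1_poly_axis:
  assumes "Q1_poly q"
  obtains D where "\<And>r. q (y + r *\<^sub>R axis i 1) = q y + r * D"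
proof -
  obtain c where c: "\<And>x. q x = (\<Sum>I\<in>UNIV. c I * (\<Prod>i\<in>I. x $ i))"
    using assms unfolding Q1_poly_def by blast
  define D where "D I = (if i \<in> I then \<Prod>k\<in>I - {i}. y $ k else 0)" for I
  have mono: "(\<Prod>k\<in>I. (y + r *\<^sub>R axis i 1) $ k) = (\<Prod>k\<in>I. y $ k) + r * D I" for I r
  proof (cases "i \<in> I")
    case True
    have "(\<Prod>k\<in>I - {i}. (y + r *\<^sub>R axis i 1) $ k) = (\<Prod>k\<in>I - {i}. y $ k)"
      by (intro prod.cong) (auto simp: axis_def)
    then show ?thesis
      using True by (simp add: prod.remove[of I i] D_def algebra_simps)
  next
    case False
    then have "(\<Prod>k\<in>I. (y + r *\<^sub>R axis i 1) $ k) = (\<Prod>k\<in>I. y $ k)"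
      by (intro prod.cong) (auto simp: axis_def)
    then show ?thesis
      using False by (simp add: D_def)
  qed
  have "q (y + r *\<^sub>R axis i 1) = q y + r * (\<Sum>I\<in>UNIV. c I * D I)" for r
    unfolding c mono by (simp add: algebra_simps sum.distrib sum_distrib_left)
  then show ?thesis using that by blast
qed

lemma mem_open_segment_symmetric:
  fixes p v :: "'a::euclidean_space"
  assumes "v \<noteq> 0"
  shows "p \<in> open_segment (p - v) (p + v)"
proof -
  have "midpoint (p - v) (p + v) = p"
    by (simp add: midpoint_def scaleR_2[symmetric])
  moreover have "p - v \<noteq> p + v"
  proof
    assume "p - v = p + v"
    then have "v + v = 0" by (simp add: diff_eq_eq add.assoc)
    then have "2 *\<^sub>R v = 0" by (simp only: scaleR_2)
    then show False using assms by simp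
  qed
  ultimately show ?thesis
    using midpoint_in_open_segment[of "p - v" "p + v"] by simp
qed

text \<open>An affine parametrization of the parallelepiped \<open>K\<close>, together with the inverse matrix.\<close>

locale chart =
  fixes K :: "(real^'d) set" and b M N
  assumes MN: "M ** N = mat 1" and NM: "N ** M = mat 1"
    and K_eq: "K = affine_ref b M ` box 0 1"
begin

definition pull :: "real^'d \<Rightarrow> real^'d" where
  "pull x = N *v (x - b)"

lemma pull_ref [simp]: "pull (affine_ref b M y) = y"
  by (simp add: pull_def affine_ref_def matrix_vector_mul_assoc NM)

lemma ref_pull [simp]: "affine_ref b M (pull x) = x"
  by (simp add: pull_def affine_ref_def matrix_vector_mul_assoc MN)

lemma ref_add: "affine_ref b M (y + w) = affine_ref b M y + M *v w"
  by (simp add: affine_ref_def matrix_vector_right_distrib)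

lemma pull_add_scaled: "pull (affine_ref b M y + r *\<^sub>R (M *v w)) = y + r *\<^sub>R w"
  using pull_ref[of "y + r *\<^sub>R w"] unfolding ref_add matrix_vector_mult_scaleR .

lemma pull_diff: "pull x - pull y = N *v (x - y)"
  by (simp add: pull_def flip: matrix_vector_mult_diff_distrib)

lemma bij_M: "bij ((*v) M)"
  by (rule o_bij[of "(*v) N"]) (auto simp: fun_eq_iff matrix_vector_mul_assoc MN NM)

lemma image_eq: "affine_ref b M ` S = (+) b ` ((*v) M ` S)"
  by (auto simp: affine_ref_def image_image)

lemma cube_nonempty: "box 0 (1::real^'d) \<noteq> {}"
  by (simp add: interval_ne_empty_cart)

lemma closure_eq: "closure K = affine_ref b M ` cbox 0 1"
  unfolding K_eq image_eq closure_translation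
  using bij_M cube_nonempty
  by (subst closure_injective_linear_image[symmetric]) (auto simp: bij_def)

lemma open_K: "open K"
  unfolding K_eq image_eq
  by (intro open_translation) (simp add: open_bijective_linear_image_eq[OF matrix_vector_mul_linear bij_M] open_box)

lemma mem_iff: "x \<in> K \<longleftrightarrow> pull x \<in> box 0 1"
  unfolding K_eq using ref_pull[of x] by (force simp del: ref_pull)

lemma mem_closure_iff: "x \<in> closure K \<longleftrightarrow> pull x \<in> cbox 0 1"
  unfolding closure_eq using ref_pull[of x] by (force simp del: ref_pull)

lemma polytope_closure: "polytope (closure K)"
  unfolding closure_eq image_eq polytope_translation_eq
  by (intro polytope_linear_image polytope_interval matrix_vector_mul_linear)

lemma convex_K: "convex K"
  unfolding K_eq image_eq by (intro convex_translation convex_linear_image convex_box matrix_vector_mul_linear)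

lemma bounded_K: "bounded K"
  by (rule bounded_subset[OF polytope_imp_bounded[OF polytope_closure] closure_subset])

lemma nonempty_K: "K \<noteq> {}"
  using cube_nonempty by (simp add: K_eq)

lemma corner_in_closure: "affine_ref b M (corner I) \<in> closure K"
  by (simp add: mem_closure_iff corner_in_cube)

text \<open>A point with a coordinate strictly between 0 and 1 can be moved both ways along that axis.\<close>

lemma open_segment_axis:
  assumes "y \<in> cbox 0 1" "0 < y $ i" "y $ i < 1"
  obtains \<epsilon> where "0 < \<epsilon>" "affine_ref b M y + \<epsilon> *\<^sub>R (M *v axis i 1) \<in> closure K"
    "affine_ref b M y - \<epsilon> *\<^sub>R (M *v axis i 1) \<in> closure K"
    "affine_ref b M y \<in> open_segment (affine_ref b M y - \<epsilon> *\<^sub>R (M *v axis i 1))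
                                      (affine_ref b M y + \<epsilon> *\<^sub>R (M *v axis i 1))"
proof -
  define \<epsilon> where "\<epsilon> = min (y $ i) (1 - y $ i)"
  have eps: "0 < \<epsilon>" "\<epsilon> \<le> y $ i" "\<epsilon> \<le> 1 - y $ i"
    using assms by (auto simp: \<epsilon>_def)
  have "pull (affine_ref b M y + \<epsilon> *\<^sub>R (M *v axis i 1)) = y + \<epsilon> *\<^sub>R axis i 1"
    "pull (affine_ref b M y - \<epsilon> *\<^sub>R (M *v axis i 1)) = y - \<epsilon> *\<^sub>R axis i 1"
    using pull_add_scaled[of y \<epsilon> "axis i 1"] pull_add_scaled[of y "- \<epsilon>" "axis i 1"] by simp_all
  moreover have "y + \<epsilon> *\<^sub>R axis i 1 \<in> cbox 0 1" "y - \<epsilon> *\<^sub>R axis i 1 \<in> cbox 0 1"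
  proof -
    have "0 \<le> y $ j" "y $ j \<le> 1" for j
      using assms(1) by (simp_all add: mem_box_cart)
    moreover have "(y + \<epsilon> *\<^sub>R axis i 1) $ j = (if j = i then y $ i + \<epsilon> else y $ j)"
      "(y - \<epsilon> *\<^sub>R axis i 1) $ j = (if j = i then y $ i - \<epsilon> else y $ j)" for j
      by (auto simp: axis_def)
    ultimately show "y + \<epsilon> *\<^sub>R axis i 1 \<in> cbox 0 1" "y - \<epsilon> *\<^sub>R axis i 1 \<in> cbox 0 1"
      using eps assms(2,3) unfolding mem_box_cart by auto
  qed
  moreover have "M *v axis i 1 \<noteq> 0"
  proof
    assume "M *v axis i 1 = 0"
    then have "N *v (M *v axis i 1) = 0" by simp
    then show False by (simp add: matrix_vector_mul_assoc NM axis_eq_0_iff)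
  qed
  then have "affine_ref b M y \<in> open_segment (affine_ref b M y - \<epsilon> *\<^sub>R (M *v axis i 1))
                                      (affine_ref b M y + \<epsilon> *\<^sub>R (M *v axis i 1))"
    using eps by (intro mem_open_segment_symmetric) simp
  ultimately show ?thesis
    using that[of \<epsilon>] eps(1) by (simp add: mem_closure_iff)
qed

lemma extreme_point_corner:
  assumes "z extreme_point_of closure K"
  obtains I where "z = affine_ref b M (corner I)"
proof -
  have y: "pull z \<in> cbox 0 1"
    using assms by (simp add: extreme_point_of_def mem_closure_iff)
  have "pull z $ i = 0 \<or> pull z $ i = 1" for i
  proof (rule ccontr)
    assume "\<not> ?thesis"
    then have "0 < pull z $ i" "pull z $ i < 1"
      using y[unfolded mem_box_cart, THEN spec, of i] by auto
    then obtain \<epsilon> where "0 < \<epsilon>" "z + \<epsilon> *\<^sub>R (M *v axis i 1) \<in> closure K"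
      "z - \<epsilon> *\<^sub>R (M *v axis i 1) \<in> closure K"
      "z \<in> open_segment (z - \<epsilon> *\<^sub>R (M *v axis i 1)) (z + \<epsilon> *\<^sub>R (M *v axis i 1))"
      by (rule open_segment_axis[OF y, unfolded ref_pull])
    then show False
      using assms unfolding extreme_point_of_def by blast
  qed
  then have "pull z = corner {i. pull z $ i = 1}"
    by (auto simp: corner_def vec_eq_iff)
  then show ?thesis
    using that[of "{i. pull z $ i = 1}"] ref_pull[of z] by simp
qed

text \<open>If two points of an edge differed in two coordinates, then their midpoint could be moved within
  the edge in two independent directions.\<close>

lemma edge_direction:
  assumes E: "E edge_of closure K" and pq: "p \<in> E" "q \<in> E"
  obtains i r where "q - p = r *\<^sub>R (M *v axis i 1)"
proof -
  have face: "E face_of closure K" and dim: "aff_dim E = 1"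
    using E by (auto simp: edge_of_def)
  have cl: "pull p \<in> cbox 0 1" "pull q \<in> cbox 0 1"
    using pq edge_of_imp_subset[OF E] mem_closure_iff by blast+
  have diff: "q - p = M *v (pull q - pull p)"
    by (simp add: pull_diff matrix_vector_mul_assoc MN)
  have "\<exists>i. \<forall>j. j \<noteq> i \<longrightarrow> pull q $ j = pull p $ j"
  proof (rule ccontr)
    assume *: "\<not> ?thesis"
    then obtain i where i: "pull q $ i \<noteq> pull p $ i" by blast
    from * obtain j where j: "j \<noteq> i" "pull q $ j \<noteq> pull p $ j" by blast
    define y where "y = pull p + (1/2) *\<^sub>R (pull q - pull p)"
    have segment: "p + u *\<^sub>R (q - p) = (1 - u) *\<^sub>R p + u *\<^sub>R q" for p q :: "real^'d" and u
      by (simp add: algebra_simps)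
    have y: "y \<in> cbox 0 1"
      unfolding y_def segment by (intro convexD_alt[OF convex_box(1)] cl) auto
    have "affine_ref b M y = p + (1/2) *\<^sub>R (q - p)"
      by (simp add: y_def ref_add matrix_vector_mult_scaleR diff)
    then have yE: "affine_ref b M y \<in> E"
      unfolding segment using convexD_alt[OF face_of_imp_convex[OF face] pq, of "1/2"] by simp
    have move: "\<exists>\<epsilon>>0. affine_ref b M y + \<epsilon> *\<^sub>R (M *v axis k 1) \<in> E" if "pull q $ k \<noteq> pull p $ k" for k
    proof -
      have mean: "0 < s + (t - s) / 2 \<and> s + (t - s) / 2 < 1"
        if "0 \<le> s" "s \<le> 1" "0 \<le> t" "t \<le> 1" "t \<noteq> s" for s t :: real
        using that by (auto simp: field_simps)
      have "0 < y $ k" "y $ k < 1"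
        using mean[of "pull p $ k" "pull q $ k"] that cl by (simp_all add: y_def mem_box_cart)
      then obtain \<epsilon> where eps: "0 < \<epsilon>" "affine_ref b M y + \<epsilon> *\<^sub>R (M *v axis k 1) \<in> closure K"
        "affine_ref b M y - \<epsilon> *\<^sub>R (M *v axis k 1) \<in> closure K"
        "affine_ref b M y \<in> open_segment (affine_ref b M y - \<epsilon> *\<^sub>R (M *v axis k 1))
                                          (affine_ref b M y + \<epsilon> *\<^sub>R (M *v axis k 1))"
        by (rule open_segment_axis[OF y])
      show ?thesis
        using eps(1) face_ofD[OF face eps(4,3,2) yE] by blast
    qed
    obtain \<epsilon>1 \<epsilon>2 where eps: "0 < \<epsilon>1" "0 < \<epsilon>2" "affine_ref b M y + \<epsilon>1 *\<^sub>R (M *v axis i 1) \<in> E"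
      "affine_ref b M y + \<epsilon>2 *\<^sub>R (M *v axis j 1) \<in> E"
      using move[OF i] move[OF j(2)] by blast
    obtain u where u: "\<And>x y. x \<in> E \<Longrightarrow> y \<in> E \<Longrightarrow> \<exists>c. x - y = c *\<^sub>R u"
      using collinear_aff_dim[of E] dim unfolding collinear_def by auto
    obtain c1 where c1: "\<epsilon>1 *\<^sub>R (M *v axis i 1) = c1 *\<^sub>R u"
      using u[OF eps(3) yE] by auto
    obtain c2 where c2: "\<epsilon>2 *\<^sub>R (M *v axis j 1) = c2 *\<^sub>R u"
      using u[OF eps(4) yE] by auto
    have Nu: "\<epsilon>1 *\<^sub>R axis i 1 = c1 *\<^sub>R (N *v u)" "\<epsilon>2 *\<^sub>R axis j 1 = c2 *\<^sub>R (N *v u)"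
      using arg_cong[OF c1, of "(*v) N"] arg_cong[OF c2, of "(*v) N"]
      by (simp_all add: matrix_vector_mult_scaleR matrix_vector_mul_assoc NM)
    have "\<epsilon>1 = c1 * (N *v u) $ i" "0 = c1 * (N *v u) $ j" "\<epsilon>2 = c2 * (N *v u) $ j"
      using arg_cong[OF Nu(1), of "\<lambda>v. v $ i"] arg_cong[OF Nu(1), of "\<lambda>v. v $ j"]
        arg_cong[OF Nu(2), of "\<lambda>v. v $ j"] j(1) by (simp_all add: axis_def)
    then show False
      using eps(1,2) by auto
  qed
  then obtain i where i: "\<And>j. j \<noteq> i \<Longrightarrow> pull q $ j = pull p $ j" by blast
  have "pull q - pull p = (pull q $ i - pull p $ i) *\<^sub>R axis i 1"
    using i by (auto simp: vec_eq_iff axis_def)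
  then show ?thesis
    using that[of "pull q $ i - pull p $ i" i] diff by (simp add: matrix_vector_mult_scaleR)
qed

lemma edge_affine_Q1_poly:
  assumes "Q1_poly q"
  shows "edge_affine (closure K) (\<lambda>x. q (pull x))"
  unfolding edge_affine_def
proof (intro allI impI)
  fix E p p' x and s t :: real
  assume "E edge_of closure K" "p \<in> E" "p' \<in> E"
  then obtain i r where r: "p' - p = r *\<^sub>R (M *v axis i 1)"
    by (rule edge_direction)
  obtain D where D: "\<And>r. q (pull x + r *\<^sub>R axis i 1) = q (pull x) + r * D"
    using Q1_poly_axis[OF assms] by blast
  have "pull (x + s *\<^sub>R (p' - p)) = pull x + (s * r) *\<^sub>R axis i 1" for s
  proof -
    have "pull (x + s *\<^sub>R (p' - p)) - pull x = (s * r) *\<^sub>R axis i 1"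
      unfolding pull_diff r by (simp add: matrix_vector_mult_scaleR matrix_vector_mul_assoc NM)
    then show ?thesis by (simp add: algebra_simps)
  qed
  then show "q (pull (x + (t * s) *\<^sub>R (p' - p)))
      = (1 - t) * q (pull x) + t * q (pull (x + s *\<^sub>R (p' - p)))"
    by (simp add: D algebra_simps)
qed

definition interpolant :: "(real^'d \<Rightarrow> real) \<Rightarrow> real^'d \<Rightarrow> real" where
  "interpolant c x = (\<Sum>I\<in>UNIV. c (affine_ref b M (corner I)) * Q1_hat I (pull x))"

lemma Q1_poly_interpolant: "Q1_poly (\<lambda>y. \<Sum>I\<in>UNIV. c (affine_ref b M (corner I)) * Q1_hat I y)"
  by (intro Q1_poly_sum Q1_poly_cmult Q1_poly_hat) simp

lemma edge_affine_interpolant: "edge_affine (closure K) (interpolant c)"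
  using edge_affine_Q1_poly[OF Q1_poly_interpolant] by (simp add: interpolant_def[abs_def])

lemma interpolant_corner: "interpolant c (affine_ref b M (corner J)) = c (affine_ref b M (corner J))"
  by (simp add: interpolant_def Q1_hat_corner if_distrib cong: if_cong)

lemma interpolant_vertex:
  assumes "z extreme_point_of closure K"
  shows "interpolant c z = c z"
  using extreme_point_corner[OF assms] interpolant_corner by metis

lemma continuous_pull: "continuous_on S pull"
  unfolding pull_def
  by (rule linear_continuous_on_compose[OF _ matrix_vector_mul_linear]) (intro continuous_intros)

lemma continuous_interpolant: "continuous_on S (interpolant c)"
proof -
  have "continuous_on S (\<lambda>x. if i \<in> I then pull x $ i else 1 - pull x $ i)" for i I
    by (cases "i \<in> I") (auto intro!: continuous_intros continuous_pull)
  then show ?thesis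
    unfolding interpolant_def Q1_hat_def by (intro continuous_intros continuous_on_prod)
qed

end

lemma parallelepiped_chart:
  assumes "parallelepiped K"
  obtains b M N where "chart K b M N"
  using assms unfolding parallelepiped_def chart_def invertible_def by blast

lemma Q1_on_chart:
  assumes "Q1_on K v"
  obtains b M N q where "chart K b M N" "Q1_poly q" "\<And>y. y \<in> box 0 1 \<Longrightarrow> v (affine_ref b M y) = q y"
  using assms unfolding Q1_on_def chart_def invertible_def by blast

lemma Q1_poly_continuous: "Q1_poly q \<Longrightarrow> continuous_on S q"
  unfolding Q1_poly_def by (auto simp: fun_eq_iff[symmetric] intro!: continuous_intros)

text \<open>A continuous Q1 function is edge-affine, whatever parametrization was used to exhibit it as Q1.
  It thus agrees with its multilinear interpolant in any other parametrization.\<close>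

lemma edge_affine_Q1_on:
  fixes v :: "real^'d \<Rightarrow> real"
  assumes "Q1_on K v" "continuous_on UNIV v"
  shows "edge_affine (closure K) v"
proof -
  obtain b M N q where c: "chart K b M N" and q: "Q1_poly q"
    and eq: "\<And>y. y \<in> box 0 1 \<Longrightarrow> v (affine_ref b M y) = q y"
    using Q1_on_chart[OF assms(1)] by blast
  interpret chart K b M N by fact
  have "q (pull x) = v x" if "x \<in> closure K" for x
  proof (rule continuous_constant_on_closure[of K "\<lambda>x. q (pull x) - v x" 0 x, simplified])
    show "continuous_on (closure K) (\<lambda>x. q (pull x) - v x)"
      using continuous_on_compose2[OF Q1_poly_continuous[OF q, of UNIV] continuous_pull] assms(2)
      by (auto intro!: continuous_intros intro: continuous_on_subset)
    show "q (pull x) = v x" if "x \<in> K" for x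
      using eq[of "pull x"] that by (simp add: mem_iff)
  qed fact
  then show ?thesis
    using edge_affine_cong[OF edge_affine_Q1_poly[OF q]] polytope_imp_convex[OF polytope_closure] by blast
qed

context chart
begin

lemma eq_interpolant:
  assumes "edge_affine (closure K) v" "x \<in> closure K"
  shows "v x = interpolant v x"
  using edge_affine_unique[OF polytope_closure assms(1) edge_affine_interpolant[of v] _ assms(2)]
  by (simp add: interpolant_vertex)

lemma Q1_on_edge_affine:
  assumes "edge_affine (closure K) v"
  shows "Q1_on K v"
  unfolding Q1_on_def
proof (intro exI conjI)
  show "invertible M" using MN NM by (auto simp: invertible_def)
  show "K = affine_ref b M ` box 0 1" by (rule K_eq)
  show "Q1_poly (\<lambda>y. \<Sum>I\<in>UNIV. v (affine_ref b M (corner I)) * Q1_hat I y)"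
    by (rule Q1_poly_interpolant)
  show "\<forall>y\<in>box 0 1. v (affine_ref b M y) = (\<Sum>I\<in>UNIV. v (affine_ref b M (corner I)) * Q1_hat I y)"
    using eq_interpolant[OF assms] box_subset_cbox[of 0 "1::real^'d"]
    by (auto simp: interpolant_def mem_closure_iff)
qed

end


section \<open>Finite element functions on a mesh\<close>

lemma polytope_point_in_rel_interior_of_face:
  fixes P :: "'a::euclidean_space set"
  assumes "polytope P" "x \<in> P"
  obtains F where "F face_of P" "x \<in> rel_interior F"
proof -
  have "\<exists>F. F face_of P \<and> x \<in> rel_interior F"
    using assms
  proof (induction "nat (aff_dim P + 1)" arbitrary: P rule: less_induct)
    case less
    show ?case
    proof (cases "x \<in> rel_interior P")
      case True
      then show ?thesis
        using face_of_refl[OF polytope_imp_convex[OF less.prems(1)]] by blast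
    next
      case False
      then have "x \<in> \<Union>{F. F facet_of P}"
        using rel_boundary_of_polyhedron[OF polytope_imp_polyhedron[OF less.prems(1)]] less.prems(2) by blast
      then obtain G where G: "G facet_of P" "x \<in> G" by blast
      then have face: "G face_of P" "aff_dim G = aff_dim P - 1"
        by (auto simp: facet_of_def)
      have "\<exists>F. F face_of G \<and> x \<in> rel_interior F"
      proof (rule less.hyps)
        show "nat (aff_dim G + 1) < nat (aff_dim P + 1)"
          using face aff_dim_geq[of G] by simp
        show "polytope G"
          using face_of_polytope_polytope[OF less.prems(1) face(1)] .
      qed fact
      then show ?thesis
        using face_of_trans[OF _ face(1)] by blast
    qed
  qed
  then show ?thesis using that by blast
qed

locale fe_mesh =
  fixes \<Omega> :: "(real^'d) set" and \<sigma> h :: real and T :: "(real^'d) set set"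
  assumes lipschitz: "lipschitz_polytope \<Omega>" and mesh: "regular_mesh \<Omega> \<sigma> h T"
begin

lemma open_domain: "open \<Omega>"
  using lipschitz by (simp add: lipschitz_polytope_def)

lemma finite_mesh: "finite T"
  and closure_elements: "(\<Union>K\<in>T. closure K) = closure \<Omega>"
  and common_face: "K \<in> T \<Longrightarrow> K' \<in> T \<Longrightarrow> closure K \<inter> closure K' face_of closure K"
  using mesh by (auto simp: regular_mesh_def)

lemma element_chart:
  assumes "K \<in> T"
  obtains b M N where "chart K b M N"
  using parallelepiped_chart[of K] assms mesh by (auto simp: regular_mesh_def)

lemma element_open: "K \<in> T \<Longrightarrow> open K"
  and element_polytope: "K \<in> T \<Longrightarrow> polytope (closure K)"
  and element_convex: "K \<in> T \<Longrightarrow> convex K"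
  and element_bounded: "K \<in> T \<Longrightarrow> bounded K"
  and element_nonempty: "K \<in> T \<Longrightarrow> K \<noteq> {}"
  using element_chart[of K] chart.open_K chart.polytope_closure chart.convex_K chart.bounded_K chart.nonempty_K
  by metis+

lemma element_disjoint_closure:
  assumes "K \<in> T" "K' \<in> T" "K \<noteq> K'"
  shows "K \<inter> closure K' = {}"
proof -
  have "K \<inter> K' = {}"
    using mesh assms unfolding regular_mesh_def disjoint_def by blast
  then show ?thesis
    using open_Int_closure_eq_empty[OF element_open[OF assms(1)], of K'] by simp
qed

lemma element_subset_domain: "K \<in> T \<Longrightarrow> K \<subseteq> \<Omega>"
  using interior_maximal[of K "closure \<Omega>"] element_open[of K] closure_elements closure_subset[of K]
    interior_closure_lipschitz_polytope[OF lipschitz] by blast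

lemma Vh_iff:
  "v \<in> Vh \<Omega> T \<longleftrightarrow> continuous_on UNIV v \<and> (\<forall>x. x \<notin> \<Omega> \<longrightarrow> v x = 0) \<and> (\<forall>K\<in>T. edge_affine (closure K) v)"
  (is "?l \<longleftrightarrow> ?r")
proof
  show "?l \<Longrightarrow> ?r"
    using edge_affine_Q1_on by (auto simp: Vh_def)
next
  assume r: ?r
  have "Q1_on K v" if K: "K \<in> T" for K
  proof -
    obtain b M N where "chart K b M N" using element_chart[OF K] .
    then show ?thesis
      using chart.Q1_on_edge_affine r K by blast
  qed
  then show ?l using r by (auto simp: Vh_def)
qed

lemma Vh_lincomb:
  assumes "v \<in> Vh \<Omega> T" "w \<in> Vh \<Omega> T"
  shows "(\<lambda>x. a * v x + b * w x) \<in> Vh \<Omega> T"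
  using assms unfolding Vh_iff by (auto intro!: continuous_intros edge_affine_lincomb)

text \<open>Near any of its points, a face in the interior of the domain is surrounded by the same elements:
  those that contain the whole face. A homothety therefore carries a neighbourhood of one point to a
  neighbourhood of any other.\<close>

lemma face_interior_in_domain:
  assumes K: "K \<in> T" and F: "F face_of closure K" and y: "y \<in> F" "y \<in> \<Omega>"
  shows "rel_interior F \<subseteq> \<Omega>"
proof
  fix x assume x: "x \<in> rel_interior F"
  have cvF: "convex F" using F by (rule face_of_imp_convex)
  have "y \<in> closure (rel_interior F)"
    using convex_closure_rel_interior[OF cvF] y(1) closure_subset by blast
  then obtain z where z: "z \<in> rel_interior F" "z \<in> \<Omega>"
    using open_Int_closure_eq_empty[OF open_domain, of "rel_interior F"] y(2) by blast
  have zF: "z \<in> F" and xF: "x \<in> F"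
    using z x rel_interior_subset by blast+
  obtain e where e: "e > 1" "(1 - e) *\<^sub>R z + e *\<^sub>R x \<in> F"
    using convex_rel_interior_iff[OF cvF, of x] x zF by blast
  define w where "w = (1 - e) *\<^sub>R z + e *\<^sub>R x"
  define s where "s = 1 - 1 / e"
  have s: "0 < s" "s < 1" "1 - s = 1 / e"
    using e by (auto simp: s_def)
  have xeq: "x = (1 - s) *\<^sub>R w + s *\<^sub>R z"
  proof -
    have "(1 - s) *\<^sub>R w = (1 / e * (1 - e)) *\<^sub>R z + (1 / e * e) *\<^sub>R x"
      unfolding s(3) w_def by (simp add: scaleR_right_distrib)
    moreover have "1 / e * (1 - e) = - s" "1 / e * e = 1"
      using e by (auto simp: s_def field_simps)
    ultimately show ?thesis by simp
  qed
  define U where "U = \<Omega> \<inter> (\<Inter>K'\<in>{K'\<in>T. z \<notin> closure K'}. - closure K')"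
  have "open U"
    unfolding U_def using finite_mesh by (intro open_Int open_domain open_INT) auto
  have zU: "z \<in> U" using z by (auto simp: U_def)
  have "(1 - s) *\<^sub>R w + s *\<^sub>R p \<in> closure \<Omega>" if p: "p \<in> U" for p
  proof -
    have "p \<in> closure \<Omega>"
      using p closure_subset by (auto simp: U_def)
    then obtain K' where K': "K' \<in> T" "p \<in> closure K'"
      using closure_elements by blast
    then have "z \<in> closure K'"
      using p by (auto simp: U_def)
    then have "F \<subseteq> closure K \<inter> closure K'"
      using z(1) zF face_of_imp_subset[OF F]
      by (intro subset_of_face_of[OF common_face[OF K K'(1)]]) auto
    then have "w \<in> closure K'"
      using e by (auto simp: w_def)
    then have "(1 - s) *\<^sub>R w + s *\<^sub>R p \<in> closure K'"
      using K' s convex_closure[OF element_convex[OF K'(1)]] by (intro convexD_alt) auto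
    then show ?thesis
      using K' closure_elements by blast
  qed
  then have "(\<lambda>p. (1 - s) *\<^sub>R w + s *\<^sub>R p) ` U \<subseteq> closure \<Omega>" by blast
  then have "(\<lambda>p. (1 - s) *\<^sub>R w + s *\<^sub>R p) ` U \<subseteq> interior (closure \<Omega>)"
    using open_affinity[OF \<open>open U\<close>] s by (intro interior_maximal) auto
  then show "x \<in> \<Omega>"
    using zU xeq interior_closure_lipschitz_polytope[OF lipschitz] by blast
qed

text \<open>Boundary values of an edge-affine function are determined by the boundary vertices only, since
  the smallest face around a boundary point has all its vertices on the boundary.\<close>

lemma edge_affine_boundary:
  assumes K: "K \<in> T" and x: "x \<in> closure K" "x \<notin> \<Omega>" and g: "edge_affine (closure K) g"
    and zero: "\<And>z. z extreme_point_of closure K \<Longrightarrow> z \<notin> \<Omega> \<Longrightarrow> g z = 0"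
  shows "g x = 0"
proof -
  obtain F where F: "F face_of closure K" "x \<in> rel_interior F"
    using polytope_point_in_rel_interior_of_face[OF element_polytope[OF K] x(1)] by blast
  show ?thesis
  proof (rule edge_affine_eq_0[of F])
    show "polytope F"
      using face_of_polytope_polytope[OF element_polytope[OF K] F(1)] .
    show "edge_affine F g"
      using edge_affine_face[OF g F(1)] .
    show "x \<in> F"
      using F(2) rel_interior_subset by blast
    fix z assume z: "z extreme_point_of F"
    then have "z \<notin> \<Omega>"
      using face_interior_in_domain[OF K F(1), of z] F(2) x(2) by (auto simp: extreme_point_of_def)
    then show "g z = 0"
      using z zero extreme_point_of_face[OF F(1)] by blast
  qed
qed

text \<open>The multilinear interpolants on two elements agree on the common closed face, because both are
  edge-affine there and have the same vertex values. So they form a continuous function.\<close>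

lemma nodal_interpolation:
  assumes c: "\<And>z. z \<notin> \<Omega> \<Longrightarrow> c z = (0::real)"
  obtains v where "v \<in> Vh \<Omega> T" "\<And>K z. K \<in> T \<Longrightarrow> z extreme_point_of closure K \<Longrightarrow> v z = c z"
proof -
  have "\<forall>K\<in>T. \<exists>g. edge_affine (closure K) g \<and> continuous_on UNIV g \<and>
      (\<forall>z. z extreme_point_of closure K \<longrightarrow> g z = c z)"
  proof
    fix K assume "K \<in> T"
    then obtain b M N where "chart K b M N" using element_chart by blast
    then show "\<exists>g. edge_affine (closure K) g \<and> continuous_on UNIV g \<and>
      (\<forall>z. z extreme_point_of closure K \<longrightarrow> g z = c z)"
      using chart.edge_affine_interpolant chart.continuous_interpolant chart.interpolant_vertex by blast
  qed
  then obtain g where g: "\<And>K. K \<in> T \<Longrightarrow> edge_affine (closure K) (g K)"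
    "\<And>K. K \<in> T \<Longrightarrow> continuous_on UNIV (g K)"
    "\<And>K z. K \<in> T \<Longrightarrow> z extreme_point_of closure K \<Longrightarrow> g K z = c z"
    by (metis bchoice)
  have agree: "g K x = g K' x" if "K \<in> T" "K' \<in> T" "x \<in> closure K" "x \<in> closure K'" for K K' x
  proof (rule edge_affine_unique[of "closure K \<inter> closure K'"])
    have f: "closure K \<inter> closure K' face_of closure K" "closure K \<inter> closure K' face_of closure K'"
      using common_face[of K K'] common_face[of K' K] that by (simp_all add: Int_commute)
    show "polytope (closure K \<inter> closure K')"
      using face_of_polytope_polytope[OF element_polytope f(1)] that by simp
    show "edge_affine (closure K \<inter> closure K') (g K)" "edge_affine (closure K \<inter> closure K') (g K')"
      using edge_affine_face g(1) f that by blast+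
    show "g K z = g K' z" if "z extreme_point_of closure K \<inter> closure K'" for z
      using that g(3) \<open>K \<in> T\<close> \<open>K' \<in> T\<close> extreme_point_of_face[OF f(1)] extreme_point_of_face[OF f(2)] by metis
  qed (use that in auto)
  define v where "v x = (if x \<in> closure \<Omega> then g (SOME K. K \<in> T \<and> x \<in> closure K) x else 0)" for x
  have v_eq: "v x = g K x" if "K \<in> T" "x \<in> closure K" for K x
  proof -
    have "x \<in> closure \<Omega>" using that closure_elements by blast
    then have "v x = g (SOME K. K \<in> T \<and> x \<in> closure K) x"
      unfolding v_def by (rule if_P)
    moreover have "(SOME K. K \<in> T \<and> x \<in> closure K) \<in> T \<and> x \<in> closure (SOME K. K \<in> T \<and> x \<in> closure K)"
      by (rule someI[of "\<lambda>K. K \<in> T \<and> x \<in> closure K" K]) (simp add: that)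
    ultimately show ?thesis
      using agree[OF _ that(1) _ that(2)] by (elim conjE) (simp only:)
  qed
  have zero: "v x = 0" if "x \<notin> \<Omega>" for x
  proof (cases "x \<in> closure \<Omega>")
    case True
    then obtain K where K: "K \<in> T" "x \<in> closure K" using closure_elements by blast
    then show ?thesis
      using edge_affine_boundary[OF K that g(1)[OF K(1)]] g(3)[OF K(1)] c v_eq[OF K] by simp
  qed (simp add: v_def)
  have "continuous_on ((\<Union>K\<in>T. closure K) \<union> - \<Omega>) v"
  proof (rule continuous_on_closed_Un)
    show "closed (\<Union>K\<in>T. closure K)" "closed (- \<Omega>)"
      using open_domain by (simp_all add: closure_elements closed_Compl)
    show "continuous_on (\<Union>K\<in>T. closure K) v"
    proof (rule continuous_on_closed_Union[OF finite_mesh])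
      fix K assume K: "K \<in> T"
      show "continuous_on (closure K) v"
        using continuous_on_subset[OF g(2)[OF K] subset_UNIV]
        by (rule continuous_on_eq) (simp add: v_eq[OF K])
    qed simp
    show "continuous_on (- \<Omega>) v"
      by (rule continuous_on_eq[of _ "\<lambda>_. 0"]) (auto simp: zero)
  qed
  moreover have "(\<Union>K\<in>T. closure K) \<union> - \<Omega> = UNIV"
    using closure_subset by (auto simp: closure_elements)
  ultimately have "continuous_on UNIV v" by simp
  moreover have "edge_affine (closure K) v" if "K \<in> T" for K
    using edge_affine_cong[OF g(1)[OF that] polytope_imp_convex[OF element_polytope[OF that]]] v_eq[OF that] by simp
  ultimately have "v \<in> Vh \<Omega> T"
    using zero by (simp add: Vh_iff)
  moreover have "v z = c z" if "K \<in> T" "z extreme_point_of closure K" for K z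
    using v_eq[of K z] g(3)[OF that] that by (simp add: extreme_point_of_def)
  ultimately show ?thesis using that by blast
qed

lemma Vh_eq_interpolant:
  assumes "K \<in> T" "chart K b M N" "v \<in> Vh \<Omega> T" "x \<in> closure K"
  shows "v x = chart.interpolant b M N v x"
  using chart.eq_interpolant[OF assms(2) _ assms(4)] assms(1,3) by (simp add: Vh_iff)

text \<open>Nodal truncation: cutting off the nodal values is a cheap substitute for multiplying with a
  cut-off function and interpolating the product.\<close>

lemma nodal_truncation:
  assumes u: "u \<in> Vh \<Omega> T"
  obtains v where "v \<in> Vh \<Omega> T"
    "\<And>K x. K \<in> T \<Longrightarrow> closure K \<subseteq> Z \<Longrightarrow> x \<in> closure K \<Longrightarrow> v x = 0"
    "\<And>K x. K \<in> T \<Longrightarrow> closure K \<inter> Z = {} \<Longrightarrow> x \<in> closure K \<Longrightarrow> v x = u x"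
    "\<And>K b M N I. K \<in> T \<Longrightarrow> chart K b M N \<Longrightarrow>
       \<bar>v (affine_ref b M (corner I))\<bar> \<le> \<bar>u (affine_ref b M (corner I))\<bar>"
proof -
  define c where "c z = (if z \<in> Z then 0 else u z)" for z
  have "c z = 0" if "z \<notin> \<Omega>" for z
    using u that by (simp add: c_def Vh_def)
  then obtain v where v: "v \<in> Vh \<Omega> T" "\<And>K z. K \<in> T \<Longrightarrow> z extreme_point_of closure K \<Longrightarrow> v z = c z"
    using nodal_interpolation by blast
  have ea: "edge_affine (closure K) v" "edge_affine (closure K) u" if "K \<in> T" for K
    using v(1) u that by (auto simp: Vh_iff)
  show ?thesis
  proof (rule that[OF v(1)])
    fix K x assume K: "K \<in> T" and x: "x \<in> closure K"
    have vertex: "z \<in> closure K" if "z extreme_point_of closure K" for z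
      using that by (simp add: extreme_point_of_def)
    show "v x = 0" if "closure K \<subseteq> Z"
      using edge_affine_unique[OF element_polytope[OF K] ea(1)[OF K] edge_affine_zero _ x] v(2)[OF K] vertex that
      by (auto simp: c_def subset_iff)
    show "v x = u x" if "closure K \<inter> Z = {}"
      using edge_affine_unique[OF element_polytope[OF K] ea(1,2)[OF K] _ x] v(2)[OF K] vertex that
      by (auto simp: c_def disjoint_iff)
  next
    fix K b M N and I :: "'d set"
    assume K: "K \<in> T" and ch: "chart K b M N"
    interpret chart K b M N by fact
    have "v (affine_ref b M (corner I)) = interpolant c (affine_ref b M (corner I))"
      using edge_affine_unique[OF element_polytope[OF K] ea(1)[OF K] edge_affine_interpolant[of c] _ corner_in_closure]
        v(2)[OF K] interpolant_vertex by simp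
    also have "\<dots> = c (affine_ref b M (corner I))"
      by (rule interpolant_corner)
    finally show "\<bar>v (affine_ref b M (corner I))\<bar> \<le> \<bar>u (affine_ref b M (corner I))\<bar>"
      by (simp add: c_def)
  qed
qed


section \<open>Layers of elements\<close>

lemma closure_interior_elements:
  assumes "R \<subseteq> T"
  shows "closure (interior (\<Union>K\<in>R. closure K)) = (\<Union>K\<in>R. closure K)"
proof
  have "closed (\<Union>K\<in>R. closure K)"
    using assms finite_subset[OF assms finite_mesh] by auto
  then show "closure (interior (\<Union>K\<in>R. closure K)) \<subseteq> (\<Union>K\<in>R. closure K)"
    by (intro closure_minimal interior_subset)
  have "K \<subseteq> interior (\<Union>K\<in>R. closure K)" if "K \<in> R" for K
    using that assms element_open[of K] closure_subset[of K] by (intro interior_maximal) auto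
  then show "(\<Union>K\<in>R. closure K) \<subseteq> closure (interior (\<Union>K\<in>R. closure K))"
    using closure_mono by blast
qed

primrec layers :: "(real^'d) set set \<Rightarrow> nat \<Rightarrow> (real^'d) set set" where
  "layers S 0 = S"
| "layers S (Suc k) = {K\<in>T. \<exists>K'\<in>layers S k. closure K \<inter> closure K' \<noteq> {}}"

lemma layers_subset: "S \<subseteq> T \<Longrightarrow> layers S k \<subseteq> T"
  by (cases k) auto

lemma layers_mono: "S \<subseteq> T \<Longrightarrow> layers S k \<subseteq> layers S (Suc k)"
  using layers_subset[of S k] element_nonempty closure_eq_empty by fastforce

lemma layers_separated:
  assumes "K \<in> T" "K \<notin> layers S (Suc k)"
  shows "closure K \<inter> (\<Union>K'\<in>layers S k. closure K') = {}"
  using assms by auto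

lemma patch_layers:
  assumes "S \<subseteq> T"
  shows "closure (patch_iter T k (\<Union>S)) = (\<Union>K\<in>layers S k. closure K)"
    and "patch_iter T (Suc k) (\<Union>S) = interior (\<Union>K\<in>layers S (Suc k). closure K)"
proof -
  have step: "patch T \<omega> = interior (\<Union>K\<in>layers S (Suc k). closure K)"
    if "closure \<omega> = (\<Union>K\<in>layers S k. closure K)" for k \<omega>
    unfolding patch_def that by (intro arg_cong[of _ _ interior]) auto
  have clo: "closure (patch_iter T k (\<Union>S)) = (\<Union>K\<in>layers S k. closure K)" for k
  proof (induction k)
    case 0
    have "finite S" using assms finite_mesh finite_subset by blast
    then have "closure (\<Union>S) = (\<Union>K\<in>S. closure K)"
      by (induction S rule: finite_induct) (simp_all add: closure_Un)
    then show ?case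
      by (simp add: patch_iter_def)
  next
    case (Suc k)
    then show ?case
      using step[of "patch_iter T k (\<Union>S)" k] closure_interior_elements[OF layers_subset[OF assms, of "Suc k"]]
      by (simp add: patch_iter_def)
  qed
  show "closure (patch_iter T k (\<Union>S)) = (\<Union>K\<in>layers S k. closure K)"
    by (rule clo)
  show "patch_iter T (Suc k) (\<Union>S) = interior (\<Union>K\<in>layers S (Suc k). closure K)"
    using step[OF clo, of k] by (simp add: patch_iter_def)
qed

end


section \<open>Gradients of finite element functions\<close>

lemma grad_eqI:
  assumes "GDERIV v x :> D"
  shows "grad v x = D"
  unfolding grad_def
proof (rule the_equality)
  show "GDERIV v x :> D" by (rule assms)
  fix D' assume "GDERIV v x :> D'"
  then have "(\<lambda>h. h \<bullet> D') = (\<lambda>h. h \<bullet> D)"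
    using assms unfolding gderiv_def by (rule has_derivative_unique)
  then show "D' = D"
    by (metis vector_eq_ldot)
qed

lemma GDERIV_grad:
  fixes v :: "real^'d \<Rightarrow> real"
  assumes "v differentiable (at x)"
  shows "GDERIV v x :> grad v x"
proof -
  obtain f where f: "(v has_derivative f) (at x)"
    using assms by (auto simp: differentiable_def)
  then have "linear f"
    by (rule has_derivative_linear)
  then have "f = (\<lambda>h. h \<bullet> adjoint f 1)"
    using adjoint_works[of f _ 1] by (simp add: fun_eq_iff)
  then have "GDERIV v x :> adjoint f 1"
    using f unfolding gderiv_def by simp
  then show ?thesis
    using grad_eqI by metis
qed

lemma grad_cong_open:
  assumes "open S" "x \<in> S" "\<And>y. y \<in> S \<Longrightarrow> v y = w y"
  shows "grad v x = grad w x"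
proof -
  have "GDERIV v x :> D \<longleftrightarrow> GDERIV w x :> D" for D
    unfolding gderiv_def
    using has_derivative_transform_within_open[of v _ x UNIV S w]
      has_derivative_transform_within_open[of w _ x UNIV S v] assms by metis
  then show ?thesis
    by (simp add: grad_def)
qed

lemma grad_zero_open:
  assumes "open S" "x \<in> S" "\<And>y. y \<in> S \<Longrightarrow> v y = 0"
  shows "grad v x = 0"
  using grad_cong_open[OF assms(1,2), of v "\<lambda>_. 0"] assms(3) grad_eqI[OF GDERIV_const[of 0 x]] by simp

text \<open>A gradient is thus a limit of countably many difference quotients. This makes it measurable on an
  element, and it bounds its norm by the Lipschitz constant.\<close>

lemma difference_quotient_tendsto:
  assumes "GDERIV v x :> D"
  shows "(\<lambda>n. (v (x + (1 / real (Suc n)) *\<^sub>R w) - v x) * real (Suc n)) \<longlonglongrightarrow> w \<bullet> D"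
proof -
  have "((\<lambda>t. v (x + t *\<^sub>R w)) has_derivative (\<lambda>t. (t *\<^sub>R w) \<bullet> D)) (at 0)"
    by (rule has_derivative_compose[of "\<lambda>t. x + t *\<^sub>R w" "\<lambda>t. t *\<^sub>R w" 0 UNIV v "\<lambda>h. h \<bullet> D"])
      (use assms in \<open>auto intro!: derivative_eq_intros simp: gderiv_def\<close>)
  then have "((\<lambda>t. v (x + t *\<^sub>R w)) has_real_derivative (w \<bullet> D)) (at 0)"
    by (simp add: has_field_derivative_def mult.commute[of _ "w \<bullet> D"])
  then have lim: "((\<lambda>t. (v (x + t *\<^sub>R w) - v x) / t) \<longlongrightarrow> w \<bullet> D) (at 0)"
    by (simp add: has_field_derivative_iff)
  have "filterlim (\<lambda>n. 1 / real (Suc n)) (at 0) sequentially"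
    using LIMSEQ_inverse_real_of_nat by (intro filterlim_atI) (auto simp: inverse_eq_divide)
  from filterlim_compose[OF lim this] show ?thesis
    by (simp add: divide_simps)
qed

lemma norm_grad_le:
  fixes v :: "real^'d \<Rightarrow> real"
  assumes "open K" "x \<in> K" "v differentiable (at x)"
    and L: "\<And>y. y \<in> K \<Longrightarrow> \<bar>v y - v x\<bar> \<le> L * norm (y - x)"
  shows "norm (grad v x) \<le> L"
proof (cases "grad v x = 0")
  case True
  have "eventually (\<lambda>y. y \<in> K) (at x)"
    using assms(1,2) eventually_at_topological by blast
  then obtain y where y: "y \<in> K" "y \<noteq> x"
    using eventually_happens'[OF at_neq_bot, of "\<lambda>y. y \<in> K \<and> y \<noteq> x" x]
      eventually_conj[OF _ eventually_neq_at_within[of x x UNIV]] by auto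
  then have "0 \<le> L"
  proof -
    have "0 \<le> L * norm (y - x)"
      using L[OF y(1)] abs_ge_zero[of "v y - v x"] by (rule order_trans[rotated])
    moreover have "0 < norm (y - x)" using y(2) by simp
    ultimately show ?thesis by (simp add: zero_le_mult_iff)
  qed
  then show ?thesis using True by simp
next
  case False
  let ?D = "grad v x"
  have "(\<lambda>n. (v (x + (1 / real (Suc n)) *\<^sub>R ?D) - v x) * real (Suc n)) \<longlonglongrightarrow> ?D \<bullet> ?D"
    by (rule difference_quotient_tendsto[OF GDERIV_grad[OF assms(3)]])
  moreover have "eventually (\<lambda>n. (v (x + (1 / real (Suc n)) *\<^sub>R ?D) - v x) * real (Suc n) \<le> L * norm ?D) sequentially"
  proof -
    have "(\<lambda>n. x + (1 / real (Suc n)) *\<^sub>R ?D) \<longlonglongrightarrow> x + 0 *\<^sub>R ?D"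
      using LIMSEQ_inverse_real_of_nat by (intro tendsto_intros) (simp add: inverse_eq_divide)
    then have "eventually (\<lambda>n. x + (1 / real (Suc n)) *\<^sub>R ?D \<in> K) sequentially"
      by (rule topological_tendstoD) (use assms in auto)
    then show ?thesis
    proof eventually_elim
      case (elim n)
      have "v (x + (1 / real (Suc n)) *\<^sub>R ?D) - v x \<le> L * norm ((1 / real (Suc n)) *\<^sub>R ?D)"
        using L[OF elim] by simp
      also have "\<dots> = L * norm ?D / real (Suc n)"
        by simp
      finally show ?case
        by (simp add: pos_le_divide_eq)
    qed
  qed
  ultimately have "?D \<bullet> ?D \<le> L * norm ?D"
    by (rule tendsto_upperbound) simp
  then have "norm ?D * norm ?D \<le> L * norm ?D"
    by (simp add: dot_square_norm power2_eq_square)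
  then show ?thesis
    using False by simp
qed

lemma (in chart) interpolant_differentiable: "interpolant c differentiable (at x)"
proof -
  have lin: "bounded_linear (\<lambda>x. (N *v x) $ i)" for i
    by (intro bounded_linear_compose[OF bounded_linear_vec_nth] matrix_vector_mul_bounded_linear)
  have "((\<lambda>x. if i \<in> I then pull x $ i else 1 - pull x $ i) has_derivative
      (\<lambda>h. if i \<in> I then (N *v h) $ i else - (N *v h) $ i)) (at x)" for i I
    unfolding pull_def
    by (cases "i \<in> I") (auto intro!: derivative_eq_intros bounded_linear.has_derivative[OF lin])
  then have "(\<lambda>x. Q1_hat I (pull x)) differentiable (at x)" for I
    unfolding Q1_hat_def differentiable_def
    by (intro exI) (rule has_derivative_prod)
  then show ?thesis
    unfolding interpolant_def[abs_def] by (intro differentiable_sum ballI differentiable_mult differentiable_const) auto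
qed

context fe_mesh
begin

lemma Vh_differentiable:
  assumes "v \<in> Vh \<Omega> T" "K \<in> T" "x \<in> K"
  shows "v differentiable (at x)"
proof -
  obtain b M N where ch: "chart K b M N" using element_chart[OF assms(2)] .
  obtain f where "(chart.interpolant b M N v has_derivative f) (at x)"
    using chart.interpolant_differentiable[OF ch] by (auto simp: differentiable_def)
  then have "(v has_derivative f) (at x)"
    by (rule has_derivative_transform_within_open[OF _ element_open[OF assms(2)] assms(3)])
      (use Vh_eq_interpolant[OF assms(2) ch assms(1)] closure_subset[of K] in auto)
  then show ?thesis by (auto simp: differentiable_def)
qed

lemma grad_lincomb:
  assumes "v \<in> Vh \<Omega> T" "w \<in> Vh \<Omega> T" "K \<in> T" "x \<in> K"
  shows "grad (\<lambda>x. a * v x + b * w x) x = a *\<^sub>R grad v x + b *\<^sub>R grad w x"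
proof (rule grad_eqI)
  have "GDERIV v x :> grad v x" "GDERIV w x :> grad w x"
    using Vh_differentiable assms GDERIV_grad by blast+
  then show "GDERIV (\<lambda>x. a * v x + b * w x) x :> a *\<^sub>R grad v x + b *\<^sub>R grad w x"
    unfolding gderiv_def by (auto intro!: derivative_eq_intros simp: inner_add_right)
qed

lemma Vh_measurable:
  assumes "v \<in> Vh \<Omega> T" "S \<in> sets lebesgue"
  shows "v \<in> borel_measurable (lebesgue_on S)"
  using assms continuous_on_subset[of UNIV v S]
  by (intro continuous_imp_measurable_on_sets_lebesgue) (simp_all add: Vh_iff)

lemma grad_measurable:
  assumes v: "v \<in> Vh \<Omega> T" and K: "K \<in> T"
  shows "grad v \<in> borel_measurable (lebesgue_on K)"
proof (rule borel_measurable_euclidean_space[THEN iffD2], rule ballI)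
  fix i :: "real^'d" assume "i \<in> Basis"
  show "(\<lambda>x. grad v x \<bullet> i) \<in> borel_measurable (lebesgue_on K)"
  proof (rule borel_measurable_LIMSEQ_real)
    fix x assume "x \<in> space (lebesgue_on K)"
    then have "GDERIV v x :> grad v x"
      by (intro GDERIV_grad Vh_differentiable[OF v K]) simp
    then show "(\<lambda>n. (v (x + (1 / real (Suc n)) *\<^sub>R i) - v x) * real (Suc n)) \<longlonglongrightarrow> grad v x \<bullet> i"
      by (subst inner_commute) (rule difference_quotient_tendsto)
  next
    fix n
    have cont: "continuous_on UNIV v"
      using v by (simp add: Vh_iff)
    have "continuous_on K (\<lambda>x. (v (x + (1 / real (Suc n)) *\<^sub>R i) - v x) * real (Suc n))"
      by (intro continuous_intros continuous_on_compose2[OF cont]) auto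
    then show "(\<lambda>x. (v (x + (1 / real (Suc n)) *\<^sub>R i) - v x) * real (Suc n)) \<in> borel_measurable (lebesgue_on K)"
      using element_open[OF K] by (intro continuous_imp_measurable_on_sets_lebesgue) auto
  qed
qed


section \<open>Inverse estimates on an element\<close>

definition vertex_sum :: "real^'d \<Rightarrow> real^'d^'d \<Rightarrow> (real^'d \<Rightarrow> real) \<Rightarrow> real" where
  "vertex_sum b M v = (\<Sum>I\<in>UNIV. \<bar>v (affine_ref b M (corner I))\<bar>)"

lemma vertex_sum_nonneg: "0 \<le> vertex_sum b M v"
  by (simp add: vertex_sum_def sum_nonneg)

lemma Vh_le_vertex_sum:
  assumes "K \<in> T" "chart K b M N" "v \<in> Vh \<Omega> T" "x \<in> closure K"
  shows "\<bar>v x\<bar> \<le> vertex_sum b M v"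
proof -
  interpret chart K b M N by fact
  have "\<bar>v x\<bar> \<le> (\<Sum>I\<in>UNIV. \<bar>v (affine_ref b M (corner I)) * Q1_hat I (pull x)\<bar>)"
    unfolding Vh_eq_interpolant[OF assms] interpolant_def by (rule sum_abs)
  also have "\<dots> \<le> vertex_sum b M v"
    unfolding vertex_sum_def using assms(4) Q1_hat_bounds[of "pull x"]
    by (intro sum_mono) (simp add: abs_mult mem_closure_iff mult_left_le)
  finally show ?thesis .
qed

lemma Vh_Lipschitz_vertex_sum:
  assumes "K \<in> T" "chart K b M N" "v \<in> Vh \<Omega> T" "x \<in> closure K" "y \<in> closure K"
  shows "\<bar>v x - v y\<bar> \<le> vertex_sum b M v * (\<Sum>i\<in>UNIV. \<bar>(N *v (x - y)) $ i\<bar>)"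
proof -
  interpret chart K b M N by fact
  have eq: "v x - v y = (\<Sum>I\<in>UNIV. v (affine_ref b M (corner I)) * (Q1_hat I (pull x) - Q1_hat I (pull y)))"
    unfolding Vh_eq_interpolant[OF assms(1-4)] Vh_eq_interpolant[OF assms(1-3,5)] interpolant_def
    by (simp add: sum_subtractf algebra_simps)
  have "\<bar>v x - v y\<bar> \<le> (\<Sum>I\<in>UNIV. \<bar>v (affine_ref b M (corner I)) * (Q1_hat I (pull x) - Q1_hat I (pull y))\<bar>)"
    unfolding eq by (rule sum_abs)
  also have "\<dots> \<le> (\<Sum>I\<in>UNIV. \<bar>v (affine_ref b M (corner I))\<bar> * (\<Sum>i\<in>UNIV. \<bar>pull x $ i - pull y $ i\<bar>))"
    using assms(4,5) by (intro sum_mono) (simp add: abs_mult mem_closure_iff Q1_hat_Lipschitz mult_left_mono)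
  also have "\<dots> = vertex_sum b M v * (\<Sum>i\<in>UNIV. \<bar>(N *v (x - y)) $ i\<bar>)"
    by (simp add: vertex_sum_def sum_distrib_right flip: pull_diff)
  finally show ?thesis .
qed

text \<open>Shape regularity bounds the inverse of the reference map: the difference of two points of the
  inscribed ball is pulled back to the difference of two points of the unit cube.\<close>

lemma mesh_size_pos:
  assumes "K \<in> T"
  shows "0 < diameter K" "0 < h"
proof -
  obtain x where x: "x \<in> K" using element_nonempty[OF assms] by blast
  obtain e where e: "e > 0" "ball x e \<subseteq> K"
    using element_open[OF assms] x open_contains_ball by blast
  obtain i :: "real^'d" where i: "i \<in> Basis" using nonempty_Basis by blast
  have "x + (e/2) *\<^sub>R i \<in> K"
    using e i by (intro subsetD[OF e(2)]) (simp add: dist_norm)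
  then have "dist x (x + (e/2) *\<^sub>R i) \<le> diameter K"
    using diameter_bounded_bound[OF element_bounded[OF assms]] x by blast
  then show "0 < diameter K"
    using e i by (simp add: dist_norm)
  moreover have "diameter K \<le> h"
    using mesh assms finite_mesh by (auto simp: regular_mesh_def)
  ultimately show "0 < h" by simp
qed

lemma pull_back_bound:
  assumes K: "K \<in> T" and ch: "chart K b M N" and \<sigma>: "0 < \<sigma>"
  shows "\<bar>(N *v w) $ i\<bar> \<le> 2 * \<sigma>\<^sup>2 / h * norm w"
proof (cases "w = 0")
  case False
  interpret chart K b M N by fact
  define r where "r = diameter K / \<sigma>"
  have r: "0 < r" and hr: "h \<le> \<sigma>\<^sup>2 * r"
    using mesh_size_pos[OF K] \<sigma> mesh K by (auto simp: r_def regular_mesh_def power2_eq_square)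
  obtain x where x: "ball x r \<subseteq> K"
    using mesh K by (auto simp: regular_mesh_def r_def)
  define y where "y = x + (r / (2 * norm w)) *\<^sub>R w"
  have "x \<in> K" "y \<in> K"
    using x r False by (auto simp: y_def dist_norm subset_iff)
  then have "pull x \<in> box 0 1" "pull y \<in> box 0 1"
    by (simp_all add: mem_iff)
  then have "\<bar>(pull y - pull x) $ i\<bar> \<le> 1"
    unfolding mem_box_cart by (auto simp: abs_le_iff intro: less_imp_le) (smt (verit) zero_index one_index)+
  moreover have "pull y - pull x = (r / (2 * norm w)) *\<^sub>R (N *v w)"
    by (simp add: pull_diff y_def matrix_vector_mult_scaleR)
  ultimately have "r / (2 * norm w) * \<bar>(N *v w) $ i\<bar> \<le> 1"
    using r by (simp add: abs_mult)
  then have "\<bar>(N *v w) $ i\<bar> \<le> 2 * norm w / r"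
    using r False by (simp add: field_simps)
  also have "\<dots> \<le> 2 * norm w * (\<sigma>\<^sup>2 / h)"
  proof -
    have "1 / r \<le> \<sigma>\<^sup>2 / h"
      using r hr mesh_size_pos[OF K] by (simp add: field_simps)
    from mult_left_mono[OF this, of "2 * norm w"] show ?thesis by simp
  qed
  finally show ?thesis by (simp add: mult_ac)
qed simp

text \<open>The gradient is at most the Lipschitz constant on the element, so the derivative of the reference map need
  not be computed.\<close>

lemma norm_grad_vertex_sum:
  assumes K: "K \<in> T" and ch: "chart K b M N" and v: "v \<in> Vh \<Omega> T" and \<sigma>: "0 < \<sigma>" and x: "x \<in> K"
  shows "norm (grad v x) \<le> vertex_sum b M v * (2 * real CARD('d) * \<sigma>\<^sup>2 / h)"
proof (rule norm_grad_le[OF element_open[OF K] x Vh_differentiable[OF v K x]])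
  fix y assume y: "y \<in> K"
  have "\<bar>v y - v x\<bar> \<le> vertex_sum b M v * (\<Sum>i\<in>UNIV. \<bar>(N *v (y - x)) $ i\<bar>)"
    using x y closure_subset[of K] by (intro Vh_Lipschitz_vertex_sum[OF K ch v]) auto
  also have "\<dots> \<le> vertex_sum b M v * (\<Sum>i\<in>(UNIV::'d set). 2 * \<sigma>\<^sup>2 / h * norm (y - x))"
    by (intro mult_left_mono sum_mono pull_back_bound[OF K ch \<sigma>] vertex_sum_nonneg)
  finally show "\<bar>v y - v x\<bar> \<le> vertex_sum b M v * (2 * real CARD('d) * \<sigma>\<^sup>2 / h) * norm (y - x)"
    by (simp add: mult_ac)
qed

end


section \<open>Mass and energy on the elements\<close>

lemma quadratic_nonneg_Cauchy_Schwarz: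
  fixes a b c :: real
  assumes nonneg: "\<And>t. 0 \<le> a + 2 * t * b + t\<^sup>2 * c" and c: "0 \<le> c"
  shows "\<bar>b\<bar> \<le> sqrt a * sqrt c"
proof (cases "c = 0")
  case True
  have "b = 0"
  proof (rule ccontr)
    assume "b \<noteq> 0"
    then show False
      using nonneg[of "- (a + 1) / (2 * b)"] True by (simp add: field_simps)
  qed
  then show ?thesis using True by simp
next
  case False
  then have "0 < c" using c by simp
  then have "b\<^sup>2 \<le> a * c"
    using nonneg[of "- b / c"] by (simp add: field_simps power2_eq_square)
  then show ?thesis
    by (metis real_sqrt_abs real_sqrt_le_iff real_sqrt_mult)
qed

lemma sum_two_products_le_sqrt:
  fixes p q p' q' :: real
  assumes "0 \<le> p" "0 \<le> q" "0 \<le> p'" "0 \<le> q'"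
  shows "sqrt p * sqrt p' + sqrt q * sqrt q' \<le> sqrt (p + q) * sqrt (p' + q')"
proof (rule power2_le_imp_le)
  define a b c d where "a = sqrt p" and "b = sqrt q" and "c = sqrt p'" and "d = sqrt q'"
  have eq: "p = a\<^sup>2" "q = b\<^sup>2" "p' = c\<^sup>2" "q' = d\<^sup>2"
    using assms by (simp_all add: a_def b_def c_def d_def)
  have "(a * c + b * d)\<^sup>2 + (a * d - b * c)\<^sup>2 = (a\<^sup>2 + b\<^sup>2) * (c\<^sup>2 + d\<^sup>2)"
    by (simp add: power2_eq_square algebra_simps)
  moreover have "(sqrt (p + q) * sqrt (p' + q'))\<^sup>2 = (p + q) * (p' + q')"
    using assms by (simp add: power_mult_distrib)
  moreover have "0 \<le> (a * d - b * c)\<^sup>2" by simp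
  ultimately show "(sqrt p * sqrt p' + sqrt q * sqrt q')\<^sup>2 \<le> (sqrt (p + q) * sqrt (p' + q'))\<^sup>2"
    unfolding a_def[symmetric] b_def[symmetric] c_def[symmetric] d_def[symmetric] eq(1)[symmetric] eq(2)[symmetric]
      eq(3)[symmetric] eq(4)[symmetric] by linarith
qed (use assms in simp)

locale wave_mesh = fe_mesh \<Omega> \<sigma> h T
  for \<Omega> :: "(real^'d) set" and \<sigma> h :: real and T +
  fixes A :: "real^'d \<Rightarrow> real" and \<alpha> \<beta> \<tau> :: real
  assumes A_measurable: "A \<in> borel_measurable (lebesgue_on \<Omega>)"
    and A_bounds: "AE x in lebesgue_on \<Omega>. \<alpha> \<le> A x \<and> A x \<le> \<beta>"
    and positive: "0 < \<alpha>" "0 < \<beta>" "0 < \<sigma>" "0 < \<tau>"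
begin

lemma element_lmeasurable: "K \<in> T \<Longrightarrow> K \<in> lmeasurable"
  by (intro lmeasurable_open element_bounded element_open)

lemma element_lebesgue: "K \<in> T \<Longrightarrow> K \<in> sets lebesgue"
  using element_lmeasurable fmeasurableD by blast

lemma element_A_measurable: "K \<in> T \<Longrightarrow> A \<in> borel_measurable (lebesgue_on K)"
  using A_measurable element_subset_domain by (rule measurable_restrict_mono)

lemma element_A_bounds:
  assumes "K \<in> T"
  shows "AE x in lebesgue_on K. \<alpha> \<le> A x \<and> A x \<le> \<beta>"
proof -
  have "AE x in lebesgue. x \<in> \<Omega> \<longrightarrow> \<alpha> \<le> A x \<and> A x \<le> \<beta>"
    using A_bounds open_domain by (subst (asm) AE_restrict_space_iff) auto
  then have "AE x in lebesgue. x \<in> K \<longrightarrow> \<alpha> \<le> A x \<and> A x \<le> \<beta>"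
    by eventually_elim (use element_subset_domain[OF assms] in auto)
  then show ?thesis
    using element_lebesgue[OF assms] by (subst AE_restrict_space_iff) auto
qed

lemma element_bounded_functions:
  assumes K: "K \<in> T" and v: "v \<in> Vh \<Omega> T"
  obtains B where "0 \<le> B" "\<And>x. x \<in> K \<Longrightarrow> \<bar>v x\<bar> \<le> B" "\<And>x. x \<in> K \<Longrightarrow> norm (grad v x) \<le> B"
proof -
  obtain b M N where ch: "chart K b M N" using element_chart[OF K] .
  let ?B1 = "vertex_sum b M v" and ?B2 = "vertex_sum b M v * (2 * real CARD('d) * \<sigma>\<^sup>2 / h)"
  have "\<bar>v x\<bar> \<le> max ?B1 ?B2" "norm (grad v x) \<le> max ?B1 ?B2" if "x \<in> K" for x
    using Vh_le_vertex_sum[OF K ch v, of x] norm_grad_vertex_sum[OF K ch v positive(3) that] that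
      closure_subset[of K] by (auto simp: le_max_iff_disj)
  moreover have "0 \<le> max ?B1 ?B2"
    using vertex_sum_nonneg[of b M v] by simp
  ultimately show ?thesis using that by blast
qed

lemma integrable_mass:
  assumes K: "K \<in> T" and v: "v \<in> Vh \<Omega> T" and w: "w \<in> Vh \<Omega> T"
  shows "integrable (lebesgue_on K) (\<lambda>x. v x * w x)"
proof -
  obtain B C where B: "0 \<le> B" "\<And>x. x \<in> K \<Longrightarrow> \<bar>v x\<bar> \<le> B" and C: "\<And>x. x \<in> K \<Longrightarrow> \<bar>w x\<bar> \<le> C"
    using element_bounded_functions[OF K v] element_bounded_functions[OF K w] by metis
  have "AE x in lebesgue_on K. norm (v x * w x) \<le> B * C"
    by (rule AE_I2) (use B C in \<open>auto simp: abs_mult intro!: mult_mono\<close>)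
  moreover have "(\<lambda>x. v x * w x) \<in> borel_measurable (lebesgue_on K)"
    by (intro borel_measurable_times Vh_measurable v w element_lebesgue K)
  ultimately show ?thesis
    by (rule finite_measure.integrable_const_bound[OF finite_measure_lebesgue_on[OF element_lmeasurable[OF K]]])
qed

lemma integrable_energy:
  assumes K: "K \<in> T" and v: "v \<in> Vh \<Omega> T" and w: "w \<in> Vh \<Omega> T"
  shows "integrable (lebesgue_on K) (\<lambda>x. (A x *\<^sub>R grad v x) \<bullet> grad w x)"
proof -
  obtain B C where B: "0 \<le> B" "\<And>x. x \<in> K \<Longrightarrow> norm (grad v x) \<le> B"
    and C: "0 \<le> C" "\<And>x. x \<in> K \<Longrightarrow> norm (grad w x) \<le> C"
    using element_bounded_functions[OF K v] element_bounded_functions[OF K w] by metis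
  have "AE x in lebesgue_on K. x \<in> K"
    by (rule AE_I2) simp
  with element_A_bounds[OF K]
  have "AE x in lebesgue_on K. norm ((A x *\<^sub>R grad v x) \<bullet> grad w x) \<le> (\<beta> * B) * C"
  proof eventually_elim
    case (elim x)
    have "norm ((A x *\<^sub>R grad v x) \<bullet> grad w x) \<le> norm (A x *\<^sub>R grad v x) * norm (grad w x)"
      using Cauchy_Schwarz_ineq2[of "A x *\<^sub>R grad v x" "grad w x"] by (simp only: real_norm_def)
    also have "\<dots> \<le> (\<beta> * B) * C"
      using elim positive B C by (intro mult_mono) (auto intro!: mult_mono)
    finally show ?case .
  qed
  moreover have "(\<lambda>x. (A x *\<^sub>R grad v x) \<bullet> grad w x) \<in> borel_measurable (lebesgue_on K)"
    by (intro borel_measurable_inner borel_measurable_scaleR element_A_measurable grad_measurable K v w)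
  ultimately show ?thesis
    by (rule finite_measure.integrable_const_bound[OF finite_measure_lebesgue_on[OF element_lmeasurable[OF K]]])
qed

lemma mass_lincomb:
  assumes K: "K \<in> T" and "u \<in> Vh \<Omega> T" "v \<in> Vh \<Omega> T" "w \<in> Vh \<Omega> T"
  shows "L2_inner K (\<lambda>x. a * u x + b * v x) w = a * L2_inner K u w + b * L2_inner K v w"
proof -
  have "L2_inner K (\<lambda>x. a * u x + b * v x) w = (LINT x|lebesgue_on K. a * (u x * w x) + b * (v x * w x))"
    unfolding L2_inner_def by (intro Bochner_Integration.integral_cong) (auto simp: algebra_simps)
  also have "\<dots> = a * L2_inner K u w + b * L2_inner K v w"
    unfolding L2_inner_def
    using integrable_mass[OF K] assms by (subst Bochner_Integration.integral_add) auto
  finally show ?thesis .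
qed

lemma energy_lincomb:
  assumes K: "K \<in> T" and u: "u \<in> Vh \<Omega> T" and v: "v \<in> Vh \<Omega> T" and w: "w \<in> Vh \<Omega> T"
  shows "energy_form A K (\<lambda>x. a * u x + b * v x) w = a * energy_form A K u w + b * energy_form A K v w"
proof -
  have "energy_form A K (\<lambda>x. a * u x + b * v x) w
      = (LINT x|lebesgue_on K. a * ((A x *\<^sub>R grad u x) \<bullet> grad w x) + b * ((A x *\<^sub>R grad v x) \<bullet> grad w x))"
    unfolding energy_form_def
    by (intro Bochner_Integration.integral_cong) (auto simp: grad_lincomb[OF u v K] inner_add_left algebra_simps)
  also have "\<dots> = a * energy_form A K u w + b * energy_form A K v w"
    unfolding energy_form_def
    using integrable_energy[OF K u w] integrable_energy[OF K v w]
    by (subst Bochner_Integration.integral_add) auto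
  finally show ?thesis .
qed

lemma mass_commute: "L2_inner S v w = L2_inner S w v"
  by (simp add: L2_inner_def mult.commute)

lemma energy_commute: "energy_form A S v w = energy_form A S w v"
  by (simp add: energy_form_def inner_commute)

lemma mass_nonneg: "0 \<le> L2_inner S v v"
  unfolding L2_inner_def by (intro Bochner_Integration.integral_nonneg) simp

lemma energy_nonneg:
  assumes K: "K \<in> T"
  shows "0 \<le> energy_form A K v v"
  unfolding energy_form_def
proof (rule integral_nonneg_AE)
  show "AE x in lebesgue_on K. 0 \<le> (A x *\<^sub>R grad v x) \<bullet> grad v x"
    using element_A_bounds[OF K] by eventually_elim (use positive in simp)
qed

lemma mass_Cauchy_Schwarz:
  assumes K: "K \<in> T" and v: "v \<in> Vh \<Omega> T" and w: "w \<in> Vh \<Omega> T"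
  shows "\<bar>L2_inner K v w\<bar> \<le> sqrt (L2_inner K v v) * sqrt (L2_inner K w w)"
proof (rule quadratic_nonneg_Cauchy_Schwarz)
  fix t :: real
  let ?u = "\<lambda>x. 1 * v x + t * w x"
  have u: "?u \<in> Vh \<Omega> T" using v w by (rule Vh_lincomb)
  have "L2_inner K ?u ?u = 1 * L2_inner K v ?u + t * L2_inner K w ?u"
    by (rule mass_lincomb[OF K v w u])
  also have "L2_inner K v ?u = 1 * L2_inner K v v + t * L2_inner K w v"
    by (subst mass_commute) (rule mass_lincomb[OF K v w v])
  also have "L2_inner K w ?u = 1 * L2_inner K v w + t * L2_inner K w w"
    by (subst mass_commute) (rule mass_lincomb[OF K v w w])
  also have "L2_inner K w v = L2_inner K v w"
    by (rule mass_commute)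
  finally have "L2_inner K ?u ?u = L2_inner K v v + 2 * t * L2_inner K v w + t\<^sup>2 * L2_inner K w w"
    by (simp add: algebra_simps power2_eq_square)
  then show "0 \<le> L2_inner K v v + 2 * t * L2_inner K v w + t\<^sup>2 * L2_inner K w w"
    using mass_nonneg[of K ?u] by simp
qed (rule mass_nonneg)

lemma energy_Cauchy_Schwarz:
  assumes K: "K \<in> T" and v: "v \<in> Vh \<Omega> T" and w: "w \<in> Vh \<Omega> T"
  shows "\<bar>energy_form A K v w\<bar> \<le> sqrt (energy_form A K v v) * sqrt (energy_form A K w w)"
proof (rule quadratic_nonneg_Cauchy_Schwarz)
  fix t :: real
  let ?u = "\<lambda>x. 1 * v x + t * w x"
  have u: "?u \<in> Vh \<Omega> T" using v w by (rule Vh_lincomb)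
  have "energy_form A K ?u ?u = 1 * energy_form A K v ?u + t * energy_form A K w ?u"
    by (rule energy_lincomb[OF K v w u])
  also have "energy_form A K v ?u = 1 * energy_form A K v v + t * energy_form A K w v"
    by (subst energy_commute) (rule energy_lincomb[OF K v w v])
  also have "energy_form A K w ?u = 1 * energy_form A K v w + t * energy_form A K w w"
    by (subst energy_commute) (rule energy_lincomb[OF K v w w])
  also have "energy_form A K w v = energy_form A K v w"
    by (rule energy_commute)
  finally have "energy_form A K ?u ?u = energy_form A K v v + 2 * t * energy_form A K v w + t\<^sup>2 * energy_form A K w w"
    by (simp add: algebra_simps power2_eq_square)
  then show "0 \<le> energy_form A K v v + 2 * t * energy_form A K v w + t\<^sup>2 * energy_form A K w w"
    using energy_nonneg[OF K, of ?u] by simp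
qed (rule energy_nonneg[OF K])

definition elem_norm :: "(real^'d) set \<Rightarrow> (real^'d \<Rightarrow> real) \<Rightarrow> real" where
  "elem_norm K v = sqrt (L2_inner K v v + \<tau>\<^sup>2 / 4 * energy_form A K v v)"

lemma elem_norm_sq:
  "K \<in> T \<Longrightarrow> (elem_norm K v)\<^sup>2 = L2_inner K v v + \<tau>\<^sup>2 / 4 * energy_form A K v v"
  using mass_nonneg[of K v] energy_nonneg[of K v] by (simp add: elem_norm_def)

lemma elem_norm_nonneg: "K \<in> T \<Longrightarrow> 0 \<le> elem_norm K v"
  using mass_nonneg[of K v] energy_nonneg[of K v] by (simp add: elem_norm_def)

text \<open>This bounds every combination of the two forms with coefficients of modulus at most 1, hence both
  the inner product itself and the form that arises from the explicit part of the scheme.\<close>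

lemma elem_Cauchy_Schwarz:
  assumes K: "K \<in> T" and v: "v \<in> Vh \<Omega> T" and w: "w \<in> Vh \<Omega> T"
  shows "\<bar>L2_inner K v w\<bar> + \<tau>\<^sup>2 / 4 * \<bar>energy_form A K v w\<bar> \<le> elem_norm K v * elem_norm K w"
proof -
  have "\<tau>\<^sup>2 / 4 * \<bar>energy_form A K v w\<bar>
      \<le> \<tau>\<^sup>2 / 4 * (sqrt (energy_form A K v v) * sqrt (energy_form A K w w))"
    using energy_Cauchy_Schwarz[OF K v w] by (intro mult_left_mono) auto
  also have "\<dots> = sqrt (\<tau>\<^sup>2 / 4 * energy_form A K v v) * sqrt (\<tau>\<^sup>2 / 4 * energy_form A K w w)"
    using positive by (simp add: real_sqrt_mult real_sqrt_divide power2_eq_square)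
  finally have "\<bar>L2_inner K v w\<bar> + \<tau>\<^sup>2 / 4 * \<bar>energy_form A K v w\<bar>
      \<le> sqrt (L2_inner K v v) * sqrt (L2_inner K w w)
        + sqrt (\<tau>\<^sup>2 / 4 * energy_form A K v v) * sqrt (\<tau>\<^sup>2 / 4 * energy_form A K w w)"
    using mass_Cauchy_Schwarz[OF K v w] by simp
  also have "\<dots> \<le> elem_norm K v * elem_norm K w"
    unfolding elem_norm_def using mass_nonneg energy_nonneg[OF K] by (intro sum_two_products_le_sqrt) auto
  finally show ?thesis .
qed

end


section \<open>Stability of nodal truncation\<close>

text \<open>With \<open>n\<close> the dimension, the sum of the nodal values exceeds the largest one by the factor \<open>2 ^ n\<close> at
  most, and half of the largest one survives on a copy of the element scaled by the reciprocal of
  \<open>2 * 2 ^ n * n\<close>. So the constant is the square of \<open>2 * 2 ^ n\<close> times the ratio of the measures.\<close>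

definition mass_const :: "nat \<Rightarrow> real" where
  "mass_const n = 4 * 4 ^ n * (2 * 2 ^ n * real n) ^ n"

definition trunc_const :: "nat \<Rightarrow> real \<Rightarrow> real \<Rightarrow> real" where
  "trunc_const n \<sigma> \<beta> = sqrt (mass_const n * (1 + \<beta> * (real n)\<^sup>2 * \<sigma> ^ 4))"

lemma corner_scale_ge_1:
  assumes "0 < n"
  shows "1 \<le> 2 * 2 ^ n * real n"
proof -
  have "(1::real) \<le> 2 ^ n" by simp
  then have "(1::real) \<le> 2 * 2 ^ n" by linarith
  then show ?thesis
    using mult_mono[of 1 "2 * 2 ^ n" 1 "real n"] assms by simp
qed

lemma mass_const_ge_1: "0 < n \<Longrightarrow> 1 \<le> mass_const n"
proof -
  assume "0 < n"
  then have "1 \<le> 2 * 2 ^ n * real n"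
    by (rule corner_scale_ge_1)
  then have "1 \<le> (2 * 2 ^ n * real n) ^ n" by (rule one_le_power)
  moreover have "(1::real) \<le> 4 * 4 ^ n" using one_le_power[of "4::real" "Suc n"] by simp
  ultimately show ?thesis
    using mult_mono[of 1 "4 * 4 ^ n" 1 "(2 * 2 ^ n * real n) ^ n"] by (simp add: mass_const_def)
qed

lemma trunc_const_ge_1: "0 < n \<Longrightarrow> 0 < \<beta> \<Longrightarrow> 1 \<le> trunc_const n \<sigma> \<beta>"
  using mult_mono[of 1 "mass_const n" 1 "1 + \<beta> * (real n)\<^sup>2 * \<sigma> ^ 4"] mass_const_ge_1[of n]
  by (simp add: trunc_const_def)

context chart
begin

lemma pull_affine: "pull (s *\<^sub>R x + (1 - s) *\<^sub>R z) = s *\<^sub>R pull x + (1 - s) *\<^sub>R pull z"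
proof -
  have "s *\<^sub>R x + (1 - s) *\<^sub>R z - b = s *\<^sub>R (x - b) + (1 - s) *\<^sub>R (z - b)"
    by (simp add: algebra_simps)
  then show ?thesis
    by (simp add: pull_def matrix_vector_right_distrib matrix_vector_mult_scaleR)
qed

lemma corner_copy:
  fixes J :: "'d set"
  assumes "x \<in> K" "0 < s" "s \<le> 1"
  defines "y \<equiv> s *\<^sub>R x + (1 - s) *\<^sub>R affine_ref b M (corner J)"
  shows "y \<in> K" "\<bar>(N *v (y - affine_ref b M (corner J))) $ i\<bar> \<le> s"
proof -
  have p: "0 < pull x $ i" "pull x $ i < 1" for i
    using assms(1) unfolding mem_iff mem_box_cart by auto
  have y: "pull y = s *\<^sub>R pull x + (1 - s) *\<^sub>R corner J"
    unfolding y_def pull_affine by simp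
  have "0 < pull y $ i" "pull y $ i < 1" for i
  proof -
    have "0 < s * pull x $ i" "s * pull x $ i < s" using p assms by simp_all
    then show "0 < pull y $ i" "pull y $ i < 1"
      using assms(3) by (simp_all add: y corner_def)
  qed
  then show "y \<in> K" by (simp add: mem_iff mem_box_cart)
  have "(N *v (y - affine_ref b M (corner J))) $ i = (pull y - pull (affine_ref b M (corner J))) $ i"
    by (simp only: pull_diff)
  also have "\<dots> = s * (pull x $ i - corner J $ i)"
    by (simp add: y algebra_simps)
  finally have "(N *v (y - affine_ref b M (corner J))) $ i = s * (pull x $ i - corner J $ i)" .
  moreover have "\<bar>pull x $ i - corner J $ i\<bar> \<le> 1"
    using p[of i] by (simp add: corner_def abs_le_iff)
  ultimately show "\<bar>(N *v (y - affine_ref b M (corner J))) $ i\<bar> \<le> s"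
    using assms(2) by (simp add: abs_mult mult_left_le)
qed

end

context wave_mesh
begin

text \<open>Let \<open>z\<close> be a vertex where \<open>v\<close> has its largest nodal value. By the Lipschitz bound, \<open>v\<close> keeps at
  least half of this value on a small copy of the element that is shrunk towards \<open>z\<close>, and the measure
  of this copy is a fixed fraction of the measure of the element.\<close>

lemma vertex_sum_le_mass:
  assumes K: "K \<in> T" and ch: "chart K b M N" and v: "v \<in> Vh \<Omega> T"
  shows "(vertex_sum b M v)\<^sup>2 * measure lebesgue K \<le> mass_const CARD('d) * L2_inner K v v"
proof -
  interpret chart K b M N by fact
  define n where "n = CARD('d)"
  have n: "0 < n" by (simp add: n_def)
  define s where "s = 1 / (2 * 2 ^ n * real n)"
  have den: "1 \<le> 2 * 2 ^ n * real n"
    by (rule corner_scale_ge_1[OF n])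
  have s: "0 < s" "s \<le> 1" and ns: "real n * s = 1 / (2 * 2 ^ n)"
    using n den by (simp_all add: s_def)
  define c where "c I = \<bar>v (affine_ref b M (corner I))\<bar>" for I
  define m where "m = vertex_sum b M v"
  have m: "m = (\<Sum>I\<in>UNIV. c I)" by (simp add: m_def vertex_sum_def c_def)
  have m0: "0 \<le> m" by (simp add: m_def vertex_sum_nonneg)
  have "Max (range c) \<in> range c" by (intro Max_in) auto
  then obtain J where J: "Max (range c) = c J" by (rule rangeE)
  have "m \<le> of_nat (card (UNIV :: 'd set set)) * c J"
    unfolding m J[symmetric] by (intro sum_bounded_above Max_ge) auto
  also have "card (UNIV :: 'd set set) = 2 ^ n"
    using card_Pow[of "UNIV :: 'd set"] by (simp add: n_def)
  finally have mJ: "m \<le> 2 ^ n * c J" by simp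
  define z where "z = affine_ref b M (corner J)"
  define S where "S = (\<lambda>x. s *\<^sub>R x + (1 - s) *\<^sub>R z) ` K"
  have SK: "S \<subseteq> K"
    using corner_copy(1)[OF _ s] by (auto simp: S_def z_def)
  have low: "(m / (2 * 2 ^ n))\<^sup>2 \<le> v y * v y" if yS: "y \<in> S" for y
  proof -
    obtain x where x: "x \<in> K" "y = s *\<^sub>R x + (1 - s) *\<^sub>R z"
      using yS by (auto simp: S_def)
    have "\<bar>v y - v z\<bar> \<le> m * (\<Sum>i\<in>UNIV. \<bar>(N *v (y - z)) $ i\<bar>)"
      unfolding m_def using yS SK closure_subset[of K] corner_in_closure[of J]
      by (intro Vh_Lipschitz_vertex_sum[OF K ch v]) (auto simp: z_def)
    also have "\<dots> \<le> m * (\<Sum>i\<in>(UNIV::'d set). s)"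
      using corner_copy(2)[OF x(1) s, of J] m0 by (intro mult_left_mono sum_mono) (simp_all add: x z_def)
    also have "\<dots> = m / (2 * 2 ^ n)"
      using ns by (simp add: n_def)
    finally have "\<bar>v y - v z\<bar> \<le> m / (2 * 2 ^ n)" .
    moreover have "2 * (m / (2 * 2 ^ n)) \<le> \<bar>v z\<bar>"
      using mJ by (simp add: c_def z_def field_simps)
    ultimately have "m / (2 * 2 ^ n) \<le> \<bar>v y\<bar>" by linarith
    then show ?thesis
      using m0 by (simp add: abs_le_square_iff[symmetric] flip: power2_eq_square)
  qed
  have "open S"
    using open_affinity[OF element_open[OF K], of s "(1 - s) *\<^sub>R z"] s
    by (simp add: S_def add.commute)
  then have S_meas: "S \<in> sets (lebesgue_on K)"
    using SK element_lebesgue[OF K] by (simp add: sets_restrict_space_iff)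
  have "(m / (2 * 2 ^ n))\<^sup>2 * measure lebesgue S \<le> L2_inner K v v"
  proof -
    interpret finite_measure "lebesgue_on K"
      by (rule finite_measure_lebesgue_on[OF element_lmeasurable[OF K]])
    have "(LINT x|lebesgue_on K. (m / (2 * 2 ^ n))\<^sup>2 * indicator S x) \<le> L2_inner K v v"
      unfolding L2_inner_def
    proof (rule integral_mono)
      show "integrable (lebesgue_on K) (\<lambda>x. (m / (2 * 2 ^ n))\<^sup>2 * indicator S x :: real)"
        by (intro integrable_mult_right integrable_real_indicator S_meas) (simp add: less_top[symmetric])
      show "integrable (lebesgue_on K) (\<lambda>x. v x * v x)"
        by (rule integrable_mass[OF K v v])
      show "(m / (2 * 2 ^ n))\<^sup>2 * indicator S x \<le> v x * v x" if "x \<in> space (lebesgue_on K)" for x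
        using low[of x] by (simp split: split_indicator)
    qed
    moreover have "(LINT x|lebesgue_on K. indicator S x :: real) = measure lebesgue S"
      using SK element_lebesgue[OF K] by (simp add: Int_absorb2 measure_restrict_space)
    ultimately show ?thesis by simp
  qed
  also have "measure lebesgue S = s ^ n * measure lebesgue K"
    unfolding S_def using measure_lebesgue_affine[of s "(1 - s) *\<^sub>R z" K] s by (simp add: n_def)
  finally have low_bound: "(m / (2 * 2 ^ n))\<^sup>2 * (s ^ n * measure lebesgue K) \<le> L2_inner K v v" .
  have "mass_const n * ((m / (2 * 2 ^ n))\<^sup>2 * (s ^ n * measure lebesgue K)) = m\<^sup>2 * measure lebesgue K"
  proof -
    have "(2 * 2 ^ n * real n) ^ n * s ^ n = 1"
      using den by (simp add: s_def flip: power_mult_distrib)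
    moreover have "4 * 4 ^ n * (m / (2 * 2 ^ n))\<^sup>2 = m\<^sup>2"
    proof -
      have "(2 * 2 ^ n)\<^sup>2 = (4 * 4 ^ n :: real)"
      proof -
        have "(2 * 2 ^ n :: real)\<^sup>2 = 2\<^sup>2 * (2\<^sup>2) ^ n"
          by (simp only: power_mult_distrib power_mult[symmetric] mult.commute[of n])
        then show ?thesis by simp
      qed
      then show ?thesis by (simp add: power_divide)
    qed
    moreover have "mass_const n * ((m / (2 * 2 ^ n))\<^sup>2 * (s ^ n * measure lebesgue K))
      = (4 * 4 ^ n * (m / (2 * 2 ^ n))\<^sup>2) * ((2 * 2 ^ n * real n) ^ n * s ^ n) * measure lebesgue K"
      by (simp only: mass_const_def mult_ac)
    ultimately show ?thesis by simp
  qed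
  moreover have "mass_const n * ((m / (2 * 2 ^ n))\<^sup>2 * (s ^ n * measure lebesgue K)) \<le> mass_const n * L2_inner K v v"
    using low_bound mass_const_ge_1[OF n] by (intro mult_left_mono) auto
  ultimately have "m\<^sup>2 * measure lebesgue K \<le> mass_const n * L2_inner K v v"
    by (simp only:)
  then show ?thesis
    by (simp only: m_def n_def)
qed

lemma mass_le_vertex_sum:
  assumes K: "K \<in> T" and ch: "chart K b M N" and v: "v \<in> Vh \<Omega> T"
  shows "L2_inner K v v \<le> (vertex_sum b M v)\<^sup>2 * measure lebesgue K"
proof -
  interpret finite_measure "lebesgue_on K"
    by (rule finite_measure_lebesgue_on[OF element_lmeasurable[OF K]])
  have "L2_inner K v v \<le> (LINT x|lebesgue_on K. (vertex_sum b M v)\<^sup>2)"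
    unfolding L2_inner_def
  proof (rule integral_mono[OF integrable_mass[OF K v v]])
    fix x assume "x \<in> space (lebesgue_on K)"
    then have "\<bar>v x\<bar> \<le> vertex_sum b M v"
      using Vh_le_vertex_sum[OF K ch v, of x] closure_subset[of K] by auto
    then show "v x * v x \<le> (vertex_sum b M v)\<^sup>2"
      using vertex_sum_nonneg[of b M v] by (simp add: abs_le_square_iff[symmetric] flip: power2_eq_square)
  qed simp
  then show ?thesis
    using element_lebesgue[OF K] by (simp add: measure_restrict_space mult_ac)
qed

lemma energy_le_vertex_sum:
  assumes K: "K \<in> T" and ch: "chart K b M N" and v: "v \<in> Vh \<Omega> T"
  shows "energy_form A K v v \<le> \<beta> * (vertex_sum b M v * (2 * real CARD('d) * \<sigma>\<^sup>2 / h))\<^sup>2 * measure lebesgue K"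
proof -
  interpret finite_measure "lebesgue_on K"
    by (rule finite_measure_lebesgue_on[OF element_lmeasurable[OF K]])
  let ?L = "vertex_sum b M v * (2 * real CARD('d) * \<sigma>\<^sup>2 / h)"
  have "AE x in lebesgue_on K. x \<in> K"
    by (rule AE_I2) simp
  with element_A_bounds[OF K] have "AE x in lebesgue_on K. (A x *\<^sub>R grad v x) \<bullet> grad v x \<le> \<beta> * ?L\<^sup>2"
  proof eventually_elim
    case (elim x)
    have "(norm (grad v x))\<^sup>2 \<le> ?L\<^sup>2"
      using norm_grad_vertex_sum[OF K ch v positive(3) elim(2)] by (intro power_mono) auto
    then show ?case
      using elim positive by (simp add: dot_square_norm mult_mono)
  qed
  then have "energy_form A K v v \<le> (LINT x|lebesgue_on K. \<beta> * ?L\<^sup>2)"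
    unfolding energy_form_def by (intro integral_mono_AE integrable_energy[OF K v v]) simp
  then show ?thesis
    using element_lebesgue[OF K] by (simp add: measure_restrict_space mult_ac)
qed

text \<open>The energy of \<open>v\<close> is traded for the mass of \<open>u\<close>. The inverse estimate for the gradient costs the factor
  \<open>\<tau>/h\<close>; the factor \<open>h/\<tau>\<close> only serves to keep the sum away from zero, so that it also covers the mass.\<close>

lemma elem_norm_le_of_vertices:
  assumes K: "K \<in> T" and ch: "chart K b M N" and u: "u \<in> Vh \<Omega> T" and v: "v \<in> Vh \<Omega> T"
    and le: "\<And>I. \<bar>v (affine_ref b M (corner I))\<bar> \<le> \<bar>u (affine_ref b M (corner I))\<bar>"
  shows "elem_norm K v \<le> trunc_const CARD('d) \<sigma> \<beta> * (\<tau> / h + h / \<tau>) * elem_norm K u"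
proof -
  define n where "n = real CARD('d)"
  define mv where "mv = vertex_sum b M v"
  define mu where "mu = vertex_sum b M u"
  define B where "B = \<beta> * n\<^sup>2 * \<sigma> ^ 4"
  define r where "r = \<tau> / h + h / \<tau>"
  define C where "C = mass_const CARD('d)"
  have h: "0 < h" using mesh_size_pos[OF K] by simp
  have B: "0 \<le> B" using positive by (simp add: B_def)
  have C: "1 \<le> C" by (simp add: C_def mass_const_ge_1)
  have mvu: "mv\<^sup>2 \<le> mu\<^sup>2"
    using sum_mono[of UNIV, OF le] vertex_sum_nonneg[of b M v]
    by (intro power_mono) (simp_all add: mv_def mu_def vertex_sum_def)
  have r2: "1 + B * (\<tau> / h)\<^sup>2 \<le> (1 + B) * r\<^sup>2"
  proof -
    have "r\<^sup>2 = (\<tau> / h)\<^sup>2 + 2 + (h / \<tau>)\<^sup>2"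
      using h positive by (simp add: r_def power2_eq_square field_simps)
    then have "1 \<le> r\<^sup>2" "(\<tau> / h)\<^sup>2 \<le> r\<^sup>2"
      using zero_le_power2[of "\<tau> / h"] zero_le_power2[of "h / \<tau>"] by linarith+
    then show ?thesis
      using mult_left_mono[of "(\<tau> / h)\<^sup>2" "r\<^sup>2" B] B by (simp add: algebra_simps)
  qed
  have "(elem_norm K v)\<^sup>2 \<le> mv\<^sup>2 * measure lebesgue K
      + \<tau>\<^sup>2 / 4 * (\<beta> * (mv * (2 * n * \<sigma>\<^sup>2 / h))\<^sup>2 * measure lebesgue K)"
    unfolding elem_norm_sq[OF K] mv_def n_def
    by (intro add_mono mult_left_mono mass_le_vertex_sum[OF K ch v] energy_le_vertex_sum[OF K ch v]) simp
  also have "\<dots> = (1 + B * (\<tau> / h)\<^sup>2) * (mv\<^sup>2 * measure lebesgue K)"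
    by (simp add: B_def power_mult_distrib power_divide algebra_simps flip: power_mult)
  also have "\<dots> \<le> (1 + B * (\<tau> / h)\<^sup>2) * (mu\<^sup>2 * measure lebesgue K)"
    using B mvu by (intro mult_left_mono mult_right_mono) auto
  also have "\<dots> \<le> ((1 + B) * r\<^sup>2) * (C * L2_inner K u u)"
    unfolding mu_def C_def using B by (intro mult_mono[OF r2 vertex_sum_le_mass[OF K ch u]]) auto
  also have "\<dots> \<le> ((1 + B) * r\<^sup>2) * (C * (elem_norm K u)\<^sup>2)"
    unfolding elem_norm_sq[OF K] using B C energy_nonneg[OF K] by (intro mult_left_mono) auto
  also have "\<dots> = (trunc_const CARD('d) \<sigma> \<beta> * r * elem_norm K u)\<^sup>2"
  proof -
    have "(trunc_const CARD('d) \<sigma> \<beta>)\<^sup>2 = C * (1 + B)"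
      using B C by (simp add: trunc_const_def B_def C_def n_def)
    then show ?thesis by (simp add: power_mult_distrib mult_ac)
  qed
  finally show ?thesis
    unfolding r_def[symmetric]
    by (rule power2_le_imp_le)
      (use h positive elem_norm_nonneg[OF K] trunc_const_ge_1[of "CARD('d)" \<beta> \<sigma>] in \<open>simp add: r_def\<close>)
qed

end


section \<open>Assembling the element contributions\<close>

context wave_mesh
begin

text \<open>The region may contain parts of the element boundaries, but these are null sets because the elements
  are convex.\<close>

lemma integral_region:
  fixes f :: "real^'d \<Rightarrow> real"
  assumes R: "R \<subseteq> T" and X: "\<Union>R \<subseteq> X" "X \<subseteq> (\<Union>K\<in>R. closure K)" "X \<in> sets lebesgue"
    and f: "\<And>K. K \<in> R \<Longrightarrow> integrable (lebesgue_on K) f"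
  shows "(LINT x|lebesgue_on X. f x) = (\<Sum>K\<in>R. LINT x|lebesgue_on K. f x)"
proof -
  have fin: "finite R" using R finite_mesh finite_subset by blast
  have meas: "K \<in> sets lebesgue" if "K \<in> R" for K
    using that R element_lebesgue by blast
  have set_int: "set_integrable lebesgue K f" if "K \<in> R" for K
    using f[OF that] meas[OF that] by (simp add: set_integrable_def integrable_restrict_space)
  have to_set: "(LINT x|lebesgue_on Y. f x) = (LINT x:Y|lebesgue. f x)" if "Y \<in> sets lebesgue" for Y
    using that by (simp add: set_lebesgue_integral_def integral_restrict_space)
  have UR: "\<Union>R \<in> sets lebesgue"
    using meas fin by (intro sets.finite_Union) auto
  have int_UR: "f absolutely_integrable_on (\<Union>K\<in>R. K)"
    using fin meas set_int by (intro set_integrable_UN) auto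
  have neg: "negligible (X - \<Union>R)"
  proof (rule negligible_subset)
    show "negligible (\<Union>K\<in>R. frontier K)"
      using fin R element_convex by (intro negligible_Union) (auto intro: negligible_convex_frontier)
    show "X - \<Union>R \<subseteq> (\<Union>K\<in>R. frontier K)"
    proof
      fix x assume x: "x \<in> X - \<Union>R"
      then obtain K where K: "K \<in> R" "x \<in> closure K" using X(2) by blast
      moreover have "x \<notin> interior K"
        using x K interior_subset[of K] by blast
      ultimately show "x \<in> (\<Union>K\<in>R. frontier K)"
        by (auto simp: frontier_def)
    qed
  qed
  have neg2: "negligible {x \<in> \<Union>R - X. f x \<noteq> 0}" "negligible {x \<in> X - \<Union>R. f x \<noteq> 0}"
    using X(1) by (auto intro: negligible_subset[OF neg] simp: negligible_subset[OF negligible_empty] Diff_eq_empty_iff[THEN iffD2])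
  have int_X: "f absolutely_integrable_on X"
    using int_UR neg2 by (intro absolutely_integrable_spike_set[of "\<Union>R" f X]) auto
  have "(LINT x:X|lebesgue. f x) = integral X f"
    using int_X by (rule set_lebesgue_integral_eq_integral)
  also have "\<dots> = integral (\<Union>R) f"
    using neg2 by (rule integral_spike_set[rotated])
  also have "\<dots> = (LINT x:(\<Union>K\<in>R. K)|lebesgue. f x)"
    using int_UR by (simp add: set_lebesgue_integral_eq_integral)
  also have "\<dots> = (\<Sum>K\<in>R. LINT x:K|lebesgue. f x)"
  proof (rule set_integral_finite_UN_AE[OF fin])
    show "AE x in lebesgue. x \<in> K \<and> x \<in> K' \<longrightarrow> K = K'" if "K \<in> R" "K' \<in> R" for K K'
      using element_disjoint_closure[of K K'] that R closure_subset[of K'] by (intro AE_I2) blast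
  qed (use meas set_int in auto)
  finally show ?thesis
    using X(3) meas by (simp add: to_set)
qed

lemma domain_region: "\<Union>T \<subseteq> \<Omega>" "\<Omega> \<subseteq> (\<Union>K\<in>T. closure K)" "\<Omega> \<in> sets lebesgue"
  using element_subset_domain closure_subset[of \<Omega>] open_domain by (auto simp: closure_elements)

lemma mass_region:
  assumes "R \<subseteq> T" "\<Union>R \<subseteq> X" "X \<subseteq> (\<Union>K\<in>R. closure K)" "X \<in> sets lebesgue"
    and "v \<in> Vh \<Omega> T" "w \<in> Vh \<Omega> T"
  shows "L2_inner X v w = (\<Sum>K\<in>R. L2_inner K v w)"
  unfolding L2_inner_def using assms(1) integrable_mass[OF _ assms(5,6)]
  by (intro integral_region[OF assms(1-4)]) auto

lemma energy_region:
  assumes "R \<subseteq> T" "\<Union>R \<subseteq> X" "X \<subseteq> (\<Union>K\<in>R. closure K)" "X \<in> sets lebesgue"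
    and "v \<in> Vh \<Omega> T" "w \<in> Vh \<Omega> T"
  shows "energy_form A X v w = (\<Sum>K\<in>R. energy_form A K v w)"
  unfolding energy_form_def using assms(1) integrable_energy[OF _ assms(5,6)]
  by (intro integral_region[OF assms(1-4)]) auto

lemmas mass_domain = mass_region[OF order_refl domain_region]
lemmas energy_domain = energy_region[OF order_refl domain_region]

lemma element_forms_zero:
  assumes "K \<in> T" "\<And>x. x \<in> K \<Longrightarrow> w x = 0"
  shows "L2_inner K v w = 0" "L2_inner K w v = 0" "energy_form A K v w = 0" "energy_form A K w v = 0"
proof -
  have "(LINT x|lebesgue_on K. v x * w x) = (LINT x|lebesgue_on K. 0)"
    by (rule Bochner_Integration.integral_cong) (simp_all add: assms(2))
  then show "L2_inner K v w = 0" by (simp add: L2_inner_def)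
  then show "L2_inner K w v = 0" by (simp add: mass_commute[of K w])
  have "(LINT x|lebesgue_on K. (A x *\<^sub>R grad v x) \<bullet> grad w x) = (LINT x|lebesgue_on K. 0)"
    by (rule Bochner_Integration.integral_cong)
      (simp_all add: grad_zero_open[OF element_open[OF assms(1)] _ assms(2)])
  then show "energy_form A K v w = 0" by (simp add: energy_form_def)
  then show "energy_form A K w v = 0" by (simp add: energy_commute[of K w])
qed

lemma element_forms_cong:
  assumes "K \<in> T" "\<And>x. x \<in> K \<Longrightarrow> w x = w' x"
  shows "L2_inner K v w = L2_inner K v w'" "energy_form A K v w = energy_form A K v w'"
proof -
  show "L2_inner K v w = L2_inner K v w'"
    unfolding L2_inner_def by (rule Bochner_Integration.integral_cong) (simp_all add: assms(2))
  show "energy_form A K v w = energy_form A K v w'"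
    unfolding energy_form_def
    by (rule Bochner_Integration.integral_cong)
      (simp_all add: grad_cong_open[OF element_open[OF assms(1)] _ assms(2)])
qed

lemma forms_region_eq_domain:
  assumes R: "R \<subseteq> T" and X: "\<Union>R \<subseteq> X" "X \<subseteq> (\<Union>K\<in>R. closure K)" "X \<in> sets lebesgue"
    and v: "v \<in> Vh \<Omega> T" and w: "w \<in> Vh \<Omega> T" and zero: "\<And>K x. K \<in> T - R \<Longrightarrow> x \<in> K \<Longrightarrow> w x = 0"
  shows "L2_inner X v w = L2_inner \<Omega> v w" "energy_form A X v w = energy_form A \<Omega> v w"
  unfolding mass_region[OF R X v w] energy_region[OF R X v w] mass_domain[OF v w] energy_domain[OF v w]
  using element_forms_zero[of _ w v] zero R finite_mesh by (auto intro!: sum.mono_neutral_left)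

lemma mass_domain_lincomb:
  assumes "u \<in> Vh \<Omega> T" "v \<in> Vh \<Omega> T" "w \<in> Vh \<Omega> T"
  shows "L2_inner \<Omega> (\<lambda>x. a * u x + b * v x) w = a * L2_inner \<Omega> u w + b * L2_inner \<Omega> v w"
  using assms
  by (simp add: mass_domain Vh_lincomb mass_lincomb sum.distrib sum_distrib_left)

lemma energy_domain_lincomb:
  assumes "u \<in> Vh \<Omega> T" "v \<in> Vh \<Omega> T" "w \<in> Vh \<Omega> T"
  shows "energy_form A \<Omega> (\<lambda>x. a * u x + b * v x) w = a * energy_form A \<Omega> u w + b * energy_form A \<Omega> v w"
  using assms
  by (simp add: energy_domain Vh_lincomb energy_lincomb sum.distrib sum_distrib_left)

lemma lincomb3:
  assumes p: "p \<in> Vh \<Omega> T" and q: "q \<in> Vh \<Omega> T" and r: "r \<in> Vh \<Omega> T" and w: "w \<in> Vh \<Omega> T"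
  shows "L2_inner \<Omega> (\<lambda>x. a * p x + b * q x + c * r x) w
      = a * L2_inner \<Omega> p w + b * L2_inner \<Omega> q w + c * L2_inner \<Omega> r w"
    and "energy_form A \<Omega> (\<lambda>x. a * p x + b * q x + c * r x) w
      = a * energy_form A \<Omega> p w + b * energy_form A \<Omega> q w + c * energy_form A \<Omega> r w"
  using mass_domain_lincomb[OF Vh_lincomb[OF p q] r w, of 1 a b c] mass_domain_lincomb[OF p q w, of a b]
    energy_domain_lincomb[OF Vh_lincomb[OF p q] r w, of 1 a b c] energy_domain_lincomb[OF p q w, of a b]
  by simp_all

definition tau_inner :: "(real^'d \<Rightarrow> real) \<Rightarrow> (real^'d \<Rightarrow> real) \<Rightarrow> real" where
  "tau_inner v w = L2_inner \<Omega> v w + \<tau>\<^sup>2 / 4 * energy_form A \<Omega> v w"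

text \<open>The combination of old values that remains on the right-hand side of the scheme. The mass and the energy
  enter with coefficients of equal modulus, so it is bounded by twice the product of the norms.\<close>

definition explicit_form :: "(real^'d \<Rightarrow> real) \<Rightarrow> (real^'d \<Rightarrow> real) \<Rightarrow> real" where
  "explicit_form v w = 2 * L2_inner \<Omega> v w - 2 * (\<tau>\<^sup>2 / 4 * energy_form A \<Omega> v w)"

lemma tau_inner_lincomb:
  assumes "u \<in> Vh \<Omega> T" "v \<in> Vh \<Omega> T" "w \<in> Vh \<Omega> T"
  shows "tau_inner (\<lambda>x. a * u x + b * v x) w = a * tau_inner u w + b * tau_inner v w"
  using assms by (simp add: tau_inner_def mass_domain_lincomb energy_domain_lincomb algebra_simps)

lemma tau_inner_commute: "tau_inner v w = tau_inner w v"
  by (simp add: tau_inner_def mass_commute[of _ v] energy_commute[of _ v])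

lemma tau_norm_sq:
  assumes "v \<in> Vh \<Omega> T"
  shows "(tau_norm A \<Omega> \<tau> v)\<^sup>2 = tau_inner v v"
    and "(tau_norm A \<Omega> \<tau> v)\<^sup>2 = (\<Sum>K\<in>T. (elem_norm K v)\<^sup>2)"
    and "0 \<le> tau_norm A \<Omega> \<tau> v"
proof -
  have sum: "tau_inner v v = (\<Sum>K\<in>T. (elem_norm K v)\<^sup>2)"
    using assms by (simp add: tau_inner_def mass_domain energy_domain elem_norm_sq sum.distrib sum_distrib_left)
  then have "0 \<le> tau_inner v v" by (simp add: sum_nonneg)
  moreover have "tau_norm A \<Omega> \<tau> v = sqrt (tau_inner v v)"
    using mass_nonneg[of \<Omega> v] by (simp add: tau_norm_def tau_inner_def L2_norm_def)
  ultimately show "(tau_norm A \<Omega> \<tau> v)\<^sup>2 = tau_inner v v" "0 \<le> tau_norm A \<Omega> \<tau> v"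
    "(tau_norm A \<Omega> \<tau> v)\<^sup>2 = (\<Sum>K\<in>T. (elem_norm K v)\<^sup>2)"
    using sum by simp_all
qed

lemma forms_Cauchy_Schwarz:
  assumes v: "v \<in> Vh \<Omega> T" and w: "w \<in> Vh \<Omega> T"
  shows "\<bar>tau_inner v w\<bar> \<le> tau_norm A \<Omega> \<tau> v * tau_norm A \<Omega> \<tau> w"
    and "\<bar>explicit_form v w\<bar> \<le> 2 * (tau_norm A \<Omega> \<tau> v * tau_norm A \<Omega> \<tau> w)"
proof -
  let ?L = "L2_inner \<Omega> v w" and ?E = "energy_form A \<Omega> v w"
  have "\<bar>?L\<bar> \<le> (\<Sum>K\<in>T. \<bar>L2_inner K v w\<bar>)" "\<bar>?E\<bar> \<le> (\<Sum>K\<in>T. \<bar>energy_form A K v w\<bar>)"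
    unfolding mass_domain[OF v w] energy_domain[OF v w] by (rule sum_abs)+
  then have "\<bar>?L\<bar> + \<tau>\<^sup>2 / 4 * \<bar>?E\<bar>
      \<le> (\<Sum>K\<in>T. \<bar>L2_inner K v w\<bar>) + \<tau>\<^sup>2 / 4 * (\<Sum>K\<in>T. \<bar>energy_form A K v w\<bar>)"
    by (intro add_mono mult_left_mono) auto
  also have "\<dots> = (\<Sum>K\<in>T. \<bar>L2_inner K v w\<bar> + \<tau>\<^sup>2 / 4 * \<bar>energy_form A K v w\<bar>)"
    by (simp add: sum.distrib sum_distrib_left)
  also have "\<dots> \<le> (\<Sum>K\<in>T. \<bar>elem_norm K v\<bar> * \<bar>elem_norm K w\<bar>)"
    using elem_Cauchy_Schwarz[OF _ v w] elem_norm_nonneg by (intro sum_mono) simp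
  also have "\<dots> \<le> L2_set (\<lambda>K. elem_norm K v) T * L2_set (\<lambda>K. elem_norm K w) T"
    by (rule L2_set_mult_ineq)
  also have "L2_set (\<lambda>K. elem_norm K v) T = tau_norm A \<Omega> \<tau> v"
    using tau_norm_sq[OF v] by (simp add: L2_set_def real_sqrt_unique)
  also have "L2_set (\<lambda>K. elem_norm K w) T = tau_norm A \<Omega> \<tau> w"
    using tau_norm_sq[OF w] by (simp add: L2_set_def real_sqrt_unique)
  finally have *: "\<bar>?L\<bar> + \<bar>\<tau>\<^sup>2 / 4 * ?E\<bar> \<le> tau_norm A \<Omega> \<tau> v * tau_norm A \<Omega> \<tau> w"
    by (simp add: abs_mult)
  then show "\<bar>tau_inner v w\<bar> \<le> tau_norm A \<Omega> \<tau> v * tau_norm A \<Omega> \<tau> w"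
    unfolding tau_inner_def by linarith
  show "\<bar>explicit_form v w\<bar> \<le> 2 * (tau_norm A \<Omega> \<tau> v * tau_norm A \<Omega> \<tau> w)"
    using * unfolding explicit_form_def by linarith
qed

lemma tau_norm_triangle_diff:
  assumes v: "v \<in> Vh \<Omega> T" and w: "w \<in> Vh \<Omega> T"
  shows "tau_norm A \<Omega> \<tau> (\<lambda>x. v x - w x) \<le> tau_norm A \<Omega> \<tau> v + tau_norm A \<Omega> \<tau> w"
proof -
  let ?u = "\<lambda>x. 1 * v x + (-1) * w x"
  have u: "?u \<in> Vh \<Omega> T" using v w by (rule Vh_lincomb)
  have "tau_inner ?u ?u = 1 * tau_inner v ?u + (-1) * tau_inner w ?u"
    by (rule tau_inner_lincomb[OF v w u])
  also have "tau_inner v ?u = 1 * tau_inner v v + (-1) * tau_inner w v"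
    by (subst tau_inner_commute) (rule tau_inner_lincomb[OF v w v])
  also have "tau_inner w ?u = 1 * tau_inner v w + (-1) * tau_inner w w"
    by (subst tau_inner_commute) (rule tau_inner_lincomb[OF v w w])
  also have "tau_inner w v = tau_inner v w"
    by (rule tau_inner_commute)
  finally have "tau_inner ?u ?u = tau_inner v v - 2 * tau_inner v w + tau_inner w w"
    by simp
  then have "(tau_norm A \<Omega> \<tau> ?u)\<^sup>2 \<le> (tau_norm A \<Omega> \<tau> v + tau_norm A \<Omega> \<tau> w)\<^sup>2"
    using forms_Cauchy_Schwarz(1)[OF v w] tau_norm_sq(1)[OF u] tau_norm_sq(1)[OF v] tau_norm_sq(1)[OF w]
    by (simp add: power2_sum)
  then show ?thesis
    using power2_le_imp_le[of "tau_norm A \<Omega> \<tau> ?u"] tau_norm_sq(3)[OF v] tau_norm_sq(3)[OF w] by simp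
qed


section \<open>Reformulation of the scheme\<close>

lemma mid_in_Vh: "(\<And>k. z k \<in> Vh \<Omega> T) \<Longrightarrow> mid z n \<in> Vh \<Omega> T"
  using Vh_lincomb[of "z (n + 1)" "z n" "1/2" "1/2"] by (simp add: mid_def add_divide_distrib)

text \<open>Adding the equations for two consecutive times eliminates everything but midpoint values. In the
  resulting recursion the new midpoint value enters through the inner product of the norm alone.\<close>

lemma midpoint_recursion:
  assumes z: "\<And>k. z k \<in> Vh \<Omega> T" and v: "v \<in> Vh \<Omega> T"
    and scheme: "\<And>n. 1 \<le> n \<Longrightarrow> L2_inner \<Omega> (diff2 \<tau> z n) v + energy_form A \<Omega> (avg3 z n) v = 0"
  shows "tau_inner (mid z (n + 2)) v = explicit_form (mid z (n + 1)) v - tau_inner (mid z n) v"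
    and "tau_inner (mid z 1) v = 2 * L2_inner \<Omega> (z 1) v - tau_inner (mid z 0) v"
proof -
  define m where "m k = L2_inner \<Omega> (z k) v" for k
  define e where "e k = \<tau>\<^sup>2 / 4 * energy_form A \<Omega> (z k) v" for k
  have diff2_eq: "diff2 \<tau> z n = (\<lambda>x. (1 / \<tau>\<^sup>2) * z (n + 1) x + (- 2 / \<tau>\<^sup>2) * z n x + (1 / \<tau>\<^sup>2) * z (n - 1) x)" for n
    by (simp add: diff2_def diff_divide_distrib add_divide_distrib)
  have avg3_eq: "avg3 z n = (\<lambda>x. (1 / 4) * z (n + 1) x + (2 / 4) * z n x + (1 / 4) * z (n - 1) x)" for n
    by (simp add: avg3_def add_divide_distrib)
  have mid_eq: "mid z n = (\<lambda>x. (1 / 2) * z (n + 1) x + (1 / 2) * z n x)" for n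
    by (simp add: mid_def add_divide_distrib)
  have mass_mid: "L2_inner \<Omega> (mid z n) v = (m (n + 1) + m n) / 2" for n
    unfolding mid_eq mass_domain_lincomb[OF z z v] by (simp add: m_def)
  have energy_mid: "\<tau>\<^sup>2 / 4 * energy_form A \<Omega> (mid z n) v = (e (n + 1) + e n) / 2" for n
    unfolding mid_eq energy_domain_lincomb[OF z z v] by (simp add: e_def algebra_simps)
  have step: "m (n + 1) - 2 * m n + m (n - 1) + (e (n + 1) + 2 * e n + e (n - 1)) = 0" if "1 \<le> n" for n
  proof -
    have "\<tau>\<^sup>2 * (L2_inner \<Omega> (diff2 \<tau> z n) v + energy_form A \<Omega> (avg3 z n) v) = 0"
      using scheme[OF that] by simp
    moreover have "\<tau>\<^sup>2 * L2_inner \<Omega> (diff2 \<tau> z n) v = m (n + 1) - 2 * m n + m (n - 1)"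
      unfolding diff2_eq lincomb3[OF z z z v] using positive by (simp add: m_def field_simps)
    moreover have "\<tau>\<^sup>2 * energy_form A \<Omega> (avg3 z n) v = e (n + 1) + 2 * e n + e (n - 1)"
      unfolding avg3_eq lincomb3[OF z z z v] by (simp add: e_def algebra_simps)
    ultimately show ?thesis by (simp add: distrib_left)
  qed
  show "tau_inner (mid z (n + 2)) v = explicit_form (mid z (n + 1)) v - tau_inner (mid z n) v"
  proof -
    have alg: "(m3 + m2) / 2 + (e3 + e2) / 2
        = 2 * ((m2 + m1) / 2) - 2 * ((e2 + e1) / 2) - ((m1 + m0) / 2 + (e1 + e0) / 2)"
      if "m2 - 2 * m1 + m0 + (e2 + 2 * e1 + e0) = 0" "m3 - 2 * m2 + m1 + (e3 + 2 * e2 + e1) = 0"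
      for m0 m1 m2 m3 e0 e1 e2 e3 :: real
      using that by (simp add: field_simps)
    have "n + 1 + 1 = n + 2" by simp
    then show ?thesis
      unfolding tau_inner_def explicit_form_def mass_mid energy_mid
      using step[of "n + 1"] step[of "n + 2"] by (simp only:) (rule alg, simp_all)
  qed
  show "tau_inner (mid z 1) v = 2 * L2_inner \<Omega> (z 1) v - tau_inner (mid z 0) v"
  proof -
    have alg: "(m2 + m1) / 2 + (e2 + e1) / 2 = 2 * m1 - ((m1 + m0) / 2 + (e1 + e0) / 2)"
      if "m2 - 2 * m1 + m0 + (e2 + 2 * e1 + e0) = 0" for m0 m1 m2 e0 e1 e2 :: real
      using that by (simp add: field_simps)
    show ?thesis
      unfolding tau_inner_def mass_mid energy_mid m_def[of 1, symmetric]
      using step[of 1] by (simp only: add_0) (rule alg, simp)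
  qed
qed

end


section \<open>Decay away from the data\<close>

text \<open>The elements in \<open>L' - L\<close> form the layer on which the solution is cut off. On each element, Young's
  inequality with \<open>(2 x + y)\<^sup>2 \<le> 6 x\<^sup>2 + 3 y\<^sup>2\<close> separates the old time steps from the new one, and
  the sum over the layer is the difference of two consecutive outer sums.\<close>

lemma layer_sums:
  fixes p q a x y :: "'k \<Rightarrow> real"
  assumes fin: "finite T" and sub: "L \<subseteq> L'" "L' \<subseteq> T" and c: "1 \<le> c"
    and eq: "sum p T = sum q T"
    and inner: "\<And>K. K \<in> L \<Longrightarrow> p K = 0" "\<And>K. K \<in> L \<Longrightarrow> q K = 0"
    and outer: "\<And>K. K \<in> T - L' \<Longrightarrow> p K = (a K)\<^sup>2" "\<And>K. K \<in> T - L' \<Longrightarrow> \<bar>q K\<bar> \<le> (2 * x K + y K) * a K"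
    and layer: "\<And>K. K \<in> L' - L \<Longrightarrow> \<bar>p K\<bar> \<le> c * (a K)\<^sup>2"
      "\<And>K. K \<in> L' - L \<Longrightarrow> \<bar>q K\<bar> \<le> (2 * x K + y K) * (c * a K)"
  shows "(\<Sum>K\<in>T - L'. (a K)\<^sup>2) \<le> 3 * c / (1 + 3 * c) *
    ((\<Sum>K\<in>T - L. (a K)\<^sup>2) + 2 * (\<Sum>K\<in>T - L. (x K)\<^sup>2) + (\<Sum>K\<in>T - L. (y K)\<^sup>2))"
proof -
  define s where "s K = 3 * (x K)\<^sup>2 + 3 / 2 * (y K)\<^sup>2" for K
  have s0: "0 \<le> s K" for K by (simp add: s_def)
  have young: "(2 * x K + y K) * a K \<le> (a K)\<^sup>2 / 2 + s K" for K
  proof -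
    have "0 \<le> (2 * x K + y K - a K)\<^sup>2 + 2 * (x K - y K)\<^sup>2" by simp
    then show ?thesis by (simp add: s_def power2_eq_square algebra_simps)
  qed
  have out: "(a K)\<^sup>2 / 2 - c * s K \<le> p K - q K" if "K \<in> T - L'" for K
    using outer[OF that] young[of K] mult_right_mono[OF c s0[of K]] by (simp add: abs_le_iff)
  have lay: "- (3 / 2 * c * (a K)\<^sup>2) - c * s K \<le> p K - q K" if "K \<in> L' - L" for K
  proof -
    have "\<bar>q K\<bar> \<le> c * ((a K)\<^sup>2 / 2 + s K)"
    proof -
      have "\<bar>q K\<bar> \<le> c * ((2 * x K + y K) * a K)"
        using layer(2)[OF that] by (simp add: mult_ac)
      also have "\<dots> \<le> c * ((a K)\<^sup>2 / 2 + s K)"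
        using c by (intro mult_left_mono[OF young]) simp
      finally show ?thesis .
    qed
    then show ?thesis
      using layer(1)[OF that] by (simp add: abs_le_iff algebra_simps)
  qed
  have split: "sum f (T - L) = sum f (T - L') + sum f (L' - L)" for f :: "'k \<Rightarrow> real"
  proof -
    have "T - L = (T - L') \<union> (L' - L)" using sub by blast
    then show ?thesis
      using fin sub finite_subset[OF sub(2) fin] by (simp add: sum.union_disjoint Int_Diff disjoint_iff)
  qed
  have "0 = (\<Sum>K\<in>T. p K - q K)"
    using eq by (simp add: sum_subtractf)
  also have "\<dots> = (\<Sum>K\<in>T - L. p K - q K)"
    using inner sub fin by (intro sum.mono_neutral_right) auto
  also have "\<dots> \<ge> (\<Sum>K\<in>T - L'. (a K)\<^sup>2 / 2 - c * s K) + (\<Sum>K\<in>L' - L. - (3 / 2 * c * (a K)\<^sup>2) - c * s K)"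
    unfolding split by (intro add_mono sum_mono out lay)
  finally have "(\<Sum>K\<in>T - L'. (a K)\<^sup>2 / 2 - c * s K) + (\<Sum>K\<in>L' - L. - (3 / 2 * c * (a K)\<^sup>2) - c * s K) \<le> 0" .
  moreover have "(\<Sum>K\<in>T - L'. (a K)\<^sup>2 / 2 - c * s K) = (\<Sum>K\<in>T - L'. (a K)\<^sup>2) / 2 - c * sum s (T - L')"
    by (simp add: sum_subtractf sum_distrib_left sum_divide_distrib)
  moreover have "(\<Sum>K\<in>L' - L. - (3 / 2 * c * (a K)\<^sup>2) - c * s K)
      = - (3 / 2 * c * (\<Sum>K\<in>L' - L. (a K)\<^sup>2)) - c * sum s (L' - L)"
    by (simp add: sum_subtractf sum_distrib_left sum_negf)
  ultimately have "(\<Sum>K\<in>T - L'. (a K)\<^sup>2) / 2 - c * sum s (T - L')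
      + (- (3 / 2 * c * (\<Sum>K\<in>L' - L. (a K)\<^sup>2)) - c * sum s (L' - L)) \<le> 0"
    by (simp only:)
  then have "(\<Sum>K\<in>T - L'. (a K)\<^sup>2) \<le> 3 * c * (\<Sum>K\<in>L' - L. (a K)\<^sup>2) + 2 * c * sum s (T - L)"
    unfolding split[of s] by (simp add: field_simps)
  also have "sum s (T - L) = 3 * (\<Sum>K\<in>T - L. (x K)\<^sup>2) + 3 / 2 * (\<Sum>K\<in>T - L. (y K)\<^sup>2)"
    by (simp add: s_def sum.distrib sum_distrib_left)
  finally have "(1 + 3 * c) * (\<Sum>K\<in>T - L'. (a K)\<^sup>2)
      \<le> 3 * c * ((\<Sum>K\<in>T - L. (a K)\<^sup>2) + 2 * (\<Sum>K\<in>T - L. (x K)\<^sup>2) + (\<Sum>K\<in>T - L. (y K)\<^sup>2))"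
    unfolding split[of "\<lambda>K. (a K)\<^sup>2"] by (simp add: field_simps)
  then show ?thesis
    using c by (simp add: pos_le_divide_eq mult_ac)
qed

text \<open>The weights 1, 2, 1 are the coefficients of \<open>(1 + z)\<^sup>2\<close>, so iteration over \<open>k\<close> layers produces partial sums
  of the binomial coefficients of \<open>(1 + z) ^ (2 k)\<close>. The bound \<open>(1 + 2 k) ^ n\<close> dominates them; with
  \<open>t = 1 + 2 k\<close> its induction step is \<open>t\<^sup>2 + 2 t + 1 \<le> (t + 2)\<^sup>2\<close>.\<close>

lemma layer_time_recursion:
  fixes E :: "nat \<Rightarrow> nat \<Rightarrow> real"
  assumes zero: "\<And>k. E 0 k = 0"
    and one: "\<And>k. E 1 (Suc k) \<le> \<rho> * E 1 k"
    and step: "\<And>n k. E (n + 2) (Suc k) \<le> \<rho> * (E (n + 2) k + 2 * E (n + 1) k + E n k)"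
    and start: "\<And>n. n \<le> m \<Longrightarrow> E n 0 \<le> B" and \<rho>: "0 \<le> \<rho>" and B: "0 \<le> B"
  shows "n \<le> m \<Longrightarrow> E n k \<le> \<rho> ^ k * (1 + 2 * real k) ^ n * B"
proof (induction k arbitrary: n)
  case 0
  then show ?case using start by simp
next
  case (Suc k)
  define t where "t = 1 + 2 * real k"
  have t: "1 \<le> t" and t2: "1 + 2 * real (Suc k) = t + 2" by (simp_all add: t_def)
  consider "n = 0" | "n = 1" | j where "n = j + 2"
    by (metis One_nat_def add_2_eq_Suc' not0_implies_Suc)
  then show ?case
  proof cases
    case 1
    then show ?thesis using zero \<rho> B by simp
  next
    case 2
    have "E 1 (Suc k) \<le> \<rho> * (\<rho> ^ k * t ^ 1 * B)"
      using one[of k] mult_left_mono[OF Suc.IH[of 1] \<rho>] Suc.prems 2 by (simp add: t_def)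
    also have "\<dots> = \<rho> ^ Suc k * t * B"
      by simp
    also have "\<dots> \<le> \<rho> ^ Suc k * (t + 2) * B"
      using \<rho> B by (intro mult_right_mono mult_left_mono) auto
    finally show ?thesis
      unfolding 2 t2 by simp
  next
    case 3
    have "E (j + 2) (Suc k) \<le> \<rho> * (E (j + 2) k + 2 * E (j + 1) k + E j k)"
      by (rule step)
    also have "\<dots> \<le> \<rho> * (\<rho> ^ k * t ^ (j + 2) * B + 2 * (\<rho> ^ k * t ^ (j + 1) * B) + \<rho> ^ k * t ^ j * B)"
      using Suc.IH[of "j + 2"] Suc.IH[of "j + 1"] Suc.IH[of j] Suc.prems 3 \<rho> unfolding t_def
      by (intro mult_left_mono add_mono) auto
    also have "\<dots> = \<rho> ^ Suc k * B * (t ^ j * (t + 1)\<^sup>2)"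
      by (simp add: power2_eq_square algebra_simps)
    also have "\<dots> \<le> \<rho> ^ Suc k * B * ((t + 2) ^ j * (t + 2)\<^sup>2)"
      using \<rho> B t by (intro mult_left_mono mult_mono power_mono) auto
    finally show ?thesis
      unfolding t2 3 by (simp add: power2_eq_square mult_ac)
  qed
qed

text \<open>For \<open>y \<ge> 3\<close> the two old values amount to at most the fraction 2/3 + 1/9 of the new bound, and the factor
  9/2 is the reciprocal of what remains for the inhomogeneity.\<close>

lemma geometric_time_recursion:
  fixes X :: "nat \<Rightarrow> real"
  assumes zero: "X 0 \<le> 0" and one: "1 \<le> m \<Longrightarrow> X 1 \<le> D * y"
    and step: "\<And>n. n + 2 \<le> m \<Longrightarrow> X (n + 2) \<le> D * y ^ (n + 2) + 2 * X (n + 1) + X n"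
    and y: "3 \<le> y" and D: "0 \<le> D"
  shows "n \<le> m \<Longrightarrow> X n \<le> 9 / 2 * D * y ^ n"
proof (induction n rule: less_induct)
  case (less n)
  consider "n = 0" | "n = 1" | j where "n = j + 2"
    by (metis One_nat_def add_2_eq_Suc' not0_implies_Suc)
  then show ?case
  proof cases
    case 1
    then show ?thesis using zero D by simp
  next
    case 2
    have "D * y \<le> 9 / 2 * D * y" using D y by simp
    then show ?thesis using one less.prems 2 by simp
  next
    case 3
    define B where "B = D * y ^ j"
    have B: "0 \<le> B" using D y by (simp add: B_def)
    have IH: "X (j + 1) \<le> 9 / 2 * (B * y)" "X j \<le> 9 / 2 * B"
      using less.IH[of "j + 1"] less.IH[of j] less.prems 3 by (simp_all add: B_def mult_ac)
    have "3 * (B * y) \<le> B * y\<^sup>2" "9 * B \<le> B * y\<^sup>2"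
      using mult_left_mono[OF y, of "B * y"] mult_left_mono[of 9 "y\<^sup>2" B] power_mono[OF y, of 2] B y
      by (simp_all add: power2_eq_square mult_ac)
    moreover have "X (j + 2) \<le> B * y\<^sup>2 + 2 * X (j + 1) + X j"
      using step[of j] less.prems 3 by (simp add: B_def power2_eq_square mult_ac)
    ultimately have "X (j + 2) \<le> 9 / 2 * (B * y\<^sup>2)"
      using IH by simp
    then show ?thesis
      unfolding 3 by (simp add: B_def power2_eq_square mult_ac)
  qed
qed

context wave_mesh
begin

definition outer_energy :: "(real^'d) set set \<Rightarrow> nat \<Rightarrow> (real^'d \<Rightarrow> real) \<Rightarrow> real" where
  "outer_energy S k v = (\<Sum>K\<in>T - layers S k. (elem_norm K v)\<^sup>2)"

definition cutoff_const :: real where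
  "cutoff_const = trunc_const CARD('d) \<sigma> \<beta> * (\<tau> / h + h / \<tau>)"

lemma cutoff_const_ge_1:
  assumes "0 < h"
  shows "1 \<le> cutoff_const"
proof -
  have "1 \<le> \<tau> / h + h / \<tau>"
  proof (cases "h \<le> \<tau>")
    case True
    then have "1 \<le> \<tau> / h" "0 \<le> h / \<tau>" using assms positive by simp_all
    then show ?thesis by linarith
  next
    case False
    then have "1 \<le> h / \<tau>" "0 \<le> \<tau> / h" using assms positive by simp_all
    then show ?thesis by linarith
  qed
  then show ?thesis
    using mult_mono[of 1 "trunc_const CARD('d) \<sigma> \<beta>" 1 "\<tau> / h + h / \<tau>"]
      trunc_const_ge_1[of "CARD('d)" \<beta> \<sigma>] positive by (simp add: cutoff_const_def)
qed

lemma zero_in_Vh: "(\<lambda>_. 0) \<in> Vh \<Omega> T"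
  by (simp add: Vh_iff edge_affine_zero)

lemma elem_norm_zero:
  assumes "K \<in> T" "\<And>x. x \<in> K \<Longrightarrow> v x = 0"
  shows "elem_norm K v = 0"
  using element_forms_zero[of K v v] assms by (simp add: elem_norm_def)

lemma layers_increasing: "S \<subseteq> T \<Longrightarrow> S \<subseteq> layers S k"
proof (induction k)
  case (Suc k)
  show ?case
    by (rule order_trans[OF Suc.IH[OF Suc.prems] layers_mono[OF Suc.prems]])
qed simp

lemma layer_truncation:
  assumes S: "S \<subseteq> T" and u: "u \<in> Vh \<Omega> T"
  obtains v where "v \<in> Vh \<Omega> T"
    "\<And>K x. K \<in> layers S k \<Longrightarrow> x \<in> closure K \<Longrightarrow> v x = 0"
    "\<And>K x. K \<in> T - layers S (Suc k) \<Longrightarrow> x \<in> closure K \<Longrightarrow> v x = u x"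
    "\<And>K. K \<in> T \<Longrightarrow> elem_norm K v \<le> cutoff_const * elem_norm K u"
proof -
  let ?Z = "\<Union>K\<in>layers S k. closure K"
  obtain v where v: "v \<in> Vh \<Omega> T"
    "\<And>K x. K \<in> T \<Longrightarrow> closure K \<subseteq> ?Z \<Longrightarrow> x \<in> closure K \<Longrightarrow> v x = 0"
    "\<And>K x. K \<in> T \<Longrightarrow> closure K \<inter> ?Z = {} \<Longrightarrow> x \<in> closure K \<Longrightarrow> v x = u x"
    "\<And>K b M N I. K \<in> T \<Longrightarrow> chart K b M N \<Longrightarrow>
       \<bar>v (affine_ref b M (corner I))\<bar> \<le> \<bar>u (affine_ref b M (corner I))\<bar>"
    using nodal_truncation[OF u, of ?Z] by blast
  show ?thesis
  proof (rule that[OF v(1)])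
    show "v x = 0" if "K \<in> layers S k" "x \<in> closure K" for K x
      using v(2)[of K x] that layers_subset[OF S, of k] by blast
    show "v x = u x" if "K \<in> T - layers S (Suc k)" "x \<in> closure K" for K x
      using v(3)[of K x] layers_separated[of K S k] that by blast
    show "elem_norm K v \<le> cutoff_const * elem_norm K u" if K: "K \<in> T" for K
    proof -
      obtain b M N where ch: "chart K b M N" using element_chart[OF K] .
      show ?thesis
        unfolding cutoff_const_def by (rule elem_norm_le_of_vertices[OF K ch u v(1)]) (rule v(4)[OF K ch])
    qed
  qed
qed

text \<open>Testing with the truncation of the solution itself. It equals the solution outside the layer, which
  gives the outer energy on the left-hand side, and it vanishes where the data live.\<close>

lemma outer_energy_decay:
  assumes S: "S \<subseteq> T" and h: "0 < h" and U: "U \<in> Vh \<Omega> T" and x: "x \<in> Vh \<Omega> T" and y: "y \<in> Vh \<Omega> T"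
    and eq: "\<And>v. v \<in> Vh \<Omega> T \<Longrightarrow> (\<And>K z. K \<in> S \<Longrightarrow> z \<in> closure K \<Longrightarrow> v z = 0) \<Longrightarrow>
      tau_inner U v = explicit_form x v - tau_inner y v"
  shows "outer_energy S (Suc k) U \<le> 3 * cutoff_const / (1 + 3 * cutoff_const) *
    (outer_energy S k U + 2 * outer_energy S k x + outer_energy S k y)"
proof -
  obtain v where v: "v \<in> Vh \<Omega> T"
    "\<And>K x. K \<in> layers S k \<Longrightarrow> x \<in> closure K \<Longrightarrow> v x = 0"
    "\<And>K x. K \<in> T - layers S (Suc k) \<Longrightarrow> x \<in> closure K \<Longrightarrow> v x = U x"
    "\<And>K. K \<in> T \<Longrightarrow> elem_norm K v \<le> cutoff_const * elem_norm K U"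
    using layer_truncation[OF S U] by blast
  define p where "p K = L2_inner K U v + \<tau>\<^sup>2 / 4 * energy_form A K U v" for K
  define q where "q K = 2 * L2_inner K x v - 2 * (\<tau>\<^sup>2 / 4 * energy_form A K x v)
    - (L2_inner K y v + \<tau>\<^sup>2 / 4 * energy_form A K y v)" for K
  have pb: "\<bar>p K\<bar> \<le> elem_norm K U * elem_norm K v" if K: "K \<in> T" for K
  proof -
    have "\<bar>L2_inner K U v\<bar> + \<bar>\<tau>\<^sup>2 / 4 * energy_form A K U v\<bar> \<le> elem_norm K U * elem_norm K v"
      using elem_Cauchy_Schwarz[OF K U v(1)] by (simp add: abs_mult)
    then show ?thesis unfolding p_def by linarith
  qed
  have qb: "\<bar>q K\<bar> \<le> (2 * elem_norm K x + elem_norm K y) * elem_norm K v" if K: "K \<in> T" for K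
  proof -
    have "\<bar>L2_inner K x v\<bar> + \<bar>\<tau>\<^sup>2 / 4 * energy_form A K x v\<bar> \<le> elem_norm K x * elem_norm K v"
      "\<bar>L2_inner K y v\<bar> + \<bar>\<tau>\<^sup>2 / 4 * energy_form A K y v\<bar> \<le> elem_norm K y * elem_norm K v"
      using elem_Cauchy_Schwarz[OF K x v(1)] elem_Cauchy_Schwarz[OF K y v(1)] by (simp_all add: abs_mult)
    then show ?thesis
      unfolding q_def distrib_right mult.assoc by linarith
  qed
  show ?thesis
    unfolding outer_energy_def
  proof (rule layer_sums[where p = p and q = q])
    show "finite T" by (rule finite_mesh)
    show "layers S k \<subseteq> layers S (Suc k)" by (rule layers_mono[OF S])
    show "layers S (Suc k) \<subseteq> T" by (rule layers_subset[OF S])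
    show "1 \<le> cutoff_const" by (rule cutoff_const_ge_1[OF h])
    have "v z = 0" if "K \<in> S" "z \<in> closure K" for K z
      using v(2) that layers_increasing[OF S, of k] by blast
    from eq[OF v(1) this] show "sum p T = sum q T"
      unfolding tau_inner_def explicit_form_def mass_domain[OF U v(1)] mass_domain[OF x v(1)]
        mass_domain[OF y v(1)] energy_domain[OF U v(1)] energy_domain[OF x v(1)] energy_domain[OF y v(1)]
      by (simp add: p_def q_def sum.distrib sum_subtractf sum_distrib_left)
  next
    fix K assume K: "K \<in> layers S k"
    then have KT: "K \<in> T" using layers_subset[OF S] by blast
    have "v z = 0" if "z \<in> K" for z
      using v(2)[OF K, of z] that closure_subset by blast
    then show "p K = 0" "q K = 0"
      using element_forms_zero[OF KT, of v] by (simp_all add: p_def q_def)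
  next
    fix K assume K: "K \<in> T - layers S (Suc k)"
    then have KT: "K \<in> T" by simp
    have vU: "v z = U z" if "z \<in> K" for z
      using v(3)[OF K, of z] that closure_subset by blast
    have "elem_norm K v = elem_norm K U"
      using element_forms_cong[where v = U, OF KT vU] element_forms_cong[where v = v, OF KT vU]
      unfolding elem_norm_def by (simp add: mass_commute[of K v U] energy_commute[of K v U])
    then show "\<bar>q K\<bar> \<le> (2 * elem_norm K x + elem_norm K y) * elem_norm K U"
      using qb[OF KT] by simp
    show "p K = (elem_norm K U)\<^sup>2"
      using element_forms_cong[where v = U, OF KT vU] by (simp add: p_def elem_norm_sq[OF KT])
  next
    fix K assume K: "K \<in> layers S (Suc k) - layers S k"
    then have KT: "K \<in> T" using layers_subset[OF S, of "Suc k"] by blast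
    show "\<bar>p K\<bar> \<le> cutoff_const * (elem_norm K U)\<^sup>2"
      using pb[OF KT] mult_left_mono[OF v(4)[OF KT] elem_norm_nonneg[OF KT, of U]]
      by (simp add: power2_eq_square mult_ac)
    have "0 \<le> 2 * elem_norm K x + elem_norm K y"
      using elem_norm_nonneg[OF KT, of x] elem_norm_nonneg[OF KT, of y] by simp
    then show "\<bar>q K\<bar> \<le> (2 * elem_norm K x + elem_norm K y) * (cutoff_const * elem_norm K U)"
      using qb[OF KT] mult_left_mono[OF v(4)[OF KT]] by (meson order_trans)
  qed
qed


section \<open>Error of the localized scheme\<close>

text \<open>One time step of the error. The truncation \<open>r\<close> of the global solution to the outer layers is what the
  local space cannot represent; up to this defect the error itself is an admissible test function.\<close>

lemma error_step:
  assumes S: "S \<subseteq> T" and h: "0 < h" and U: "U \<in> Vh \<Omega> T" and V: "V \<in> Vh \<Omega> T"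
    and V0: "\<And>K z. K \<in> T - layers S (Suc k) \<Longrightarrow> z \<in> K \<Longrightarrow> V z = 0"
    and \<xi>: "\<xi> = (\<lambda>z. V z - U z)" and x: "x \<in> Vh \<Omega> T" and y: "y \<in> Vh \<Omega> T"
    and eq: "\<And>w. w \<in> Vh \<Omega> T \<Longrightarrow> (\<And>K z. K \<in> T - layers S (Suc k) \<Longrightarrow> z \<in> K \<Longrightarrow> w z = 0) \<Longrightarrow>
      tau_inner \<xi> w = explicit_form x w - tau_inner y w"
  shows "tau_norm A \<Omega> \<tau> \<xi> \<le> 2 * (cutoff_const * sqrt (outer_energy S k U))
    + 2 * tau_norm A \<Omega> \<tau> x + tau_norm A \<Omega> \<tau> y"
proof -
  let ?n = "tau_norm A \<Omega> \<tau>"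
  obtain r where r: "r \<in> Vh \<Omega> T"
    "\<And>K x. K \<in> layers S k \<Longrightarrow> x \<in> closure K \<Longrightarrow> r x = 0"
    "\<And>K x. K \<in> T - layers S (Suc k) \<Longrightarrow> x \<in> closure K \<Longrightarrow> r x = U x"
    "\<And>K. K \<in> T \<Longrightarrow> elem_norm K r \<le> cutoff_const * elem_norm K U"
    using layer_truncation[OF S U] by blast
  have r_norm: "?n r \<le> cutoff_const * sqrt (outer_energy S k U)"
  proof (rule power2_le_imp_le)
    have "(?n r)\<^sup>2 = (\<Sum>K\<in>T. (elem_norm K r)\<^sup>2)"
      by (rule tau_norm_sq(2)[OF r(1)])
    also have "\<dots> = (\<Sum>K\<in>T - layers S k. (elem_norm K r)\<^sup>2)"
    proof (rule sum.mono_neutral_right[OF finite_mesh])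
      show "\<forall>K\<in>T - (T - layers S k). (elem_norm K r)\<^sup>2 = 0"
      proof
        fix K assume "K \<in> T - (T - layers S k)"
        then have K: "K \<in> T" "K \<in> layers S k" by auto
        have "r z = 0" if "z \<in> K" for z
          using r(2)[OF K(2), of z] that closure_subset by blast
        then show "(elem_norm K r)\<^sup>2 = 0"
          using elem_norm_zero[OF K(1)] by simp
      qed
    qed blast
    also have "\<dots> \<le> (\<Sum>K\<in>T - layers S k. (cutoff_const * elem_norm K U)\<^sup>2)"
      using r(4) elem_norm_nonneg by (intro sum_mono power_mono) auto
    also have "\<dots> = cutoff_const\<^sup>2 * outer_energy S k U"
      by (simp add: outer_energy_def power_mult_distrib sum_distrib_left)
    also have "\<dots> = (cutoff_const * sqrt (outer_energy S k U))\<^sup>2"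
      by (simp add: power_mult_distrib outer_energy_def sum_nonneg)
    finally show "(?n r)\<^sup>2 \<le> (cutoff_const * sqrt (outer_energy S k U))\<^sup>2" .
    show "0 \<le> cutoff_const * sqrt (outer_energy S k U)"
      using cutoff_const_ge_1[OF h] by (simp add: outer_energy_def sum_nonneg)
  qed
  have \<xi>V: "\<xi> \<in> Vh \<Omega> T"
    using Vh_lincomb[OF V U, of 1 "-1"] by (simp add: \<xi>)
  define \<theta> where "\<theta> = (\<lambda>z. 1 * \<xi> z + 1 * r z)"
  have \<theta>: "\<theta> \<in> Vh \<Omega> T"
    unfolding \<theta>_def by (rule Vh_lincomb[OF \<xi>V r(1)])
  have \<theta>0: "\<theta> z = 0" if "K \<in> T - layers S (Suc k)" "z \<in> K" for K z
    using V0[OF that] r(3)[OF that(1), of z] that(2) closure_subset[of K] by (auto simp: \<theta>_def \<xi>)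
  have "tau_inner \<theta> \<theta> = 1 * tau_inner \<xi> \<theta> + 1 * tau_inner r \<theta>"
    unfolding \<theta>_def by (rule tau_inner_lincomb[OF \<xi>V r(1) \<theta>[unfolded \<theta>_def]])
  then have "?n \<theta> * ?n \<theta> = explicit_form x \<theta> - tau_inner y \<theta> + tau_inner r \<theta>"
    using eq[OF \<theta> \<theta>0] tau_norm_sq(1)[OF \<theta>] by (simp add: power2_eq_square)
  also have "\<dots> \<le> 2 * (?n x * ?n \<theta>) + ?n y * ?n \<theta> + ?n r * ?n \<theta>"
    using forms_Cauchy_Schwarz(2)[OF x \<theta>] forms_Cauchy_Schwarz(1)[OF y \<theta>] forms_Cauchy_Schwarz(1)[OF r(1) \<theta>]
    by linarith
  also have "\<dots> = (2 * ?n x + ?n y + ?n r) * ?n \<theta>"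
    by (simp add: algebra_simps)
  finally have mul: "?n \<theta> * ?n \<theta> \<le> (2 * ?n x + ?n y + ?n r) * ?n \<theta>" .
  have "?n \<theta> \<le> 2 * ?n x + ?n y + ?n r"
  proof (cases "?n \<theta> = 0")
    case True
    then show ?thesis
      using tau_norm_sq(3)[OF x] tau_norm_sq(3)[OF y] tau_norm_sq(3)[OF r(1)] by simp
  next
    case False
    then have "0 < ?n \<theta>" using tau_norm_sq(3)[OF \<theta>] by simp
    then show ?thesis using mul by simp
  qed
  moreover have "?n \<xi> \<le> ?n \<theta> + ?n r"
    using tau_norm_triangle_diff[OF \<theta> r(1)] by (simp add: \<theta>_def)
  ultimately show ?thesis
    using r_norm by linarith
qed

lemma vanishes_on_closure:
  assumes "v \<in> Vh \<Omega> T" "\<And>z. z \<in> K \<Longrightarrow> v z = 0" "z \<in> closure K"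
  shows "v z = 0"
proof (rule continuous_constant_on_closure[of K v 0 z])
  show "continuous_on (closure K) v"
    using assms(1) continuous_on_subset[of UNIV v "closure K"] by (simp add: Vh_iff)
  show "z \<in> closure K" by (rule assms(3))
  show "v x = 0" if "x \<in> K" for x using that by (rule assms(2))
qed

lemma Vh_on_iff:
  assumes R: "R \<subseteq> T" and X: "closure X = (\<Union>K\<in>R. closure K)"
  shows "v \<in> Vh_on \<Omega> T X \<longleftrightarrow> v \<in> Vh \<Omega> T \<and> (\<forall>K\<in>T - R. \<forall>z\<in>K. v z = 0)"
proof (intro iffI conjI ballI)
  assume v: "v \<in> Vh_on \<Omega> T X"
  then show "v \<in> Vh \<Omega> T" by (simp add: Vh_on_def)
  fix K z assume K: "K \<in> T - R" and z: "z \<in> K"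
  show "v z = 0"
  proof (rule ccontr)
    assume "v z \<noteq> 0"
    then have "z \<in> closure {x. v x \<noteq> 0}"
      by (intro subsetD[OF closure_subset]) simp
    moreover have "closure {x. v x \<noteq> 0} \<subseteq> closure X"
      using v by (simp add: Vh_on_def)
    ultimately have "z \<in> closure X" by (rule subsetD[rotated])
    then obtain K' where "K' \<in> R" "z \<in> closure K'" using X by blast
    then show False
      using element_disjoint_closure[of K K'] K z R by blast
  qed
next
  assume *: "v \<in> Vh \<Omega> T \<and> (\<forall>K\<in>T - R. \<forall>z\<in>K. v z = 0)"
  have "{x. v x \<noteq> 0} \<subseteq> closure X"
  proof
    fix z assume "z \<in> {x. v x \<noteq> 0}"
    then have z: "v z \<noteq> 0" by simp
    then have "z \<in> closure \<Omega>"
      using * closure_subset[of \<Omega>] by (auto simp: Vh_iff)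
    then obtain K where K: "K \<in> T" "z \<in> closure K" using closure_elements by blast
    then have "K \<in> R"
      using vanishes_on_closure[of v K z] * z by blast
    then show "z \<in> closure X" using K X by blast
  qed
  then show "v \<in> Vh_on \<Omega> T X"
    using * by (simp add: Vh_on_def closure_minimal)
qed

text \<open>The approximated data need not be supported in the data region, but they act like the given function on
  test functions that vanish there, and this function is zero almost everywhere else.\<close>

lemma data_vanishes:
  assumes S: "S \<subseteq> T" and g: "ess_supp \<Omega> g \<subseteq> closure (\<Union>S)" and gh: "fe_approximation \<Omega> T (\<Union>S) g gh"
    and v: "v \<in> Vh \<Omega> T" and v0: "\<And>K z. K \<in> S \<Longrightarrow> z \<in> closure K \<Longrightarrow> v z = 0"
  shows "L2_inner \<Omega> gh v = 0"
proof -
  have clo: "closure (\<Union>S) = (\<Union>K\<in>S. closure K)"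
    using patch_layers(1)[OF S, of 0] by (simp add: patch_iter_def)
  have off: "v z = 0" if "z \<in> closure (\<Union>S)" for z
    using that v0 unfolding clo by blast
  have "{x. v x \<noteq> 0} \<subseteq> closure (\<Omega> - closure (\<Union>S))"
    using off v closure_subset[of "\<Omega> - closure (\<Union>S)"] by (auto simp: Vh_iff)
  then have "v \<in> Vh_on \<Omega> T (\<Omega> - closure (\<Union>S))"
    using v by (simp add: Vh_on_def closure_minimal)
  then have "L2_inner \<Omega> gh v = L2_inner \<Omega> g v"
    using gh by (simp add: fe_approximation_def)
  also have "\<dots> = 0"
  proof -
    have "AE x in lebesgue. x \<in> \<Omega> \<longrightarrow> g x * v x = 0"
      using AE_zero_off_ess_supp[OF open_domain, of g] by eventually_elim (use off g in auto)
    then have "AE x in lebesgue_on \<Omega>. g x * v x = 0"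
      using open_domain by (subst AE_restrict_space_iff) auto
    then show ?thesis
      unfolding L2_inner_def by (rule integral_eq_zero_AE)
  qed
  finally show ?thesis .
qed

lemma diff2_in_Vh: "(\<And>k. z k \<in> Vh \<Omega> T) \<Longrightarrow> diff2 \<tau> z n \<in> Vh \<Omega> T"
  using Vh_lincomb[OF Vh_lincomb[of "z (n + 1)" "z n" "1 / \<tau>\<^sup>2" "- 2 / \<tau>\<^sup>2"], of "z (n - 1)" 1 "1 / \<tau>\<^sup>2"]
  by (simp add: diff2_def diff_divide_distrib add_divide_distrib)

lemma avg3_in_Vh: "(\<And>k. z k \<in> Vh \<Omega> T) \<Longrightarrow> avg3 z n \<in> Vh \<Omega> T"
  using Vh_lincomb[OF Vh_lincomb[of "z (n + 1)" "z n" "1 / 4" "2 / 4"], of "z (n - 1)" 1 "1 / 4"]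
  by (simp add: avg3_def add_divide_distrib)

end


section \<open>Iteration over layers and time steps\<close>

context wave_mesh
begin

lemma mass_avg3:
  assumes z: "\<And>k. z k \<in> Vh \<Omega> T" and v: "v \<in> Vh \<Omega> T"
  shows "L2_inner \<Omega> (avg3 z n) v
    = (L2_inner \<Omega> (z (n + 1)) v + 2 * L2_inner \<Omega> (z n) v + L2_inner \<Omega> (z (n - 1)) v) / 4"
proof -
  have "avg3 z n = (\<lambda>x. (1 / 4) * z (n + 1) x + (2 / 4) * z n x + (1 / 4) * z (n - 1) x)"
    by (simp add: avg3_def add_divide_distrib)
  then show ?thesis
    using lincomb3(1)[OF z z z v, of "1 / 4" "n + 1" "2 / 4" n "1 / 4" "n - 1"] by (simp add: add_divide_distrib)
qed

lemma forms_zero_left: "tau_inner (\<lambda>_. 0) v = 0" "explicit_form (\<lambda>_. 0) v = 0" "L2_inner \<Omega> (\<lambda>_. 0) v = 0"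
proof -
  have "grad (\<lambda>_. 0) x = (0::real^'d)" for x
    by (rule grad_zero_open[of UNIV]) auto
  then show "tau_inner (\<lambda>_. 0) v = 0" "explicit_form (\<lambda>_. 0) v = 0" "L2_inner \<Omega> (\<lambda>_. 0) v = 0"
    by (simp_all add: tau_inner_def explicit_form_def L2_inner_def energy_form_def)
qed

lemma forms_zero_disjoint:
  assumes p: "p \<in> Vh \<Omega> T" and v: "v \<in> Vh \<Omega> T"
    and p0: "\<And>K x. K \<in> T - R \<Longrightarrow> x \<in> K \<Longrightarrow> p x = 0" and v0: "\<And>K x. K \<in> R \<Longrightarrow> x \<in> K \<Longrightarrow> v x = 0"
  shows "L2_inner \<Omega> p v = 0" "tau_inner p v = 0"
proof -
  have "L2_inner K p v = 0 \<and> energy_form A K p v = 0" if K: "K \<in> T" for K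
  proof (cases "K \<in> R")
    case True
    then show ?thesis using element_forms_zero[OF K, of v p] v0 by blast
  next
    case False
    then show ?thesis using element_forms_zero[OF K, of p v] p0 K by blast
  qed
  then show "L2_inner \<Omega> p v = 0" "tau_inner p v = 0"
    by (simp_all add: tau_inner_def mass_domain[OF p v] energy_domain[OF p v])
qed

lemma tau_norm_minus_commute:
  assumes v: "v \<in> Vh \<Omega> T" and w: "w \<in> Vh \<Omega> T"
  shows "tau_norm A \<Omega> \<tau> (\<lambda>x. v x - w x) = tau_norm A \<Omega> \<tau> (\<lambda>x. w x - v x)"
proof -
  define d where "d = (\<lambda>x. 1 * v x + (-1) * w x)"
  define d' where "d' = (\<lambda>x. (-1) * d x + 0 * d x)"
  have d: "d \<in> Vh \<Omega> T" unfolding d_def by (rule Vh_lincomb[OF v w])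
  have d': "d' \<in> Vh \<Omega> T" unfolding d'_def by (rule Vh_lincomb[OF d d])
  have "tau_inner d' d' = (-1) * tau_inner d d' + 0 * tau_inner d d'"
    unfolding d'_def by (rule tau_inner_lincomb[OF d d d'[unfolded d'_def]])
  also have "tau_inner d d' = tau_inner d' d"
    by (rule tau_inner_commute)
  also have "tau_inner d' d = (-1) * tau_inner d d + 0 * tau_inner d d"
    unfolding d'_def by (rule tau_inner_lincomb[OF d d d])
  finally have eq: "tau_inner d' d' = tau_inner d d" by simp
  have "tau_norm A \<Omega> \<tau> d = tau_norm A \<Omega> \<tau> d'"
  proof (rule power2_eq_imp_eq)
    show "(tau_norm A \<Omega> \<tau> d)\<^sup>2 = (tau_norm A \<Omega> \<tau> d')\<^sup>2"
      unfolding tau_norm_sq(1)[OF d] tau_norm_sq(1)[OF d'] eq ..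
  qed (rule tau_norm_sq(3), fact)+
  then show ?thesis
    by (simp add: d_def d'_def)
qed

lemma tau_norm_zero: "tau_norm A \<Omega> \<tau> (\<lambda>_. 0) = 0"
  using tau_norm_sq(1)[OF zero_in_Vh] forms_zero_left(1) by simp

lemma outer_energy_zero:
  assumes "\<And>K x. K \<in> T - layers S k \<Longrightarrow> x \<in> K \<Longrightarrow> v x = 0"
  shows "outer_energy S k v = 0"
  unfolding outer_energy_def
proof (rule sum.neutral, rule ballI)
  fix K assume K: "K \<in> T - layers S k"
  then show "(elem_norm K v)\<^sup>2 = 0"
    using elem_norm_zero[of K v] assms[OF K] by simp
qed

lemma outer_energy_le_tau_norm:
  assumes "v \<in> Vh \<Omega> T"
  shows "outer_energy S k v \<le> (tau_norm A \<Omega> \<tau> v)\<^sup>2"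
  unfolding outer_energy_def tau_norm_sq(2)[OF assms]
  by (intro sum_mono2 finite_mesh) auto

text \<open>In the first time step the recursion has no history: the initial values and the data vanish where the test
  function does not. This is the case of zero old values in the decay estimate.\<close>

lemma global_solution_decay:
  assumes S: "S \<subseteq> T" and h: "0 < h"
    and g: "\<And>k. ess_supp \<Omega> (g k) \<subseteq> closure (\<Union>S)"
    and fh: "\<And>k. fe_approximation \<Omega> T (\<Union>S) (g k) (fh k)"
    and u: "crank_nicolson A \<tau> \<Omega> (Vh \<Omega> T) fh u"
    and init: "u 0 \<in> Vh_on \<Omega> T (\<Union>S)" "u 1 \<in> Vh_on \<Omega> T (\<Union>S)"
    and B: "\<And>j. j \<le> n \<Longrightarrow> tau_norm A \<Omega> \<tau> (mid u j) \<le> B" and j: "j \<le> n"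
  shows "outer_energy S k (mid u j)
    \<le> (3 * cutoff_const / (1 + 3 * cutoff_const)) ^ k * (1 + 2 * real k) ^ j * B\<^sup>2"
proof -
  have uV: "u k \<in> Vh \<Omega> T" for k
    using u by (simp add: crank_nicolson_def)
  have midV: "mid u k \<in> Vh \<Omega> T" for k
    using uV by (rule mid_in_Vh)
  have fhV: "fh k \<in> Vh \<Omega> T" for k
    using fh[of k] by (simp add: fe_approximation_def)
  have clo: "closure (\<Union>S) = (\<Union>K\<in>S. closure K)"
    using patch_layers(1)[OF S, of 0] by (simp add: patch_iter_def)
  have init0: "u 0 x = 0" "u 1 x = 0" if "K \<in> T - S" "x \<in> K" for K x
    using init that unfolding Vh_on_iff[OF S clo] by blast+
  then have mid0: "mid u 0 x = 0" if "K \<in> T - S" "x \<in> K" for K x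
    using that by (simp add: mid_def)
  have scheme: "L2_inner \<Omega> (diff2 \<tau> u n) v + energy_form A \<Omega> (avg3 u n) v = 0"
    if v: "v \<in> Vh \<Omega> T" "\<And>K z. K \<in> S \<Longrightarrow> z \<in> closure K \<Longrightarrow> v z = 0" and n: "1 \<le> n" for v n
  proof -
    have "L2_inner \<Omega> (fh k) v = 0" for k
      by (rule data_vanishes[OF S g fh v])
    then have "L2_inner \<Omega> (avg3 fh n) v = 0"
      by (simp add: mass_avg3[OF fhV v(1)])
    then show ?thesis
      using u v(1) n by (simp add: crank_nicolson_def)
  qed
  show ?thesis
  proof (rule layer_time_recursion[where E = "\<lambda>j k. outer_energy S k (mid u j)" and m = n])
    show "outer_energy S k (mid u 0) = 0" for k
    proof (rule outer_energy_zero)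
      fix K x assume "K \<in> T - layers S k" "x \<in> K"
      then show "mid u 0 x = 0"
        using mid0[of K x] layers_increasing[OF S, of k] by blast
    qed
    show "outer_energy S (Suc k) (mid u 1)
        \<le> 3 * cutoff_const / (1 + 3 * cutoff_const) * outer_energy S k (mid u 1)" for k
    proof -
      have "tau_inner (mid u 1) v = explicit_form (\<lambda>_. 0) v - tau_inner (\<lambda>_. 0) v"
        if v: "v \<in> Vh \<Omega> T" "\<And>K z. K \<in> S \<Longrightarrow> z \<in> closure K \<Longrightarrow> v z = 0" for v
      proof -
        have v0: "v z = 0" if "K \<in> S" "z \<in> K" for K z
          using v(2)[of K z] that closure_subset by blast
        have "tau_inner (mid u 1) v = 2 * L2_inner \<Omega> (u 1) v - tau_inner (mid u 0) v"
          by (rule midpoint_recursion(2)[OF uV v(1) scheme[OF v]])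
        also have "L2_inner \<Omega> (u 1) v = 0"
          by (rule forms_zero_disjoint(1)[OF uV v(1) init0(2) v0])
        also have "tau_inner (mid u 0) v = 0"
          by (rule forms_zero_disjoint(2)[OF midV v(1) mid0 v0])
        finally show ?thesis by (simp add: forms_zero_left)
      qed
      from outer_energy_decay[where k = k, OF S h midV zero_in_Vh zero_in_Vh this]
      show ?thesis
        using outer_energy_zero[of S k "\<lambda>_. 0"] by simp
    qed
    show "outer_energy S (Suc k) (mid u (n + 2)) \<le> 3 * cutoff_const / (1 + 3 * cutoff_const) *
        (outer_energy S k (mid u (n + 2)) + 2 * outer_energy S k (mid u (n + 1)) + outer_energy S k (mid u n))"
      for n k
      by (rule outer_energy_decay[OF S h midV midV midV])
        (rule midpoint_recursion(1)[OF uV _ scheme])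
    show "outer_energy S 0 (mid u i) \<le> B\<^sup>2" if "i \<le> n" for i
      using outer_energy_le_tau_norm[OF midV[of i], of S 0] power_mono[OF B[OF that] tau_norm_sq(3)[OF midV], of 2]
      by linarith
    show "0 \<le> 3 * cutoff_const / (1 + 3 * cutoff_const)"
      using cutoff_const_ge_1[OF h] by simp
  qed (use j in auto)
qed

text \<open>In the local space, integrals over the patch agree with integrals over the domain. So the difference of
  the two solutions satisfies the homogeneous scheme for local test functions, with initial values zero.\<close>

lemma localized_error:
  assumes S: "S \<subseteq> T" and h: "0 < h"
    and g: "\<And>k. ess_supp \<Omega> (g k) \<subseteq> closure (\<Union>S)"
    and fh: "\<And>k. fe_approximation \<Omega> T (\<Union>S) (g k) (fh k)"
    and u: "crank_nicolson A \<tau> \<Omega> (Vh \<Omega> T) fh u"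
    and init: "u 0 \<in> Vh_on \<Omega> T (\<Union>S)" "u 1 \<in> Vh_on \<Omega> T (\<Union>S)"
    and ut: "crank_nicolson A \<tau> (patch_iter T (Suc k) (\<Union>S)) (Vh_on \<Omega> T (patch_iter T (Suc k) (\<Union>S))) fh ut"
    and same: "ut 0 = u 0" "ut 1 = u 1"
    and \<gamma>: "1 / 2 \<le> \<gamma>" "3 * cutoff_const / (1 + 3 * cutoff_const) \<le> \<gamma>\<^sup>2"
  shows "tau_norm A \<Omega> \<tau> (\<lambda>x. mid ut n x - mid u n x)
    \<le> 18 * cutoff_const * (3 * sqrt (real (Suc k))) ^ n * \<gamma> ^ Suc k * (MAX j\<in>{..n}. tau_norm A \<Omega> \<tau> (mid u j))"
proof -
  let ?n = "tau_norm A \<Omega> \<tau>"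
  define R where "R = layers S (Suc k)"
  define X where "X = patch_iter T (Suc k) (\<Union>S)"
  define B where "B = (MAX j\<in>{..n}. ?n (mid u j))"
  define y where "y = 3 * sqrt (real (Suc k))"
  define \<rho> where "\<rho> = 3 * cutoff_const / (1 + 3 * cutoff_const)"
  have c: "1 \<le> cutoff_const" by (rule cutoff_const_ge_1[OF h])
  have uV: "u j \<in> Vh \<Omega> T" for j
    using u by (simp add: crank_nicolson_def)
  have midV: "mid u j \<in> Vh \<Omega> T" for j
    using uV by (rule mid_in_Vh)
  have B: "?n (mid u j) \<le> B" if "j \<le> n" for j
    unfolding B_def using that by (intro Max_ge) auto
  have B0: "0 \<le> B"
    using B[of 0] tau_norm_sq(3)[OF midV[of 0]] by simp
  have y3: "3 \<le> y" and y2: "1 + 2 * real k \<le> y\<^sup>2" by (simp_all add: y_def power_mult_distrib)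
  have outer: "sqrt (outer_energy S k (mid u j)) \<le> 2 * (\<gamma> ^ Suc k * y ^ j * B)" if j: "j \<le> n" for j
  proof -
    have \<rho>0: "0 \<le> \<rho>" using c by (simp add: \<rho>_def)
    have "outer_energy S k (mid u j) \<le> \<rho> ^ k * (1 + 2 * real k) ^ j * B\<^sup>2"
      unfolding \<rho>_def using global_solution_decay[OF S h g fh u init B j] .
    also have "\<dots> \<le> (\<gamma>\<^sup>2) ^ k * (y\<^sup>2) ^ j * B\<^sup>2"
      using \<gamma>(2) \<rho>0 y2 by (intro mult_right_mono mult_mono power_mono) (auto simp: \<rho>_def)
    also have "\<dots> = (\<gamma> ^ k * y ^ j * B)\<^sup>2"
      by (simp only: power_mult_distrib power_mult[symmetric] mult.commute[of 2])
    finally have "sqrt (outer_energy S k (mid u j)) \<le> \<gamma> ^ k * y ^ j * B"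
      using \<gamma>(1) y3 B0 by (intro real_le_lsqrt) auto
    \<comment> \<open>The truncation leaves the last layer of the patch free, so one power of \<open>\<gamma>\<close> is missing; it costs a factor 2.\<close>
    also have "\<dots> \<le> 2 * \<gamma> * (\<gamma> ^ k * y ^ j * B)"
      using \<gamma>(1) y3 B0 mult_right_mono[of 1 "2 * \<gamma>" "\<gamma> ^ k * y ^ j * B"] by simp
    finally show ?thesis by (simp add: mult_ac)
  qed
  have R: "R \<subseteq> T" unfolding R_def by (rule layers_subset[OF S])
  have clX: "closure X = (\<Union>K\<in>R. closure K)"
    unfolding X_def R_def by (rule patch_layers(1)[OF S])
  have X_eq: "X = interior (\<Union>K\<in>R. closure K)"
    unfolding X_def R_def by (rule patch_layers(2)[OF S])
  have X: "\<Union>R \<subseteq> X" "X \<subseteq> (\<Union>K\<in>R. closure K)" "X \<in> sets lebesgue"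
  proof -
    have "open (\<Union>R)" using R element_open by (intro open_Union) blast
    moreover have "\<Union>R \<subseteq> (\<Union>K\<in>R. closure K)" using closure_subset by blast
    ultimately show "\<Union>R \<subseteq> X" unfolding X_eq by (intro interior_maximal)
    show "X \<subseteq> (\<Union>K\<in>R. closure K)" unfolding X_eq by (rule interior_subset)
    show "X \<in> sets lebesgue" unfolding X_eq by simp
  qed
  have local_iff: "w \<in> Vh_on \<Omega> T X \<longleftrightarrow> w \<in> Vh \<Omega> T \<and> (\<forall>K\<in>T - R. \<forall>z\<in>K. w z = 0)" for w
    by (rule Vh_on_iff[OF R clX])
  have utX: "ut j \<in> Vh_on \<Omega> T X" for j
    using ut by (simp add: crank_nicolson_def X_def)
  then have utV: "ut j \<in> Vh \<Omega> T" and ut0: "\<And>K z. K \<in> T - R \<Longrightarrow> z \<in> K \<Longrightarrow> ut j z = 0" for j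
    using local_iff by blast+
  have midtV: "mid ut j \<in> Vh \<Omega> T" for j
    using utV by (rule mid_in_Vh)
  have midt0: "mid ut j z = 0" if "K \<in> T - R" "z \<in> K" for j K z
    using ut0[OF that] by (simp add: mid_def)
  have fhV: "fh j \<in> Vh \<Omega> T" for j
    using fh[of j] by (simp add: fe_approximation_def)
  define e where "e j x = ut j x - u j x" for j x
  have eV: "e j \<in> Vh \<Omega> T" for j
    using Vh_lincomb[OF utV[of j] uV[of j], of 1 "-1"] by (simp add: e_def[abs_def])
  have mid_e: "mid e j = (\<lambda>x. mid ut j x - mid u j x)" for j
    by (simp add: fun_eq_iff mid_def e_def field_simps)
  have scheme: "L2_inner \<Omega> (diff2 \<tau> e m) w + energy_form A \<Omega> (avg3 e m) w = 0"
    if w: "w \<in> Vh \<Omega> T" and w0: "\<And>K z. K \<in> T - R \<Longrightarrow> z \<in> K \<Longrightarrow> w z = 0" and m: "1 \<le> m" for w m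
  proof -
    have d: "diff2 \<tau> e m = (\<lambda>x. 1 * diff2 \<tau> ut m x + (-1) * diff2 \<tau> u m x)"
      and a: "avg3 e m = (\<lambda>x. 1 * avg3 ut m x + (-1) * avg3 u m x)"
      by (auto simp: diff2_def avg3_def e_def algebra_simps diff_divide_distrib add_divide_distrib)
    have "w \<in> Vh_on \<Omega> T X" using local_iff w w0 by blast
    then have "L2_inner X (diff2 \<tau> ut m) w + energy_form A X (avg3 ut m) w = L2_inner X (avg3 fh m) w"
      using ut m by (simp add: crank_nicolson_def X_def)
    then have "L2_inner \<Omega> (diff2 \<tau> ut m) w + energy_form A \<Omega> (avg3 ut m) w = L2_inner \<Omega> (avg3 fh m) w"
      using forms_region_eq_domain[OF R X diff2_in_Vh[OF utV] w w0] forms_region_eq_domain[OF R X avg3_in_Vh[OF utV] w w0]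
        forms_region_eq_domain[OF R X avg3_in_Vh[OF fhV] w w0] by simp
    moreover have "L2_inner \<Omega> (diff2 \<tau> u m) w + energy_form A \<Omega> (avg3 u m) w = L2_inner \<Omega> (avg3 fh m) w"
      using u m w by (simp add: crank_nicolson_def)
    ultimately show ?thesis
      unfolding d a mass_domain_lincomb[OF diff2_in_Vh[OF utV] diff2_in_Vh[OF uV] w]
        energy_domain_lincomb[OF avg3_in_Vh[OF utV] avg3_in_Vh[OF uV] w] by simp
  qed
  have e01: "e 0 = (\<lambda>_. 0)" "e 1 = (\<lambda>_. 0)" and mid_e0: "mid e 0 = (\<lambda>_. 0)"
    using same by (simp_all add: e_def[abs_def] mid_def)
  have "?n (mid e n) \<le> 9 / 2 * (4 * cutoff_const * \<gamma> ^ Suc k * B) * y ^ n"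
  proof (rule geometric_time_recursion[where m = n and X = "\<lambda>j. ?n (mid e j)"])
    show "?n (mid e 0) \<le> 0"
      by (simp add: mid_e0 tau_norm_zero)
    show "?n (mid e 1) \<le> 4 * cutoff_const * \<gamma> ^ Suc k * B * y" if "1 \<le> n"
    proof -
      have "?n (mid e 1) \<le> 2 * (cutoff_const * sqrt (outer_energy S k (mid u 1))) + 2 * ?n (\<lambda>_. 0) + ?n (\<lambda>_. 0)"
      proof (rule error_step[OF S h midV[of 1] midtV[of 1] _ mid_e zero_in_Vh zero_in_Vh])
        show "mid ut 1 z = 0" if "K \<in> T - layers S (Suc k)" "z \<in> K" for K z
          using midt0 that unfolding R_def by blast
        fix w assume w: "w \<in> Vh \<Omega> T" "\<And>K z. K \<in> T - layers S (Suc k) \<Longrightarrow> z \<in> K \<Longrightarrow> w z = 0"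
        have "tau_inner (mid e 1) w = 2 * L2_inner \<Omega> (e 1) w - tau_inner (mid e 0) w"
          by (rule midpoint_recursion(2)[OF eV w(1) scheme[OF w(1) w(2)[folded R_def]]])
        then show "tau_inner (mid e 1) w = explicit_form (\<lambda>_. 0) w - tau_inner (\<lambda>_. 0) w"
          unfolding e01 mid_e0 by (simp add: forms_zero_left)
      qed
      also have "\<dots> = 2 * (cutoff_const * sqrt (outer_energy S k (mid u 1)))"
        by (simp add: tau_norm_zero)
      also have "\<dots> \<le> 2 * (cutoff_const * (2 * (\<gamma> ^ Suc k * y ^ 1 * B)))"
        using c by (intro mult_left_mono outer[OF that]) auto
      finally show ?thesis by (simp add: mult_ac)
    qed
    show "?n (mid e (j + 2)) \<le> 4 * cutoff_const * \<gamma> ^ Suc k * B * y ^ (j + 2)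
        + 2 * ?n (mid e (j + 1)) + ?n (mid e j)" if j: "j + 2 \<le> n" for j
    proof -
      have "?n (mid e (j + 2)) \<le> 2 * (cutoff_const * sqrt (outer_energy S k (mid u (j + 2))))
          + 2 * ?n (mid e (j + 1)) + ?n (mid e j)"
      proof (rule error_step[OF S h midV[of "j + 2"] midtV[of "j + 2"] _ mid_e mid_in_Vh[OF eV] mid_in_Vh[OF eV]])
        show "mid ut (j + 2) z = 0" if "K \<in> T - layers S (Suc k)" "z \<in> K" for K z
          using midt0 that unfolding R_def by blast
        fix w assume w: "w \<in> Vh \<Omega> T" "\<And>K z. K \<in> T - layers S (Suc k) \<Longrightarrow> z \<in> K \<Longrightarrow> w z = 0"
        show "tau_inner (mid e (j + 2)) w = explicit_form (mid e (j + 1)) w - tau_inner (mid e j) w"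
          by (rule midpoint_recursion(1)[OF eV w(1) scheme[OF w(1) w(2)[folded R_def]]])
      qed
      moreover have "2 * (cutoff_const * sqrt (outer_energy S k (mid u (j + 2))))
          \<le> 2 * (cutoff_const * (2 * (\<gamma> ^ Suc k * y ^ (j + 2) * B)))"
        using c by (intro mult_left_mono outer[OF j]) auto
      moreover have "2 * (cutoff_const * (2 * (\<gamma> ^ Suc k * y ^ (j + 2) * B)))
          = 4 * cutoff_const * \<gamma> ^ Suc k * B * y ^ (j + 2)"
        by (simp only: mult_ac)
      ultimately show ?thesis by linarith
    qed
    show "0 \<le> 4 * cutoff_const * \<gamma> ^ Suc k * B"
      using c \<gamma>(1) B0 by simp
  qed (use y3 in auto)
  also have "\<dots> = 18 * cutoff_const * y ^ n * \<gamma> ^ Suc k * B"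
    by (simp add: mult_ac)
  finally show ?thesis
    unfolding mid_e B_def y_def .
qed

end

theorem theorem3p2:
  fixes \<alpha> \<beta> \<kappa> \<sigma> :: real
  assumes "0 < \<alpha>" and "\<alpha> \<le> \<beta>" and "0 < \<kappa>" and "0 < \<sigma>"
  shows "\<exists>(C :: real) (c1 :: real) (c2 :: real) (Cth :: real \<Rightarrow> real \<Rightarrow> real).
    0 < C \<and> 0 < c1 \<and> 0 < c2 \<and>
    (\<forall>\<tau>>0. \<forall>h>0.
       c1 * (\<beta> / \<alpha> * (\<tau> / h + h / \<tau>)) \<le> Cth \<tau> h \<and>
       Cth \<tau> h \<le> c2 * (\<beta> / \<alpha> * (\<tau> / h + h / \<tau>))) \<and>
    (\<forall>(\<Omega> :: (real^'d) set) A tfin f h T \<tau> fh \<omega> u l ut.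
       lipschitz_polytope \<Omega> \<longrightarrow> 1 / \<kappa> \<le> diameter \<Omega> \<longrightarrow> diameter \<Omega> \<le> \<kappa> \<longrightarrow>
       A \<in> borel_measurable (lebesgue_on \<Omega>) \<longrightarrow>
       (AE x in lebesgue_on \<Omega>. \<alpha> \<le> A x \<and> A x \<le> \<beta>) \<longrightarrow>
       0 < tfin \<longrightarrow> Linf_L2 tfin \<Omega> f \<longrightarrow>
       regular_mesh \<Omega> \<sigma> h T \<longrightarrow> 0 < \<tau> \<longrightarrow>
       (\<exists>S\<subseteq>T. \<omega> = \<Union>S) \<longrightarrow>
       (\<forall>t\<ge>0. f t \<in> L2 \<Omega> \<and> ess_supp \<Omega> (f t) \<subseteq> closure \<omega>) \<longrightarrow>
       (\<forall>k. fe_approximation \<Omega> T \<omega> (f (real k * \<tau>)) (fh k)) \<longrightarrow>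
       crank_nicolson A \<tau> \<Omega> (Vh \<Omega> T) fh u \<longrightarrow>
       u 0 \<in> Vh_on \<Omega> T \<omega> \<longrightarrow> u 1 \<in> Vh_on \<Omega> T \<omega> \<longrightarrow>
       1 \<le> l \<longrightarrow>
       crank_nicolson A \<tau> (patch_iter T l \<omega>) (Vh_on \<Omega> T (patch_iter T l \<omega>)) fh ut \<longrightarrow>
       ut 0 = u 0 \<longrightarrow> ut 1 = u 1 \<longrightarrow>
       (let \<gamma> = sqrt ((Cth \<tau> h + 1/2) / (1 + Cth \<tau> h)) in
          0 < \<gamma> \<and> \<gamma> < 1 \<and>
          (\<forall>n. tau_norm A \<Omega> \<tau> (\<lambda>x. mid ut n x - mid u n x)
                 = tau_norm A \<Omega> \<tau> (\<lambda>x. mid u n x - mid ut n x) \<and>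
               tau_norm A \<Omega> \<tau> (\<lambda>x. mid ut n x - mid u n x)
                 \<le> C * Cth \<tau> h * (9 * real l) powr (real n / 2) * \<gamma> ^ l
                     * (MAX k\<in>{..n}. tau_norm A \<Omega> \<tau> (mid u k)))))"
proof -
  let ?t = "trunc_const CARD('d) \<sigma> \<beta>"
  define Cth :: "real \<Rightarrow> real \<Rightarrow> real" where "Cth \<tau> h = 2 * (?t * (\<tau> / h + h / \<tau>))" for \<tau> h
  define c1 where "c1 = 2 * ?t * (\<alpha> / \<beta>)"
  have \<beta>: "0 < \<beta>" using assms by simp
  have t: "1 \<le> ?t" using trunc_const_ge_1[of "CARD('d)" \<beta> \<sigma>] \<beta> by simp
  have Cth_eq: "c1 * (\<beta> / \<alpha> * (\<tau> / h + h / \<tau>)) = Cth \<tau> h" for \<tau> h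
  proof -
    have "c1 * (\<beta> / \<alpha> * (\<tau> / h + h / \<tau>)) = 2 * (?t * (\<tau> / h + h / \<tau>)) * (\<alpha> / \<beta> * (\<beta> / \<alpha>))"
      by (simp only: c1_def mult_ac)
    also have "\<alpha> / \<beta> * (\<beta> / \<alpha>) = 1" using assms \<beta> by simp
    finally show ?thesis by (simp add: Cth_def)
  qed
  have main: "let \<gamma> = sqrt ((Cth \<tau> h + 1/2) / (1 + Cth \<tau> h)) in
          0 < \<gamma> \<and> \<gamma> < 1 \<and>
          (\<forall>n. tau_norm A \<Omega> \<tau> (\<lambda>x. mid ut n x - mid u n x)
                 = tau_norm A \<Omega> \<tau> (\<lambda>x. mid u n x - mid ut n x) \<and>
               tau_norm A \<Omega> \<tau> (\<lambda>x. mid ut n x - mid u n x)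
                 \<le> 18 * Cth \<tau> h * (9 * real l) powr (real n / 2) * \<gamma> ^ l
                     * (MAX k\<in>{..n}. tau_norm A \<Omega> \<tau> (mid u k)))"
    if "lipschitz_polytope \<Omega>" and diam: "1 / \<kappa> \<le> diameter \<Omega>"
      and "A \<in> borel_measurable (lebesgue_on \<Omega>)" "AE x in lebesgue_on \<Omega>. \<alpha> \<le> A x \<and> A x \<le> \<beta>"
      and "regular_mesh \<Omega> \<sigma> h T" "0 < \<tau>" and "\<exists>S\<subseteq>T. \<omega> = \<Union>S"
      and f: "\<forall>t\<ge>0. f t \<in> L2 \<Omega> \<and> ess_supp \<Omega> (f t) \<subseteq> closure \<omega>"
      and fh: "\<forall>k. fe_approximation \<Omega> T \<omega> (f (real k * \<tau>)) (fh k)"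
      and u: "crank_nicolson A \<tau> \<Omega> (Vh \<Omega> T) fh u" "u 0 \<in> Vh_on \<Omega> T \<omega>" "u 1 \<in> Vh_on \<Omega> T \<omega>"
      and l: "1 \<le> l"
      and ut: "crank_nicolson A \<tau> (patch_iter T l \<omega>) (Vh_on \<Omega> T (patch_iter T l \<omega>)) fh ut"
        "ut 0 = u 0" "ut 1 = u 1"
    for \<Omega> :: "(real^'d) set" and A f h T \<tau> fh \<omega> u l ut
  proof -
    interpret wave_mesh \<Omega> \<sigma> h T A \<alpha> \<beta> \<tau>
      using that assms \<beta> by unfold_locales auto
    obtain S where S: "S \<subseteq> T" "\<omega> = \<Union>S" using \<open>\<exists>S\<subseteq>T. \<omega> = \<Union>S\<close> by blast
    obtain k where k: "l = Suc k" using l by (cases l) auto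
    have "0 < diameter \<Omega>"
      using diam \<open>0 < \<kappa>\<close> by (meson divide_pos_pos less_le_trans zero_less_one)
    then have "\<Omega> \<noteq> {}" by auto
    then obtain K where "K \<in> T"
      using domain_region(2) by blast
    then have h: "0 < h" by (rule mesh_size_pos)
    define \<gamma> where "\<gamma> = sqrt ((Cth \<tau> h + 1/2) / (1 + Cth \<tau> h))"
    have c: "1 \<le> cutoff_const" by (rule cutoff_const_ge_1[OF h])
    have C: "Cth \<tau> h = 2 * cutoff_const" by (simp add: Cth_def cutoff_const_def)
    have \<gamma>2: "\<gamma>\<^sup>2 = (2 * cutoff_const + 1/2) / (1 + 2 * cutoff_const)"
      using c by (simp add: \<gamma>_def C)
    have \<gamma>0: "0 < \<gamma>" using c by (simp add: \<gamma>_def C)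
    have "\<gamma> < 1" using c by (simp add: \<gamma>_def C)
    have "(1 / 2)\<^sup>2 \<le> \<gamma>\<^sup>2"
      using c unfolding \<gamma>2 by (simp add: field_simps power2_eq_square)
    then have \<gamma>_half: "1 / 2 \<le> \<gamma>"
      by (rule power2_le_imp_le) (use \<gamma>0 in simp)
    have rate: "3 * cutoff_const / (1 + 3 * cutoff_const) \<le> \<gamma>\<^sup>2"
      using c unfolding \<gamma>2 by (simp add: field_simps)
    have sym: "tau_norm A \<Omega> \<tau> (\<lambda>x. mid ut n x - mid u n x) = tau_norm A \<Omega> \<tau> (\<lambda>x. mid u n x - mid ut n x)" for n
      using u(1) ut(1) by (intro tau_norm_minus_commute mid_in_Vh) (auto simp: crank_nicolson_def Vh_on_def)
    have bound: "tau_norm A \<Omega> \<tau> (\<lambda>x. mid ut n x - mid u n x)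
        \<le> 18 * Cth \<tau> h * (9 * real l) powr (real n / 2) * \<gamma> ^ l * (MAX k\<in>{..n}. tau_norm A \<Omega> \<tau> (mid u k))" for n
    proof -
      let ?B = "MAX k\<in>{..n}. tau_norm A \<Omega> \<tau> (mid u k)"
      have uV: "u j \<in> Vh \<Omega> T" for j
        using u(1) by (simp add: crank_nicolson_def)
      have "tau_norm A \<Omega> \<tau> (mid u 0) \<le> ?B" by (intro Max_ge) auto
      moreover have "mid u 0 \<in> Vh \<Omega> T" by (rule mid_in_Vh) (rule uV)
      ultimately have B0: "0 \<le> ?B"
        using tau_norm_sq(3)[of "mid u 0"] by linarith
      have pow: "(9 * real l) powr (real n / 2) = (3 * sqrt (real (Suc k))) ^ n"
      proof -
        have "(9 * real l) powr (real n / 2) = ((9 * real l) powr (1 / 2)) powr real n"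
          by (simp add: powr_powr)
        also have "(9 * real l) powr (1 / 2) = 3 * sqrt (real (Suc k))"
        proof -
          have "sqrt (9::real) = 3" by (rule real_sqrt_unique) simp_all
          then show ?thesis
            unfolding k by (subst powr_half_sqrt, simp) (simp only: real_sqrt_mult)
        qed
        also have "(3 * sqrt (real (Suc k))) powr real n = (3 * sqrt (real (Suc k))) ^ n"
          by (rule powr_realpow) simp
        finally show ?thesis .
      qed
      have "ess_supp \<Omega> (f (real j * \<tau>)) \<subseteq> closure (\<Union>S)" for j
        using f S(2) \<open>0 < \<tau>\<close> by simp
      then have "tau_norm A \<Omega> \<tau> (\<lambda>x. mid ut n x - mid u n x)
          \<le> 18 * cutoff_const * (3 * sqrt (real (Suc k))) ^ n * \<gamma> ^ Suc k * ?B"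
        using fh u ut unfolding S(2) k
        by (intro localized_error[where g = "\<lambda>j. f (real j * \<tau>)", OF S(1) h _ _ _ _ _ _ _ _ \<gamma>_half rate]) auto
      also have "\<dots> \<le> 18 * Cth \<tau> h * (3 * sqrt (real (Suc k))) ^ n * \<gamma> ^ Suc k * ?B"
        using B0 \<gamma>0 c unfolding C by (intro mult_right_mono) auto
      finally show ?thesis unfolding pow unfolding k .
    qed
    show ?thesis
      unfolding Let_def \<gamma>_def[symmetric] using \<gamma>0 \<open>\<gamma> < 1\<close> sym bound by blast
  qed
  have "0 < c1" using t assms \<beta> by (simp add: c1_def)
  show ?thesis
  proof (rule exI[of _ 18], rule exI[of _ c1], rule exI[of _ c1], rule exI[of _ Cth], intro conjI)
    show "\<forall>\<tau>>0. \<forall>h>0. c1 * (\<beta> / \<alpha> * (\<tau> / h + h / \<tau>)) \<le> Cth \<tau> h \<and>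
        Cth \<tau> h \<le> c1 * (\<beta> / \<alpha> * (\<tau> / h + h / \<tau>))"
      by (simp only: Cth_eq order_refl simp_thms)
  qed ((simp, fact, fact), intro allI impI, rule main, assumption+)
qed


end
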